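(* Let $k\in\mathbb{N}$ and let $\mathcal{A}$ and $\mathcal{C}$ be SD-barriers with $\operatorname{ht}(\mathcal{A})=\alpha$, $\operatorname{ht}(\mathcal{C})=\gamma$ and $\operatorname{base}(\mathcal{A})$ a final segment of $\operatorname{base}(\mathcal{C})$. Then there exists an SD-barrier $\mathcal{B}$ with $\operatorname{base}(\mathcal{B})=\operatorname{base}(\mathcal{A})$ and $\operatorname{ht}(\mathcal{B})\le\varphi_{\log\gamma}(\alpha)$ such that: for every $(\mathbb{1}\oplus\mathcal{B})$-size $s$ and every $c:[s]^{\mathbb{1}\oplus\mathcal{C}}\to\{0,\dots,k-1\}$ there is a $(\mathbb{1}\oplus\mathcal{C}\oplus\mathcal{A})$-size $t\subseteq s$ such that for all $u\in[t]^{\mathbb{1}\oplus\mathcal{C}}$ the value $c(u)$ depends only on $\min u$ (i.e. on the one-element initial segment of $u$).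
   Context: Veblen functions: $\varphi_0(\beta)=\omega^\beta$, for $\delta>0$ $\varphi_\delta$ enumerates the common fixed points of all $\varphi_{\delta'}$, $\delta'<\delta$. If $\gamma=\omega^{\delta_0}+\dots+\omega^{\delta_n}$ (Cantor normal form), $\varphi_{\log\gamma}=\varphi_{\delta_0}\circ\dots\circ\varphi_{\delta_n}$; $\varphi_{\log 0}$ is the identity. Finite subsets of $\mathbb{N}$ are identified with strictly increasing sequences; $\sqsubset$ proper initial segment; $s^\frown t$ concatenation. A set $\mathcal{B}\subseteq[\mathbb{N}]^{<\omega}$ is a front if either $\mathcal{B}=\{\langle\rangle\}$ (degenerate, base $\mathbb{N}$) or: (1) $\operatorname{base}(\mathcal{B})=\bigcup\mathcal{B}$ infinite; (2) every infinite $X\subseteq\operatorname{base}(\mathcal{B})$ has $s\in\mathcal{B}$ with $s\sqsubset X$; (3) no $s,t\in\mathcal{B}$ with $s\sqsubset t$. Barrier: front with no $s\subsetneq t$ in it. Smooth: for $s,t\in\mathcal{B}$ with $|s|<|t|$ some $i<|s|$ has $s(i)<t(i)$. $T(\mathcal{B})$: finite subsets of the base with no proper initial segment in $\mathcal{B}$; $\operatorname{ht}_{\mathcal{B}}$ its rank ($0$ on $\mathcal{B}$, else $\sup(\operatorname{ht}_{\mathcal{B}}(s^\frown\langle n\rangle)+1)$); $\operatorname{ht}(\mathcal{B})=\operatorname{ht}_{\mathcal{B}}(\langle\rangle)$. $Y$ is a final segment of $X$ if $Y=\{n\in X:n\ge m\}$; if $\operatorname{base}(\mathcal{B})$ is a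 final segment of $\operatorname{base}(\mathcal{A})$, $\mathcal{A}\oplus\mathcal{B}=\{s^\frown t:s\in\mathcal{B},t\in\mathcal{A},\max s<\min t\}$. A smooth barrier of height $\omega^{\beta_0}+\dots+\omega^{\beta_{n-1}}$ (CNF) is decomposable if it equals $\mathcal{B}_0\oplus\dots\oplus\mathcal{B}_{n-1}$ with smooth barriers $\operatorname{ht}(\mathcal{B}_i)=\omega^{\beta_i}$; SD-barrier = smooth decomposable barrier (degenerate front counts). $t$ is $\mathcal{C}$-size if $t\in\mathcal{C}$; $[s]^{\mathcal{C}}=\{u\in\mathcal{C}:u\subseteq s\}$; $\mathbb{1}$ is the barrier of singletons $\{\langle n\rangle\}$ on the relevant base. *)

theory Defs
  imports "HOL-Library.Countable_Set" "HOL-Library.FuncSet"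
begin

text \<open>
  The cardinal successor of \<open>natLeq\<close> has order type \<open>\<omega>\<^sub>1\<close>, so this is the type of countable
  ordinals. Heights of fronts are countable and
  \<open>\<omega>\<^sub>1\<close> is closed under the operations below, so all ordinals that occur live in this type.
\<close>

typedef cordinal = "Field (cardSuc natLeq)"
  using Field_cardSuc_not_empty[OF natLeq_Card_order] by blast

lemma cardSuc_natLeq_Well_order: "Well_order (cardSuc natLeq)"
  using cardSuc_Card_order[OF natLeq_Card_order] by (simp add: card_order_on_def)

instantiation cordinal :: linorder
begin

definition less_eq_cordinal :: "cordinal \<Rightarrow> cordinal \<Rightarrow> bool" where
  "a \<le> b \<longleftrightarrow> (Rep_cordinal a, Rep_cordinal b) \<in> cardSuc natLeq"

definition less_cordinal :: "cordinal \<Rightarrow> cordinal \<Rightarrow> bool" where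
  "a < b \<longleftrightarrow> a \<le> b \<and> \<not> b \<le> (a :: cordinal)"

instance
proof
  have wo: "Refl (cardSuc natLeq)" "trans (cardSuc natLeq)" "antisym (cardSuc natLeq)"
      "Total (cardSuc natLeq)"
    using cardSuc_natLeq_Well_order
    by (auto simp: well_order_on_def linear_order_on_def partial_order_on_def preorder_on_def)
  fix x y z :: cordinal
  show "(x < y) = (x \<le> y \<and> \<not> y \<le> x)" by (simp add: less_cordinal_def)
  show "x \<le> x"
    using wo(1) Rep_cordinal[of x] by (simp add: less_eq_cordinal_def refl_on_def)
  show "x \<le> y \<Longrightarrow> y \<le> z \<Longrightarrow> x \<le> z"
    using wo(2) unfolding less_eq_cordinal_def by (meson transD)
  show "x \<le> y \<Longrightarrow> y \<le> x \<Longrightarrow> x = y"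
    using wo(3) unfolding less_eq_cordinal_def antisym_def by (metis Rep_cordinal_inject)
  show "x \<le> y \<or> y \<le> x"
  proof (cases "x = y")
    case True
    then show ?thesis using \<open>x \<le> x\<close> by simp
  next
    case False
    then show ?thesis
      using wo(4) Rep_cordinal[of x] Rep_cordinal[of y]
      unfolding less_eq_cordinal_def total_on_def by (metis Rep_cordinal_inject)
  qed
qed

end

instance cordinal :: wellorder
proof
  fix P :: "cordinal \<Rightarrow> bool" and a :: cordinal
  assume step: "\<And>x. (\<And>y. y < x \<Longrightarrow> P y) \<Longrightarrow> P x"
  have "wf (cardSuc natLeq - Id)"
    using cardSuc_natLeq_Well_order by (simp add: well_order_on_def)
  then have "wf (inv_image (cardSuc natLeq - Id) Rep_cordinal)" by (rule wf_inv_image)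
  then show "P a"
  proof (induction a rule: wf_induct_rule)
    case (less x)
    show ?case
    proof (rule step)
      fix y assume "y < x"
      then show "P y"
        using less.IH[of y] less_le[of y x]
        by (simp add: less_eq_cordinal_def in_inv_image Rep_cordinal_inject)
    qed
  qed
qed

lemma countable_cordinal_lessThan: "countable {..< (a :: cordinal)}"
proof -
  let ?r = "cardSuc natLeq"
  have sub: "Rep_cordinal ` {..<a} \<subseteq> underS ?r (Rep_cordinal a)"
    by (auto simp: underS_def less_cordinal_def less_eq_cordinal_def)
  have "(card_of (underS ?r (Rep_cordinal a)), ?r) \<in> ordLess"
    by (rule card_of_underS[OF cardSuc_Card_order[OF natLeq_Card_order] Rep_cordinal])
  then have "(card_of (underS ?r (Rep_cordinal a)), natLeq) \<in> ordLeq"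
    using cardSuc_ordLeq_ordLess[OF natLeq_Card_order card_of_Card_order] by blast
  then have "(card_of (underS ?r (Rep_cordinal a)), card_of (UNIV :: nat set)) \<in> ordLeq"
    using card_of_nat ordIso_symmetric ordLeq_ordIso_trans by blast
  then have "countable (underS ?r (Rep_cordinal a))"
    by (metis card_of_ordLeq countable_def subset_UNIV)
  then have "countable (Rep_cordinal ` {..<a})" using sub countable_subset by blast
  then show ?thesis
    by (rule countable_image_inj_on) (simp add: inj_on_def Rep_cordinal_inject)
qed

lemma uncountable_cordinal: "uncountable (UNIV :: cordinal set)"
proof
  assume "countable (UNIV :: cordinal set)"
  then have "countable (range Rep_cordinal)" by (rule countable_image)
  then have "countable (Field (cardSuc natLeq))"
    using type_definition.Rep_range[OF type_definition_cordinal] by simp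
  then have "(card_of (Field (cardSuc natLeq)), card_of (UNIV :: nat set)) \<in> ordLeq"
    by (metis card_of_ordLeq countable_def subset_UNIV)
  then have "(cardSuc natLeq, natLeq) \<in> ordLeq"
    using card_of_nat card_of_Field_ordIso[OF cardSuc_Card_order[OF natLeq_Card_order]]
    by (meson ordIso_ordLeq_trans ordIso_symmetric ordLeq_ordIso_trans)
  then show False
    using cardSuc_greater[OF natLeq_Card_order] not_ordLess_ordLeq by blast
qed

lemma countable_cordinal_bounded:
  fixes A :: "cordinal set"
  assumes "countable A"
  shows "\<exists>x. \<forall>a\<in>A. a < x"
proof (rule ccontr)
  assume "\<nexists>x. \<forall>a\<in>A. a < x"
  then have "UNIV \<subseteq> (\<Union>a\<in>A. insert a {..<a})" by (fastforce simp: not_less le_less)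
  moreover have "countable (\<Union>a\<in>A. insert a {..<a})"
    using assms countable_cordinal_lessThan by blast
  ultimately show False using uncountable_cordinal countable_subset by blast
qed

text \<open>
  The \<open>LEAST\<close> operators below are applied to nonempty sets of bounds by the preceding lemma.
\<close>

definition osuc :: "cordinal \<Rightarrow> cordinal" where
  "osuc a = (LEAST x. a < x)"

definition osup :: "cordinal set \<Rightarrow> cordinal" where
  "osup A = (LEAST x. \<forall>a\<in>A. a \<le> x)"

text \<open>
  Ordinal addition in the form \<open>a + b = max a (sup\<^bsub>c<b\<^esub> ((a + c) + 1))\<close>, which covers the zero,
  successor and limit clauses at once.
\<close>

function oadd :: "cordinal \<Rightarrow> cordinal \<Rightarrow> cordinal" where
  "oadd a b = (LEAST x. a \<le> x \<and> (\<forall>c\<in>{..<b}. oadd a c < x))"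
  by pat_completeness auto
termination
  by (relation "inv_image {(x, y). x < y} snd") (auto simp: wf)

declare oadd.simps [simp del]

instantiation cordinal :: monoid_add
begin

definition zero_cordinal :: cordinal where "0 = (LEAST x :: cordinal. True)"

definition plus_cordinal :: "cordinal \<Rightarrow> cordinal \<Rightarrow> cordinal" where "a + b = oadd a b"

lemma cordinal_zero_le: "0 \<le> (a :: cordinal)"
  unfolding zero_cordinal_def by (rule Least_le) simp

lemma cordinal_add_bounds:
  fixes a b :: cordinal
  shows "a \<le> a + b \<and> (\<forall>c<b. a + c < a + b)"
proof -
  have "countable (insert a ((+) a ` {..<b}))"
    using countable_cordinal_lessThan by blast
  then obtain x where x: "\<forall>y\<in>insert a ((+) a ` {..<b}). y < x"
    using countable_cordinal_bounded by blast
  let ?P = "\<lambda>x. a \<le> x \<and> (\<forall>c\<in>{..<b}. oadd a c < x)"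
  have "?P x" using x by (auto simp: plus_cordinal_def)
  then have "?P (LEAST x. ?P x)" by (rule LeastI)
  then have "?P (oadd a b)" by (subst (1 2) oadd.simps[of a b])
  then show ?thesis by (simp add: plus_cordinal_def)
qed

lemma cordinal_add_least:
  fixes a b x :: cordinal
  assumes "a \<le> x" "\<And>c. c < b \<Longrightarrow> a + c < x"
  shows "a + b \<le> x"
  unfolding plus_cordinal_def oadd.simps[of a b]
  using assms by (intro Least_le) (auto simp: plus_cordinal_def)

lemma cordinal_le_imp_add:
  fixes a x :: cordinal
  assumes "a \<le> x"
  shows "\<exists>c. x = a + c"
proof -
  have "\<exists>c. x \<le> a + c"
  proof (rule ccontr)
    assume "\<nexists>c. x \<le> a + c"
    then have below: "range ((+) a) \<subseteq> {..<x}" by (auto simp: not_le)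
    have "inj ((+) a)"
      by (rule injI) (metis cordinal_add_bounds less_irrefl neqE)
    then show False
      using below uncountable_cordinal countable_cordinal_lessThan
      by (meson countable_image_inj_on countable_subset)
  qed
  define c where "c = (LEAST c. x \<le> a + c)"
  have "x \<le> a + c" unfolding c_def using \<open>\<exists>c. x \<le> a + c\<close> by (rule LeastI_ex)
  moreover have "a + c \<le> x"
    using assms not_less_Least unfolding c_def
    by (intro cordinal_add_least) (auto simp: not_le[symmetric])
  ultimately show ?thesis by (meson order_antisym)
qed

instance
proof
  fix a b c :: cordinal
  show "a + 0 = a"
    using cordinal_zero_le cordinal_add_bounds
    by (intro order_antisym cordinal_add_least) (auto simp: not_less[symmetric])
  show "0 + a = a"
  proof (induction a rule: less_induct)
    case (less a)
    have "0 + a \<le> a" using less by (intro cordinal_add_least) (auto simp: cordinal_zero_le)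
    moreover have "\<not> 0 + a < a"
      using less cordinal_add_bounds by (metis less_irrefl)
    ultimately show ?case by simp
  qed
  show "a + b + c = a + (b + c)"
  proof (induction c rule: less_induct)
    case (less c)
    have "a + b \<le> a + (b + c)"
      using cordinal_add_bounds by (metis le_less)
    then have "a + b + c \<le> a + (b + c)"
      by (rule cordinal_add_least) (use less cordinal_add_bounds in auto)
    moreover have "a + (b + c) \<le> a + b + c"
    proof (rule cordinal_add_least)
      show "a \<le> a + b + c" using cordinal_add_bounds by (meson order_trans)
      fix e assume e: "e < b + c"
      show "a + e < a + b + c"
      proof (cases "e < b")
        case True
        then show ?thesis using cordinal_add_bounds by (meson less_le_trans)
      next
        case False
        then obtain d where d: "e = b + d" using cordinal_le_imp_add by (meson not_less)
        then have "d < c" using e cordinal_add_bounds by (metis less_asym neqE)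
        then show ?thesis using d less cordinal_add_bounds by metis
      qed
    qed
    ultimately show ?case by simp
  qed
qed

end

text \<open>
  \<open>\<omega>\<^sup>0 = 1\<close>, \<open>\<omega>\<^bsup>b+1\<^esup> = sup\<^sub>n \<omega>\<^sup>b \<cdot> n\<close>, and suprema at limits; the product \<open>\<omega>\<^sup>b \<cdot> n\<close> is the
  \<open>n\<close>-fold sum.
\<close>

function omega_pow :: "cordinal \<Rightarrow> cordinal" where
  "omega_pow b =
    (LEAST x. 0 < x \<and> (\<forall>c\<in>{..<b}. \<forall>n. sum_list (replicate n (omega_pow c)) \<le> x))"
  by pat_completeness auto
termination
  by (relation "{(x, y). x < y}") (auto simp: wf)

declare omega_pow.simps [simp del]

text \<open>The increasing enumeration of \<open>S\<close>, meant for unbounded \<open>S\<close>.\<close>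

function oenum :: "cordinal set \<Rightarrow> cordinal \<Rightarrow> cordinal" where
  "oenum S a = (LEAST x. x \<in> S \<and> (\<forall>b\<in>{..<a}. oenum S b < x))"
  by pat_completeness auto
termination
  by (relation "inv_image {(x, y). x < y} snd") (auto simp: wf)

declare oenum.simps [simp del]

function veblen :: "cordinal \<Rightarrow> cordinal \<Rightarrow> cordinal" where
  "veblen d =
    (if d = 0 then omega_pow else oenum {x. \<forall>e\<in>{..<d}. veblen e x = x})"
  by pat_completeness auto
termination
  by (relation "{(x, y). x < y}") (auto simp: wf)

declare veblen.simps [simp del]

text \<open>\<open>is_cnf [d\<^sub>0, \<dots>, d\<^sub>n] g\<close> means that \<open>g = \<omega>\<^bsup>d\<^sub>0\<^esup> + \<dots> + \<omega>\<^bsup>d\<^sub>n\<^esup>\<close> with \<open>d\<^sub>0 \<ge> \<dots> \<ge> d\<^sub>n\<close>.\<close>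

definition is_cnf :: "cordinal list \<Rightarrow> cordinal \<Rightarrow> bool" where
  "is_cnf ds g \<longleftrightarrow> sorted_wrt (\<ge>) ds \<and> g = sum_list (map omega_pow ds)"

definition cnf :: "cordinal \<Rightarrow> cordinal list" where
  "cnf g = (THE ds. is_cnf ds g)"

definition veblen_log :: "cordinal \<Rightarrow> cordinal \<Rightarrow> cordinal" where
  "veblen_log g = foldr (\<circ>) (map veblen (cnf g)) id"


definition init_seg :: "nat set \<Rightarrow> nat set \<Rightarrow> bool" (infix "\<sqsubset>" 50) where
  "s \<sqsubset> X \<longleftrightarrow> finite s \<and> s \<subset> X \<and> (\<forall>m\<in>s. \<forall>n\<in>X - s. m < n)"

definition base :: "nat set set \<Rightarrow> nat set" where
  "base B = (if B = {{}} then UNIV else \<Union>B)"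

definition front :: "nat set set \<Rightarrow> bool" where
  "front B \<longleftrightarrow> B = {{}} \<or>
    (\<forall>s\<in>B. finite s) \<and>
    infinite (base B) \<and>
    (\<forall>X. infinite X \<and> X \<subseteq> base B \<longrightarrow> (\<exists>s\<in>B. s \<sqsubset> X)) \<and>
    \<not> (\<exists>s\<in>B. \<exists>t\<in>B. s \<sqsubset> t)"

definition barrier :: "nat set set \<Rightarrow> bool" where
  "barrier B \<longleftrightarrow> front B \<and> \<not> (\<exists>s\<in>B. \<exists>t\<in>B. s \<subset> t)"

definition smooth :: "nat set set \<Rightarrow> bool" where
  "smooth B \<longleftrightarrow> (\<forall>s\<in>B. \<forall>t\<in>B. card s < card t \<longrightarrow>
    (\<exists>i<card s. sorted_list_of_set s ! i < sorted_list_of_set t ! i))"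

definition tree :: "nat set set \<Rightarrow> nat set set" where
  "tree B = {s. finite s \<and> s \<subseteq> base B \<and> \<not> (\<exists>t\<in>B. t \<sqsubset> s)}"

definition tree_ext :: "nat set set \<Rightarrow> (nat set \<times> nat set) set" where
  "tree_ext B = {(t, s). s \<in> tree B \<and> t \<in> tree B \<and> (\<exists>n. (\<forall>m\<in>s. m < n) \<and> t = insert n s)}"

text \<open>The relation \<open>tree_ext B\<close> is well-founded for every front; see \<open>ht_at_eq\<close> below.\<close>

definition ht_at :: "nat set set \<Rightarrow> nat set \<Rightarrow> cordinal" where
  "ht_at B = wfrec (tree_ext B)
    (\<lambda>h s. if s \<in> B then 0 else osup {osuc (h t) | t. (t, s) \<in> tree_ext B})"

definition ht :: "nat set set \<Rightarrow> cordinal" where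
  "ht B = ht_at B {}"

lemma wf_tree_ext:
  assumes "front B"
  shows "wf (tree_ext B)"
proof (rule ccontr)
  assume "\<not> wf (tree_ext B)"
  then obtain f where f: "\<And>i. (f (Suc i), f i) \<in> tree_ext B"
    by (auto simp: wf_iff_no_infinite_down_chain)
  have tr: "f i \<in> tree B" for i using f[of i] by (auto simp: tree_ext_def)
  have step: "f i \<sqsubset> f (Suc i)" for i
  proof -
    have "finite (f i)" using tr[of i] by (simp add: tree_def)
    then show ?thesis using f[of i] by (auto simp: tree_ext_def init_seg_def)
  qed
  have tr_sq: "t \<sqsubset> v" if "t \<sqsubset> u" "u \<sqsubset> v" for t u v :: "nat set"
    using that unfolding init_seg_def by blast
  have chain: "f i \<sqsubset> f j" if "i < j" for i j
    using that by (induction rule: less_Suc_induct) (auto intro: step tr_sq)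
  define X where "X = (\<Union>i. f i)"
  have fX: "f i \<sqsubset> X" for i
  proof -
    have "m < n" if "m \<in> f i" "n \<in> f j - f i" for m n j
      using that chain[of i j] chain[of j i] by (cases i j rule: linorder_cases) (auto simp: init_seg_def)
    moreover have "f i \<subset> X" using step[of i] by (auto simp: X_def init_seg_def)
    moreover have "finite (f i)" using tr[of i] by (simp add: tree_def)
    ultimately show ?thesis by (auto simp: init_seg_def X_def)
  qed
  have card: "i \<le> card (f i)" for i
  proof (induction i)
    case (Suc i)
    have "finite (f (Suc i))" using tr[of "Suc i"] by (simp add: tree_def)
    then have "card (f i) < card (f (Suc i))"
      using step[of i] by (intro psubset_card_mono) (auto simp: init_seg_def)
    then show ?case using Suc by simp
  qed simp
  have inf: "infinite X"
  proof
    assume fin: "finite X"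
    have "card (f (Suc (card X))) \<le> card X"
      using fin fX by (intro card_mono) (auto simp: init_seg_def)
    then show False using card[of "Suc (card X)"] by simp
  qed
  have "X \<subseteq> base B" using tr by (auto simp: X_def tree_def)
  have "\<exists>s\<in>B. s \<sqsubset> X"
  proof (cases "B = {{}}")
    case True
    then show ?thesis using inf by (auto simp: init_seg_def)
  next
    case False
    then show ?thesis using assms inf \<open>X \<subseteq> base B\<close> by (auto simp: front_def)
  qed
  then obtain s where s: "s \<in> B" "s \<sqsubset> X" by blast
  define i where "i = Suc (card s)"
  have fi: "finite (f i)" "\<not> s \<sqsubset> f i" using tr[of i] s(1) by (auto simp: tree_def)
  have "s \<subset> f i"
  proof -
    have "\<not> f i \<subseteq> s"
      using card[of i] card_mono[of s "f i"] s(2) by (auto simp: i_def init_seg_def)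
    then obtain y where y: "y \<in> f i" "y \<notin> s" by blast
    then have "y \<in> X - s" using fX[of i] by (auto simp: init_seg_def)
    have "x \<in> f i" if "x \<in> s" for x
    proof (rule ccontr)
      assume "x \<notin> f i"
      then have "y < x" using y s(2) fX[of i] that unfolding init_seg_def by blast
      moreover have "x < y" using s(2) that \<open>y \<in> X - s\<close> unfolding init_seg_def by blast
      ultimately show False by simp
    qed
    then show ?thesis using y by blast
  qed
  then have "s \<sqsubset> f i" using s(2) fX[of i] by (auto simp: init_seg_def)
  then show False using fi by blast
qed

lemma ht_at_eq:
  assumes "front B"
  shows "ht_at B s = (if s \<in> B then 0 else osup {osuc (ht_at B t) | t. (t, s) \<in> tree_ext B})"
proof -
  have "{osuc (cut (ht_at B) (tree_ext B) s t) | t. (t, s) \<in> tree_ext B} =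
        {osuc (ht_at B t) | t. (t, s) \<in> tree_ext B}"
    by (auto simp: cut_def)
  then show ?thesis
    using def_wfrec[OF eq_reflection[OF ht_at_def] wf_tree_ext[OF assms], of s] by simp
qed

definition final_segment :: "nat set \<Rightarrow> nat set \<Rightarrow> bool" where
  "final_segment Y X \<longleftrightarrow> (\<exists>m. Y = {n\<in>X. m \<le> n})"

text \<open>
  Used only when \<open>base B\<close> is a final segment of \<open>base A\<close>. As an operation on sets it is
  associative, and \<open>{{}}\<close> is a unit.
\<close>

definition front_sum :: "nat set set \<Rightarrow> nat set set \<Rightarrow> nat set set" (infixl "\<oplus>" 65) where
  "A \<oplus> B = {s \<union> t | s t. s \<in> B \<and> t \<in> A \<and> (\<forall>m\<in>s. \<forall>n\<in>t. m < n)}"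

text \<open>
  The degenerate front is covered by the empty Cantor normal form. As \<open>{{}}\<close> is a unit, the
  fold is \<open>B\<^sub>0 \<oplus> \<dots> \<oplus> B\<^bsub>n-1\<^esub>\<close>.
\<close>

definition decomposable :: "nat set set \<Rightarrow> bool" where
  "decomposable B \<longleftrightarrow> (\<exists>bs Bs.
    is_cnf bs (ht B) \<and>
    length Bs = length bs \<and>
    (\<forall>i<length bs. barrier (Bs ! i) \<and> smooth (Bs ! i) \<and> ht (Bs ! i) = omega_pow (bs ! i)) \<and>
    (\<forall>i. Suc i < length bs \<longrightarrow> final_segment (base (Bs ! Suc i)) (base (Bs ! i))) \<and>
    B = foldr (\<oplus>) Bs {{}})"

definition SD_barrier :: "nat set set \<Rightarrow> bool" where
  "SD_barrier B \<longleftrightarrow> barrier B \<and> smooth B \<and> decomposable B"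

definition singletons :: "nat set \<Rightarrow> nat set set" where
  "singletons X = {{n} | n. n \<in> X}"

definition size_subsets :: "nat set \<Rightarrow> nat set set \<Rightarrow> nat set set" where
  "size_subsets s C = {u\<in>C. u \<subseteq> s}"

end

theory Submission
  imports Defs "HOL-Library.Multiset"
begin

text \<open>
  A family \<open>Q\<close> of finite sets is a bar of rank \<open>a\<close> if adding larger and larger elements to the empty
  set leads into \<open>Q\<close> along a tree of rank \<open>a\<close> (\<open>barred\<close> below). Every bar of rank \<open>a\<close> that is closed under end
  extensions contains a smooth barrier of height exactly \<open>a\<close>, so it suffices to bound the rank of the
  family of all sets each of whose colourings has a large min-homogeneous subset.

  If \<open>f\<close> is such a bound for \<open>C\<close> and \<open>g\<close> for \<open>D\<close>, as functions of the rank of \<open>A\<close>, then \<open>f \<circ> g\<close> is one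
  for \<open>C \<oplus> D\<close>: the bound for \<open>C\<close>, applied to the vector of the colours over all possible \<open>D\<close>-parts,
  makes the colour depend on the \<open>D\<close>-part and the next element only, and then the bound for \<open>D\<close>
  applies. This reduces the problem to \<open>C\<close> of height \<open>\<omega>\<^sup>d\<close>.

  For \<open>d = 0\<close> the sets coloured are pairs. A number is inserted into the Erdos-Rado tree at a slot; if
  \<open>r\<close> is the rank of \<open>A\<close> that remains there, the slot is replaced by finitely many slots of smaller
  rank, so the sum of \<open>\<omega>\<^sup>r\<close> over all slots, in decreasing order, decreases.

  For \<open>d > 0\<close> one argues by induction on the rank \<open>a\<close> of \<open>A\<close>. The section of \<open>C\<close> at the first element
  \<open>n\<close> has rank less than \<open>\<omega>\<^sup>d\<close>, so each member of a suitable finite sum of barriers of height \<open>\<omega>\<^sup>e\<close>,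
  \<open>e < d\<close>, extends a member of it. The bound for this sum and the pigeonhole principle make the colour
  constant on the sets with minimum \<open>n\<close>, and the rank needed stays below \<open>\<phi>\<^sub>d a\<close>, which is a fixed
  point of every \<open>\<phi>\<^sub>e\<close>.
\<close>


section \<open>Countable ordinals\<close>

lemma less_osuc: "a < osuc a"
proof -
  have "\<exists>x. a < x"
    using countable_cordinal_bounded[of "{a}"] by auto
  then show ?thesis
    unfolding osuc_def by (rule LeastI_ex)
qed

lemma osuc_le: "a < b \<Longrightarrow> osuc a \<le> b"
  unfolding osuc_def by (rule Least_le)

lemma less_osuc_iff: "a < osuc b \<longleftrightarrow> a \<le> b"
  by (meson less_osuc not_less osuc_le le_less_trans)

lemma osup_upper:
  assumes "countable A" "a \<in> A"
  shows "a \<le> osup A"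
proof -
  have "\<exists>x. \<forall>a\<in>A. a \<le> x"
    using countable_cordinal_bounded[OF assms(1)] less_imp_le by blast
  then have "\<forall>a\<in>A. a \<le> osup A"
    unfolding osup_def by (rule LeastI_ex)
  then show ?thesis using assms by blast
qed

lemma osup_least: "(\<And>a. a \<in> A \<Longrightarrow> a \<le> x) \<Longrightarrow> osup A \<le> x"
  unfolding osup_def by (rule Least_le) blast

lemma less_osup_iff:
  assumes "countable A"
  shows "x < osup A \<longleftrightarrow> (\<exists>a\<in>A. x < a)"
  by (meson assms leD leI osup_least osup_upper less_le_trans)

lemma cordinal_not_less_zero [simp]: "\<not> a < (0 :: cordinal)"
  using cordinal_zero_le not_less by blast

lemma cordinal_le_zero [simp]: "a \<le> (0 :: cordinal) \<longleftrightarrow> a = 0"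
  using cordinal_zero_le by (auto intro: order_antisym)

lemma cordinal_neq_zero: "a \<noteq> (0 :: cordinal) \<longleftrightarrow> 0 < a"
  using cordinal_zero_le by (auto simp: le_less)

lemma cordinal_add_strict_mono: "b < c \<Longrightarrow> a + b < a + (c :: cordinal)"
  using cordinal_add_bounds by blast

lemma cordinal_add_less_cancel [simp]: "a + b < a + c \<longleftrightarrow> b < (c :: cordinal)"
  by (metis cordinal_add_strict_mono less_asym neqE)

lemma cordinal_add_le_cancel [simp]: "a + b \<le> a + c \<longleftrightarrow> b \<le> (c :: cordinal)"
  by (simp add: not_less[symmetric])

lemma cordinal_add_cancel [simp]: "a + b = a + c \<longleftrightarrow> b = (c :: cordinal)"
  by (simp add: order_eq_iff)

lemma cordinal_le_add1 [simp]: "a \<le> a + (b :: cordinal)"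
  using cordinal_add_bounds by blast

lemma cordinal_add_right_mono:
  fixes a b c :: cordinal
  assumes "a \<le> b"
  shows "a + c \<le> b + c"
proof (induction c rule: less_induct)
  case (less c)
  show ?case
  proof (rule cordinal_add_least)
    show "a \<le> b + c" using assms cordinal_le_add1 order_trans by blast
    show "a + d < b + c" if "d < c" for d
      using less[OF that] cordinal_add_strict_mono[OF that, of b] by (rule le_less_trans)
  qed
qed

lemma cordinal_add_mono: "a \<le> b \<Longrightarrow> c \<le> d \<Longrightarrow> a + c \<le> b + (d :: cordinal)"
  by (meson cordinal_add_le_cancel cordinal_add_right_mono order_trans)

lemma cordinal_less_add: "0 < b \<Longrightarrow> a < a + (b :: cordinal)"
  using cordinal_add_strict_mono[of 0 b a] by simp

lemma strict_mono_cordinal_ge: "strict_mono f \<Longrightarrow> a \<le> f (a :: cordinal)"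
proof (induction a rule: less_induct)
  case (less a)
  show ?case
    by (metis less.IH less.prems not_less strict_mono_less)
qed

subsection \<open>Powers of \<open>\<omega>\<close>\<close>

abbreviation omega_mult :: "cordinal \<Rightarrow> nat \<Rightarrow> cordinal" where
  "omega_mult c n \<equiv> sum_list (replicate n (omega_pow c))"

lemma omega_pow_bounds:
  shows "0 < omega_pow b" and "c < b \<Longrightarrow> omega_mult c n \<le> omega_pow b"
proof -
  let ?P = "\<lambda>x. 0 < x \<and> (\<forall>c\<in>{..<b}. \<forall>n. omega_mult c n \<le> x)"
  have "countable (insert 0 (\<Union>c\<in>{..<b}. range (omega_mult c)))"
    using countable_cordinal_lessThan by blast
  then obtain x where x: "\<forall>y\<in>insert 0 (\<Union>c\<in>{..<b}. range (omega_mult c)). y < x"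
    using countable_cordinal_bounded by blast
  have "?P x" using x by (auto intro: less_imp_le)
  then have "?P (LEAST x. ?P x)" by (rule LeastI)
  then have "?P (omega_pow b)" unfolding omega_pow.simps[of b, symmetric] .
  then show "0 < omega_pow b" and "c < b \<Longrightarrow> omega_mult c n \<le> omega_pow b" by auto
qed

lemma omega_pow_least:
  assumes "0 < x" "\<And>c n. c < b \<Longrightarrow> omega_mult c n \<le> x"
  shows "omega_pow b \<le> x"
  unfolding omega_pow.simps[of b] using assms by (intro Least_le) auto

lemma omega_mult_mono:
  assumes "c \<le> d" "n \<le> m"
  shows "omega_mult c n \<le> omega_mult d m"
proof -
  have "omega_pow c \<le> omega_pow d"
    using assms(1) omega_pow_bounds(2)[of c d "Suc 0"] by (auto simp: le_less)
  then have "omega_mult c n \<le> omega_mult d n"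
    by (induction n) (auto intro: cordinal_add_mono)
  moreover have "omega_mult d m = omega_mult d n + omega_mult d (m - n)"
    using assms(2) by (metis le_add_diff_inverse replicate_add sum_list_append)
  ultimately show ?thesis
    by (metis cordinal_le_add1 order_trans)
qed

lemma omega_mult_less: "n < m \<Longrightarrow> omega_mult c n < omega_mult c m"
proof -
  assume "n < m"
  have "omega_mult c n < omega_mult c n + omega_pow c"
    by (simp add: cordinal_less_add omega_pow_bounds)
  also have "\<dots> = omega_mult c (Suc n)"
    by (metis replicate_Suc replicate_append_same sum_list_append sum_list.Cons sum_list.Nil add_0_right)
  also have "\<dots> \<le> omega_mult c m"
    using \<open>n < m\<close> by (intro omega_mult_mono) auto
  finally show ?thesis .
qed

lemma omega_mult_less_pow: "c < b \<Longrightarrow> omega_mult c n < omega_pow b"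
  using omega_mult_less[of n "Suc n" c] omega_pow_bounds(2)[of c b "Suc n"] by (meson lessI less_le_trans)

lemma strict_mono_omega_pow: "strict_mono omega_pow"
  by (rule strict_monoI) (use omega_mult_less_pow[of _ _ 1] in simp)

lemmas omega_pow_less = strict_mono_less[OF strict_mono_omega_pow]
lemmas omega_pow_le = strict_mono_less_eq[OF strict_mono_omega_pow]

lemma less_omega_powE:
  assumes "x < omega_pow b" "0 < x"
  obtains c n where "c < b" "x < omega_mult c n"
  using assms omega_pow_least[of x b] by (meson not_less)

lemma omega_pow_0: "omega_pow 0 = osuc 0"
  by (rule order_antisym) (auto intro!: omega_pow_least less_osuc osuc_le omega_pow_bounds)

text \<open>Both summands lie below finite multiples of smaller powers, and these fit into a finite
  multiple of the power with the larger exponent.\<close>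

lemma omega_pow_add_closed:
  assumes "x < omega_pow b" "y < omega_pow b"
  shows "x + y < omega_pow b"
proof (cases "x = 0 \<or> y = 0")
  case True
  then show ?thesis using assms by auto
next
  case False
  then have "0 < x" "0 < y" by (auto simp: cordinal_neq_zero)
  then obtain c n d m where c: "c < b" "x < omega_mult c n" and d: "d < b" "y < omega_mult d m"
    using assms less_omega_powE by metis
  let ?e = "max c d"
  have "x \<le> omega_mult ?e n" "y \<le> omega_mult ?e m"
    using c(2) d(2) omega_mult_mono[of c ?e n n] omega_mult_mono[of d ?e m m] by (force intro: less_imp_le)+
  then have "x + y \<le> omega_mult ?e n + omega_mult ?e m"
    by (rule cordinal_add_mono)
  also have "\<dots> = omega_mult ?e (n + m)"
    by (simp add: replicate_add)
  also have "\<dots> < omega_pow b"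
    using c d by (intro omega_mult_less_pow) auto
  finally show ?thesis .
qed

lemma sum_omega_pow_less: "(\<And>d. d \<in> set ds \<Longrightarrow> d < e) \<Longrightarrow> sum_list (map omega_pow ds) < omega_pow e"
  by (induction ds) (auto intro!: omega_pow_add_closed omega_pow_bounds simp: omega_pow_less)

text \<open>The leading exponent is determined by \<open>g\<close>: if one form had the smaller one,
  \<open>g\<close> would lie below the leading power of the other. Equal leading terms then cancel
  on the left.\<close>

lemma is_cnf_unique: "is_cnf ds g \<Longrightarrow> is_cnf es g \<Longrightarrow> ds = es"
proof (induction ds arbitrary: es g)
  case Nil
  show ?case
  proof (cases es)
    case (Cons e es')
    then have "omega_pow e \<le> g" using Nil.prems(2) by (simp add: is_cnf_def)
    moreover have "g = 0" using Nil.prems(1) by (simp add: is_cnf_def)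
    ultimately show ?thesis using omega_pow_bounds(1)[of e] by simp
  qed simp
next
  case (Cons d ds)
  have less: "sum_list (map omega_pow xs) < omega_pow y"
    if "sorted_wrt (\<ge>) xs" "xs = x # xs'" "x < y" for x y :: cordinal and xs xs'
    using that by (intro sum_omega_pow_less) auto
  show ?case
  proof (cases es)
    case Nil
    have "g = 0" using Cons.prems(2) Nil by (simp add: is_cnf_def)
    moreover have "omega_pow d \<le> g" using Cons.prems(1) by (simp add: is_cnf_def)
    ultimately have "omega_pow d \<le> 0" by simp
    then show ?thesis using omega_pow_bounds(1)[of d] by auto
  next
    case es: (Cons e es')
    have "omega_pow d \<le> g"
      using Cons.prems(1) cordinal_le_add1 by (metis is_cnf_def list.map(2) sum_list.Cons)
    moreover have "omega_pow e \<le> g"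
      using Cons.prems(2) es cordinal_le_add1 by (metis is_cnf_def list.map(2) sum_list.Cons)
    moreover have "d < e \<Longrightarrow> g < omega_pow e" "e < d \<Longrightarrow> g < omega_pow d"
      using less[of "d # ds" d ds e] less[of es e es' d] Cons.prems es by (auto simp: is_cnf_def)
    ultimately have "d = e" by (meson neqE not_less)
    then have "sum_list (map omega_pow ds) = sum_list (map omega_pow es')"
      using Cons.prems es by (auto simp: is_cnf_def)
    then have "ds = es'"
      using Cons.IH[of "sum_list (map omega_pow ds)" es'] Cons.prems es by (auto simp: is_cnf_def)
    then show ?thesis using \<open>d = e\<close> es by simp
  qed
qed

lemma cnf_eq: "is_cnf ds g \<Longrightarrow> cnf g = ds"
  unfolding cnf_def by (blast intro: is_cnf_unique)

subsection \<open>Normal functions and the Veblen hierarchy\<close>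

definition limit_ord :: "cordinal \<Rightarrow> bool" where
  "limit_ord x \<longleftrightarrow> 0 < x \<and> (\<forall>y<x. osuc y < x)"

definition normal :: "(cordinal \<Rightarrow> cordinal) \<Rightarrow> bool" where
  "normal f \<longleftrightarrow> strict_mono f \<and> (\<forall>x z. limit_ord x \<longrightarrow> (\<forall>y<x. f y \<le> z) \<longrightarrow> f x \<le> z)"

lemma normalD:
  assumes "normal f"
  shows "strict_mono f" and "limit_ord x \<Longrightarrow> (\<And>y. y < x \<Longrightarrow> f y \<le> z) \<Longrightarrow> f x \<le> z"
  using assms by (auto simp: normal_def)

lemma normal_omega_pow: "normal omega_pow"
  unfolding normal_def
proof (intro conjI strict_mono_omega_pow allI impI)
  fix x z assume x: "limit_ord x" and le: "\<forall>y<x. omega_pow y \<le> z"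
  show "omega_pow x \<le> z"
  proof (rule omega_pow_least)
    show "0 < z" using x le omega_pow_bounds(1) less_le_trans unfolding limit_ord_def by blast
    fix c :: cordinal and n assume "c < x"
    then have "omega_pow (osuc c) \<le> z" using x le by (auto simp: limit_ord_def)
    then show "omega_mult c n \<le> z"
      using omega_pow_bounds(2)[OF less_osuc[of c], of n] by (rule order_trans[rotated])
  qed
qed

text \<open>Starting from \<open>a\<close>, one repeatedly passes to an ordinal above the current
  one and above all its images under \<open>F\<close>. The supremum of the iterates is a limit, and
  continuity makes it fixed. Countability of \<open>F\<close> keeps every step within the countable
  ordinals.\<close>

lemma common_fixed_point:
  assumes "countable F" "\<And>f. f \<in> F \<Longrightarrow> normal f"
  shows "\<exists>x>a. \<forall>f\<in>F. f x = x"
proof -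
  define nxt where "nxt y = (SOME x. \<forall>z\<in>insert y ((\<lambda>f. f y) ` F). z < x)" for y :: cordinal
  have nxt: "\<forall>z\<in>insert y ((\<lambda>f. f y) ` F). z < nxt y" for y
  proof -
    have "\<exists>x. \<forall>z\<in>insert y ((\<lambda>f. f y) ` F). z < x"
      using assms(1) by (intro countable_cordinal_bounded) simp
    then show ?thesis unfolding nxt_def by (rule someI_ex)
  qed
  define xs where "xs n = (nxt ^^ Suc n) a" for n
  have xs: "xs n < xs (Suc n)" "\<And>f. f \<in> F \<Longrightarrow> f (xs n) < xs (Suc n)" for n
    using nxt[of "xs n"] by (auto simp: xs_def)
  define x where "x = osup (range xs)"
  have less: "xs n < x" for n
    using xs(1)[of n] osup_upper[of "range xs" "xs (Suc n)"] by (simp add: x_def less_le_trans)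
  have lt: "\<exists>n. y < xs n" if "y < x" for y
    using that less_osup_iff[of "range xs" y] by (auto simp: x_def)
  have "limit_ord x"
    unfolding limit_ord_def
  proof (intro conjI allI impI)
    show "0 < x" using less[of 0] cordinal_zero_le by (rule le_less_trans[rotated])
    show "osuc y < x" if "y < x" for y
      using lt[OF that] less osuc_le by (meson le_less_trans)
  qed
  have "f x = x" if f: "f \<in> F" for f
  proof (rule order_antisym)
    show "x \<le> f x"
      using strict_mono_cordinal_ge normalD(1) assms(2) f by blast
    show "f x \<le> x"
    proof (rule normalD(2)[OF assms(2)[OF f] \<open>limit_ord x\<close>])
      fix y assume "y < x"
      then obtain n where "y < xs n" using lt by blast
      then have "f y < f (xs n)" using normalD(1)[OF assms(2)[OF f]] by (simp add: strict_mono_less)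
      then show "f y \<le> x" using xs(2)[OF f, of n] less[of "Suc n"] by (meson less_trans less_imp_le)
    qed
  qed
  moreover have "a < x" using nxt[of a] less[of 0] by (auto simp: xs_def)
  ultimately show ?thesis by blast
qed

lemma oenum_props:
  assumes "\<And>a. \<exists>x>a. x \<in> S"
  shows "oenum S a \<in> S" and "b < a \<Longrightarrow> oenum S b < oenum S a"
    and "x \<in> S \<Longrightarrow> (\<And>b. b < a \<Longrightarrow> oenum S b < x) \<Longrightarrow> oenum S a \<le> x"
proof -
  let ?P = "\<lambda>x. x \<in> S \<and> (\<forall>b\<in>{..<a}. oenum S b < x)"
  have "countable (oenum S ` {..<a})" using countable_cordinal_lessThan by blast
  then obtain y where y: "\<forall>z\<in>oenum S ` {..<a}. z < y"
    using countable_cordinal_bounded by blast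
  obtain w where "w > y" "w \<in> S" using assms by blast
  then have "?P w" using y by (auto intro: less_trans)
  then have "?P (LEAST x. ?P x)" by (rule LeastI)
  then have "?P (oenum S a)" unfolding oenum.simps[of S a, symmetric] .
  then show "oenum S a \<in> S" "b < a \<Longrightarrow> oenum S b < oenum S a" by auto
  show "oenum S a \<le> x" if "x \<in> S" "\<And>b. b < a \<Longrightarrow> oenum S b < x"
    unfolding oenum.simps[of S a] using that by (intro Least_le) auto
qed

lemma veblen_0: "veblen 0 = omega_pow"
  by (simp add: veblen.simps)

text \<open>For \<open>d > 0\<close> the common fixed points of the earlier functions are unbounded,
  by \<open>common_fixed_point\<close> applied to the countably many \<open>e < d\<close>, and
  closed, as the supremum \<open>w\<close> shows. Hence their enumeration is normal.\<close>

lemma veblen_normal_aux: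
  "normal (veblen d) \<and> (\<forall>e<d. \<forall>a. veblen e (veblen d a) = veblen d a)"
proof (induction d rule: less_induct)
  case (less d)
  show ?case
  proof (cases "d = 0")
    case True
    then show ?thesis by (simp add: veblen_0 normal_omega_pow)
  next
    case False
    define S where "S = {x. \<forall>e\<in>{..<d}. veblen e x = x}"
    have v: "veblen d = oenum S" using False by (subst veblen.simps) (simp add: S_def)
    have unb: "\<exists>x>a. x \<in> S" for a
      using common_fixed_point[of "veblen ` {..<d}" a] less countable_cordinal_lessThan
      by (auto simp: S_def)
    note en = oenum_props[of S, OF unb]
    have "normal (oenum S)"
      unfolding normal_def
    proof (intro conjI allI impI)
      show mono: "strict_mono (oenum S)" by (rule strict_monoI) (rule en)
      fix x z assume x: "limit_ord x" and le: "\<forall>y<x. oenum S y \<le> z"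
      define w where "w = osup (oenum S ` {..<x})"
      have cnt: "countable (oenum S ` {..<x})" using countable_cordinal_lessThan by blast
      have up: "oenum S y < w" if "y < x" for y
        using that x en(2)[OF less_osuc, of y] osup_upper[OF cnt, of "oenum S (osuc y)"]
        by (auto simp: limit_ord_def w_def intro: less_le_trans)
      have lt: "\<exists>y<x. v < oenum S y" if "v < w" for v
        using that less_osup_iff[OF cnt, of v] by (auto simp: w_def)
      have "limit_ord w"
        unfolding limit_ord_def
      proof (intro conjI allI impI)
        show "0 < w" using up[of 0] x cordinal_zero_le by (auto simp: limit_ord_def intro: le_less_trans)
        show "osuc v < w" if "v < w" for v
          using lt[OF that] up osuc_le by (meson le_less_trans)
      qed
      have "w \<in> S"
        unfolding S_def
      proof safe
        fix e assume e: "e < d"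
        have ne: "normal (veblen e)" using less e by blast
        show "veblen e w = w"
        proof (rule order_antisym)
          show "w \<le> veblen e w" using strict_mono_cordinal_ge normalD(1)[OF ne] by blast
          show "veblen e w \<le> w"
          proof (rule normalD(2)[OF ne \<open>limit_ord w\<close>])
            fix v assume "v < w"
            then obtain y where y: "y < x" "v < oenum S y" using lt by blast
            then have "veblen e v < veblen e (oenum S y)"
              using normalD(1)[OF ne] by (simp add: strict_mono_less)
            also have "\<dots> = oenum S y" using en(1)[of y] e by (auto simp: S_def)
            finally show "veblen e v \<le> w" using up[OF y(1)] by simp
          qed
        qed
      qed
      then have "oenum S x \<le> w" using up by (intro en(3)) auto
      also have "w \<le> z" unfolding w_def using le by (intro osup_least) auto
      finally show "oenum S x \<le> z" .
    qed
    moreover have "veblen e (oenum S a) = oenum S a" if "e < d" for e a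
      using en(1)[of a] that by (auto simp: S_def)
    ultimately show ?thesis by (simp add: v)
  qed
qed

lemma strict_mono_veblen: "strict_mono (veblen d)"
  using veblen_normal_aux normalD(1) by blast

lemma veblen_fixed: "e < d \<Longrightarrow> veblen e (veblen d a) = veblen d a"
  using veblen_normal_aux by blast

lemma veblen_closed: "e < d \<Longrightarrow> b < veblen d a \<Longrightarrow> veblen e b < veblen d a"
  by (metis strict_mono_less strict_mono_veblen veblen_fixed)

lemma veblen_is_omega_pow: "\<exists>b. veblen d a = omega_pow b"
  by (metis cordinal_neq_zero veblen_0 veblen_fixed)

text \<open>\<open>\<lambda>d. veblen d 0\<close> is strictly increasing, so
  \<open>d \<le> veblen d a\<close>; for \<open>d > 0\<close>, \<open>omega_pow\<close> fixes the
  right-hand side. The inequality serves the case in which \<open>A\<close> contains the empty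
  set.\<close>

lemma omega_pow_le_veblen: "omega_pow d \<le> veblen d a"
proof (cases "d = 0")
  case True
  then show ?thesis by (simp add: veblen_0 omega_pow_le cordinal_zero_le)
next
  case False
  then have d: "0 < d" by (simp add: cordinal_neq_zero)
  have "strict_mono (\<lambda>d. veblen d 0)"
  proof (rule strict_monoI)
    fix x y :: cordinal assume "x < y"
    have "0 < veblen y 0" by (metis veblen_is_omega_pow omega_pow_bounds(1))
    then show "veblen x 0 < veblen y 0" using \<open>x < y\<close> veblen_closed by blast
  qed
  then have "d \<le> veblen d 0" using strict_mono_cordinal_ge by blast
  also have "\<dots> \<le> veblen d a" using strict_mono_veblen cordinal_zero_le by (simp add: strict_mono_less_eq)
  finally have "omega_pow d \<le> omega_pow (veblen d a)" by (simp add: omega_pow_le)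
  then show ?thesis using veblen_fixed[OF d, of a] by (simp add: veblen_0)
qed

text \<open>The value is a fixed point of \<open>omega_pow\<close>, hence closed under powers of
  \<omega> and under sums; so it exceeds \<open>b + omega_pow b\<close>.\<close>

lemma osuc_less_veblen:
  assumes "0 < d" "b < veblen d a"
  shows "osuc b < veblen d a"
proof -
  have "b < omega_pow (osuc b)"
    using less_osuc strict_mono_cordinal_ge[OF strict_mono_omega_pow] less_le_trans by blast
  have "0 < omega_pow b" by (rule omega_pow_bounds)
  have *: "omega_pow b < veblen d a"
    using veblen_closed[OF assms] by (simp add: veblen_0)
  have "b < b + omega_pow b" by (simp add: cordinal_less_add omega_pow_bounds)
  then have "osuc b \<le> b + omega_pow b" by (rule osuc_le)
  also have "\<dots> < veblen d a"
    using assms(2) * veblen_is_omega_pow[of d a] omega_pow_add_closed by metis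
  finally show ?thesis .
qed

section \<open>Bars and their ranks\<close>

abbreviation below :: "nat set \<Rightarrow> nat set \<Rightarrow> bool" (infix "\<lless>" 50) where
  "s \<lless> t \<equiv> \<forall>m\<in>s. \<forall>n\<in>t. m < n"

text \<open>Unlike \<open>init_seg\<close>, this relation is reflexive and makes no demand of
  finiteness.\<close>

definition iseg :: "nat set \<Rightarrow> nat set \<Rightarrow> bool" where
  "iseg e f \<longleftrightarrow> e \<subseteq> f \<and> e \<lless> f - e"

lemma iseg_Un: "e \<lless> r \<Longrightarrow> iseg e (e \<union> r)"
  by (auto simp: iseg_def)

lemma iseg_refl [simp]: "iseg e e"
  by (simp add: iseg_def)

lemma iseg_empty [simp]: "iseg {} e"
  by (simp add: iseg_def)

lemma iseg_linear:
  assumes "iseg d f" "iseg e f"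
  shows "iseg d e \<or> iseg e d"
proof -
  have "d \<subseteq> e \<or> e \<subseteq> d"
  proof (rule ccontr)
    assume "\<not> (d \<subseteq> e \<or> e \<subseteq> d)"
    then obtain x y where "x \<in> d" "x \<notin> e" "y \<in> e" "y \<notin> d" by blast
    then have "x < y" "y < x" using assms by (auto simp: iseg_def)
    then show False by simp
  qed
  then show ?thesis using assms unfolding iseg_def by blast
qed

lemma iseg_trans: "iseg d e \<Longrightarrow> iseg e f \<Longrightarrow> iseg d f"
  unfolding iseg_def by blast

lemma iseg_diff: "iseg e f \<Longrightarrow> e \<union> (f - e) = f" "iseg e f \<Longrightarrow> e \<lless> f - e"
  unfolding iseg_def by blast+

lemma iseg_Min: "iseg e f \<Longrightarrow> e \<noteq> {} \<Longrightarrow> finite f \<Longrightarrow> Min e = Min f"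
proof -
  assume a: "iseg e f" "e \<noteq> {}" "finite f"
  then have "finite e" using finite_subset unfolding iseg_def by blast
  have "Min e \<in> e" using a \<open>finite e\<close> by simp
  moreover have "Min e \<le> x" if "x \<in> f" for x
  proof (cases "x \<in> e")
    case True
    then show ?thesis using \<open>finite e\<close> by simp
  next
    case False
    then have "Min e < x" using a(1) that \<open>Min e \<in> e\<close> unfolding iseg_def by blast
    then show ?thesis by simp
  qed
  ultimately show ?thesis using a by (intro Min_eqI[symmetric]) (auto simp: iseg_def)
qed

lemma iseg_insert_Min:
  assumes "iseg e f" "e \<noteq> f" "finite f"
  shows "iseg (insert (Min (f - e)) e) f" and "e \<lless> {Min (f - e)}" and "Min (f - e) \<in> f - e"
proof -
  have "f - e \<noteq> {}" using assms by (auto simp: iseg_def)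
  then show m: "Min (f - e) \<in> f - e" using assms(3) by (intro Min_in) auto
  then show "e \<lless> {Min (f - e)}" using assms(1) by (auto simp: iseg_def)
  have "Min (f - e) < n" if "n \<in> f - insert (Min (f - e)) e" for n
    using that assms(3) Min_le[of "f - e" n] by (auto simp: le_less)
  then show "iseg (insert (Min (f - e)) e) f"
    using assms m by (auto simp: iseg_def)
qed

section \<open>Ranked bars and their sections\<close>

lemma infinite_above: "infinite X \<Longrightarrow> infinite {x\<in>X. n < (x :: nat)}"
proof -
  assume "infinite X"
  moreover have "{x\<in>X. n < x} = X - {..n}" by auto
  ultimately show ?thesis by (simp add: Diff_infinite_finite)
qed

text \<open>The ordinal is only an upper bound of the rank, so \<open>now\<close> accepts every
  \<open>a\<close>. This makes the predicate monotone in \<open>Q\<close> and \<open>a\<close>,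
  antitone in \<open>Y\<close>, and meaningful for families that are not fronts.\<close>

inductive barred :: "nat set \<Rightarrow> nat set set \<Rightarrow> nat set \<Rightarrow> cordinal \<Rightarrow> bool" for Y Q where
  now: "s \<in> Q \<Longrightarrow> barred Y Q s a"
| later: "(\<And>n. n \<in> Y \<Longrightarrow> s \<lless> {n} \<Longrightarrow> \<exists>b<a. barred Y Q (insert n s) b) \<Longrightarrow> barred Y Q s a"

lemma barred_mono:
  assumes "barred Y Q s a" "Y' \<subseteq> Y" "Q \<subseteq> Q'" "a \<le> a'"
  shows "barred Y' Q' s a'"
  using assms(1,4)
proof (induction arbitrary: a' rule: barred.induct)
  case (now s a)
  then show ?case using assms(3) by (blast intro: barred.now)
next
  case (later s a)
  show ?case
  proof (rule barred.later)
    fix n assume "n \<in> Y'" "s \<lless> {n}"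
    then obtain b where "b < a" "\<forall>a'\<ge>b. barred Y' Q' (insert n s) a'"
      using later.IH assms(2) by blast
    then show "\<exists>b<a'. barred Y' Q' (insert n s) b" using later.prems by (meson order_refl less_le_trans)
  qed
qed

lemma barred_le: "barred Y Q s a \<Longrightarrow> a \<le> b \<Longrightarrow> barred Y Q s b"
  by (rule barred_mono) auto

lemma barred_zero: "barred Y Q s 0 \<Longrightarrow> infinite Y \<Longrightarrow> finite s \<Longrightarrow> s \<in> Q"
proof (erule barred.cases)
  fix t and a :: cordinal
  assume inf: "infinite Y" "finite s" and eq: "s = t" "0 = a"
    and st: "\<And>n. n \<in> Y \<Longrightarrow> t \<lless> {n} \<Longrightarrow> \<exists>b<a. barred Y Q (insert n t) b"
  obtain n where "n \<in> Y" "n > Max (insert 0 s)"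
    using inf(1) by (meson infinite_nat_iff_unbounded)
  then have "n \<in> Y" "t \<lless> {n}" using inf(2) eq by auto
  then show "s \<in> Q" using st[of n] eq by auto
qed auto

lemma barred_step:
  assumes "barred Y Q s a" "n \<in> Y" "s \<lless> {n}"
  obtains "s \<in> Q" | b where "b < a" "barred Y Q (insert n s) b"
  using assms by (cases rule: barred.cases) blast+

text \<open>Together with \<open>barred_shift\<close> this passes between a bar at \<open>s\<close>
  and the section of the bar at \<open>s\<close>; inductions descend to a first element in this
  way.\<close>

lemma barred_unshift:
  assumes "barred Y Q (s \<union> r) a" "\<And>n. n \<in> Y' \<Longrightarrow> r \<lless> {n} \<Longrightarrow> n \<in> Y \<and> s \<lless> {n}"
  shows "barred Y' {r. s \<union> r \<in> Q} r a"
  using assms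
proof (induction "s \<union> r" a arbitrary: r rule: barred.induct)
  case (now a)
  then show ?case by (auto intro: barred.now)
next
  case (later a)
  show ?case
  proof (rule barred.later)
    fix n assume n: "n \<in> Y'" "r \<lless> {n}"
    then have *: "n \<in> Y" "s \<union> r \<lless> {n}" using later.prems by blast+
    have "insert n (s \<union> r) = s \<union> insert n r" by simp
    then show "\<exists>b<a. barred Y' {r. s \<union> r \<in> Q} (insert n r) b"
      using later.hyps[OF *] later.prems n by (smt (verit) insertCI)
  qed
qed

lemma barred_shift:
  assumes "barred Y' {r. s \<union> r \<in> Q} r a" "\<And>n. n \<in> Y \<Longrightarrow> s \<union> r \<lless> {n} \<Longrightarrow> n \<in> Y'"
  shows "barred Y Q (s \<union> r) a"
  using assms
proof (induction rule: barred.induct)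
  case (now r a)
  then show ?case by (auto intro: barred.now)
next
  case (later r a)
  show ?case
  proof (rule barred.later)
    fix n assume n: "n \<in> Y" "s \<union> r \<lless> {n}"
    then obtain b where "b < a" "barred Y Q (s \<union> insert n r) b"
      using later.IH[of n] later.prems by (smt (verit) Un_iff insertCI)
    then show "\<exists>b<a. barred Y Q (insert n (s \<union> r)) b" by auto
  qed
qed

text \<open>Only end extensions of \<open>s\<close> by finitely many elements of \<open>Y\<close>
  occur along the tree.\<close>

lemma barred_restrict:
  assumes "barred Y Q s a"
  shows "barred Y {r \<in> Q. iseg s r \<and> finite (r - s) \<and> r - s \<subseteq> Y} s a"
proof -
  have "barred Y {r \<in> Q. iseg s r \<and> finite (r - s) \<and> r - s \<subseteq> Y} r a"
    if "barred Y Q r a" "iseg s r" "finite (r - s)" "r - s \<subseteq> Y" for r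
    using that
  proof (induction rule: barred.induct)
    case (now r a)
    then show ?case by (auto intro: barred.now)
  next
    case (later r a)
    show ?case
    proof (rule barred.later)
      fix n assume n: "n \<in> Y" "r \<lless> {n}"
      have "iseg r (insert n r)" using n by (auto simp: iseg_def)
      then have "iseg s (insert n r)" using later.prems(1) iseg_trans by blast
      moreover have "finite (insert n r - s)" "insert n r - s \<subseteq> Y"
        using later.prems n by (auto simp: insert_Diff_if)
      ultimately show "\<exists>b<a. barred Y {r \<in> Q. iseg s r \<and> finite (r - s) \<and> r - s \<subseteq> Y} (insert n r) b"
        using later.IH[OF n] by blast
    qed
  qed
  from this[OF assms] show ?thesis by simp
qed

lemma barred_restrict_empty:
  "barred Y Q {} a \<Longrightarrow> barred Y {r \<in> Q. finite r \<and> r \<subseteq> Y} {} a"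
  using barred_restrict[of Y Q "{}" a] by (rule barred_mono) auto

text \<open>Once entered, such a family is never left along the tree, so several bars can be
  followed simultaneously.\<close>

definition end_closed :: "nat set set \<Rightarrow> bool" where
  "end_closed Q \<longleftrightarrow> (\<forall>s\<in>Q. \<forall>n. s \<lless> {n} \<longrightarrow> insert n s \<in> Q)"

lemma end_closed_up: "end_closed {s. \<exists>e\<in>S. iseg e s}"
  unfolding end_closed_def
proof clarify
  fix s k e assume "e \<in> S" "iseg e s" "s \<lless> {k}"
  moreover from this have "iseg s (insert k s)" by (auto simp: iseg_def)
  ultimately show "\<exists>e\<in>S. iseg e (insert k s)" using iseg_trans by blast
qed

text \<open>The larger of the two remaining ranks serves for both bars, so the rank does not
  grow.\<close>

lemma barred_Int:
  assumes "barred Y P s a" "barred Y Q s a" "end_closed P" "end_closed Q"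
  shows "barred Y (P \<inter> Q) s a"
  using assms(1,2)
proof (induction a arbitrary: s rule: less_induct)
  case (less a)
  show ?case
  proof (cases "s \<in> P \<inter> Q")
    case True
    then show ?thesis by (rule barred.now)
  next
    case False
    show ?thesis
    proof (rule barred.later)
      fix n assume n: "n \<in> Y" "s \<lless> {n}"
      have P: "insert n s \<in> P \<or> (\<exists>b<a. barred Y P (insert n s) b)"
        using barred_step[OF less.prems(1) n] assms(3) n unfolding end_closed_def by metis
      have Q: "insert n s \<in> Q \<or> (\<exists>b<a. barred Y Q (insert n s) b)"
        using barred_step[OF less.prems(2) n] assms(4) n unfolding end_closed_def by metis
      have nz: "0 < a"
        using barred_step[OF less.prems(1) n] barred_step[OF less.prems(2) n] False
        by (metis IntI cordinal_zero_le le_less_trans)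
      have P': "\<exists>b<a. barred Y P (insert n s) b" using P nz barred.now by blast
      have Q': "\<exists>b<a. barred Y Q (insert n s) b" using Q nz barred.now by blast
      from P' Q' obtain b c where b: "b < a" "barred Y P (insert n s) b"
        and c: "c < a" "barred Y Q (insert n s) c" by blast
      have "barred Y P (insert n s) (max b c)" "barred Y Q (insert n s) (max b c)"
        using b(2) c(2) barred_le by (meson max.cobounded1 max.cobounded2)+
      moreover have "max b c < a" using b c by simp
      ultimately show "\<exists>b<a. barred Y (P \<inter> Q) (insert n s) b" using less.IH by blast
    qed
  qed
qed

lemma barred_INT:
  assumes "finite I" "\<And>i. i \<in> I \<Longrightarrow> barred Y (Q i) s a" "\<And>i. i \<in> I \<Longrightarrow> end_closed (Q i)"
  shows "barred Y (\<Inter>i\<in>I. Q i) s a"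
  using assms
proof (induction I)
  case empty
  then show ?case by (auto intro: barred.now)
next
  case (insert i I)
  have "end_closed (\<Inter>i\<in>I. Q i)" using insert.prems by (auto simp: end_closed_def)
  then show ?case using insert by (auto intro!: barred_Int)
qed

text \<open>The tree is cut where the remaining rank has dropped to \<open>a\<close>: an ordinal
  below \<open>a + b\<close> is at most \<open>a\<close> or of the form \<open>a + d\<close> with
  \<open>d < b\<close>.\<close>

lemma barred_add:
  assumes "barred Y Q s (a + b)"
  shows "barred Y {s. barred Y Q s a} s b"
  using assms
proof (induction b arbitrary: s rule: less_induct)
  case (less b)
  show ?case
  proof (cases "barred Y Q s a")
    case True
    then show ?thesis by (auto intro: barred.now)
  next
    case False
    have nb: "b \<noteq> 0" using less.prems False by auto
    show ?thesis
    proof (rule barred.later)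
      fix n assume n: "n \<in> Y" "s \<lless> {n}"
      have "s \<notin> Q" using False barred.now by blast
      then obtain c where c: "c < a + b" "barred Y Q (insert n s) c"
        using barred_step[OF less.prems n] by blast
      show "\<exists>c<b. barred Y {s. barred Y Q s a} (insert n s) c"
      proof (cases "c \<le> a")
        case True
        then have "barred Y {s. barred Y Q s a} (insert n s) 0"
          using c(2) barred_le by (blast intro: barred.now)
        then show ?thesis using nb cordinal_neq_zero by blast
      next
        case False
        then obtain d where "c = a + d" using cordinal_le_imp_add by (meson linear)
        then show ?thesis using c less.IH[of d] by auto
      qed
    qed
  qed
qed

lemma end_closed_barred:
  assumes "end_closed Q" 
  shows "barred Y Q s a \<Longrightarrow> n \<in> Y \<Longrightarrow> s \<lless> {n} \<Longrightarrow> barred Y Q (insert n s) a"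
  using assms barred_step[of Y Q s a n] barred_le less_imp_le barred.now
  unfolding end_closed_def by metis

section \<open>Antichains and density\<close>

definition antichain :: "nat set set \<Rightarrow> bool" where
  "antichain B \<longleftrightarrow> (\<forall>s\<in>B. \<forall>t\<in>B. s \<subseteq> t \<longrightarrow> s = t)"

text \<open>The finitary consequence of being a bar that is preserved by \<open>\<oplus>\<close>.\<close>

definition dense :: "nat set \<Rightarrow> nat set set \<Rightarrow> bool" where
  "dense Y B \<longleftrightarrow> (\<forall>f. finite f \<longrightarrow> f \<subseteq> Y \<longrightarrow> (\<exists>e\<in>B. iseg e f \<or> iseg f e))"

text \<open>The tree is followed along the elements of \<open>f\<close>. If \<open>f\<close> is used
  up first, any larger element \<open>n\<close> of \<open>Y\<close> continues the descent, and a set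
  comparable with \<open>insert n f\<close> is comparable with \<open>f\<close>.\<close>

lemma barred_dense_aux:
  assumes "barred Y Q s a" "infinite Y" "finite f" "finite s" "iseg s f" "f - s \<subseteq> Y"
  shows "\<exists>e\<in>Q. iseg e f \<or> iseg f e"
  using assms(1,3-)
proof (induction arbitrary: f rule: barred.induct)
  case (now s a)
  then show ?case by blast
next
  case (later s a)
  show ?case
  proof (cases "s = f")
    case True
    obtain n where n: "n \<in> Y" "n > Max (insert 0 s)"
      using assms(2) by (meson infinite_nat_iff_unbounded)
    then have n': "s \<lless> {n}" using later.prems by auto
    obtain e where e: "e \<in> Q" "iseg e (insert n s) \<or> iseg (insert n s) e"
      using later.IH[OF n(1) n'] later.prems(2) by (metis Diff_cancel empty_subsetI finite_insert iseg_refl)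
    have s: "iseg s (insert n s)" using n' by (auto simp: iseg_def)
    have "iseg e s \<or> iseg s e" using e(2) s iseg_linear iseg_trans by blast
    then show ?thesis using e True by blast
  next
    case False
    let ?n = "Min (f - s)"
    note m = iseg_insert_Min[OF later.prems(3) False later.prems(1)]
    have "?n \<in> Y" using m later.prems by blast
    then show ?thesis
      using later.IH[OF _ m(2)] m later.prems by blast
  qed
qed

lemma barred_dense: "barred Y Q {} a \<Longrightarrow> infinite Y \<Longrightarrow> dense Y Q"
  unfolding dense_def using barred_dense_aux by fastforce

lemma barred_front:
  assumes "barred Y Q s a" "infinite X" "X \<subseteq> Y" "s \<sqsubset> X"
  shows "\<exists>e\<in>Q. e \<sqsubset> X"
  using assms(1,4)
proof (induction rule: barred.induct)
  case (now s a)
  then show ?case by blast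
next
  case (later s a)
  let ?n = "LEAST n. n \<in> X - s"
  have "X - s \<noteq> {}" using later.prems by (auto simp: init_seg_def)
  then have n: "?n \<in> X - s" by (meson LeastI ex_in_conv)
  have le: "?n \<le> m" if "m \<in> X - s" for m using that by (rule Least_le)
  have fin: "finite (insert ?n s)" using later.prems by (auto simp: init_seg_def)
  have "insert ?n s \<noteq> X" using fin assms(2) by metis
  then have sub: "insert ?n s \<subset> X"
    using n later.prems by (auto simp: init_seg_def)
  have "insert ?n s \<sqsubset> X"
    using fin sub le n later.prems by (auto simp: init_seg_def order.strict_iff_order)
  moreover have "s \<lless> {?n}" using n later.prems by (auto simp: init_seg_def)
  ultimately show ?case using later.IH[of ?n] n assms(3) by blast
qed

subsection \<open>Heights of fronts\<close>

lemma countable_tree_ext: "countable {osuc (ht_at B t) | t. (t, s) \<in> tree_ext B}"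
proof -
  have "{osuc (ht_at B t) | t. (t, s) \<in> tree_ext B} \<subseteq> range (\<lambda>n. osuc (ht_at B (insert n s)))"
    by (auto simp: tree_ext_def)
  then show ?thesis by (rule countable_subset) simp
qed

lemma barred_ht_at:
  assumes "front B"
  shows "s \<in> tree B \<Longrightarrow> barred (base B) B s (ht_at B s)"
  using wf_tree_ext[OF assms]
proof (induction s rule: wf_induct_rule)
  case (less s)
  show ?case
  proof (cases "s \<in> B")
    case True
    then show ?thesis by (rule barred.now)
  next
    case False
    show ?thesis
    proof (rule barred.later)
      fix n assume n: "n \<in> base B" "s \<lless> {n}"
      have "insert n s \<in> tree B"
        unfolding tree_def
      proof (intro CollectI conjI notI)
        show "finite (insert n s)" "insert n s \<subseteq> base B" using less.prems n by (auto simp: tree_def)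
        assume "\<exists>t\<in>B. t \<sqsubset> insert n s"
        then obtain t where t: "t \<in> B" "t \<sqsubset> insert n s" by blast
        \<comment> \<open>The greatest element of \<open>insert n s\<close> cannot belong to a
          proper initial segment.\<close>
        have "n \<notin> t"
        proof
          assume "n \<in> t"
          moreover obtain y where "y \<in> insert n s - t" using t(2) unfolding init_seg_def by blast
          ultimately have "n < y" "y < n" using t(2) n(2) unfolding init_seg_def by auto
          then show False by simp
        qed
        then have "t \<subseteq> s" using t(2) by (auto simp: init_seg_def)
        moreover have "t \<noteq> s" using t False by blast
        ultimately have "t \<sqsubset> s" using t(2) by (auto simp: init_seg_def)
        then show False using t less.prems by (auto simp: tree_def)
      qed
      then have ext: "(insert n s, s) \<in> tree_ext B" using n less.prems by (auto simp: tree_ext_def)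
      have "ht_at B (insert n s) < osuc (ht_at B (insert n s))" by (rule less_osuc)
      also have "\<dots> \<le> ht_at B s"
        unfolding ht_at_eq[OF assms, of s] using False ext
        by (auto intro!: osup_upper[OF countable_tree_ext])
      finally show "\<exists>b<ht_at B s. barred (base B) B (insert n s) b"
        using less.IH[OF ext \<open>insert n s \<in> tree B\<close>] by blast
    qed
  qed
qed

lemma ht_at_le:
  assumes "front B" "barred (base B) B s b" "s \<in> tree B"
  shows "ht_at B s \<le> b"
  using assms(2,3)
proof (induction rule: barred.induct)
  case (now s a)
  then show ?case by (simp add: ht_at_eq[OF assms(1)] cordinal_zero_le)
next
  case (later s a)
  have "osup {osuc (ht_at B t) | t. (t, s) \<in> tree_ext B} \<le> a"
  proof (rule osup_least, clarify)
    fix t assume t: "(t, s) \<in> tree_ext B"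
    then obtain n where n: "t = insert n s" "s \<lless> {n}" "t \<in> tree B" by (auto simp: tree_ext_def)
    then have "n \<in> base B" by (auto simp: tree_def)
    then show "osuc (ht_at B t) \<le> a" using later.IH[of n] n by (meson le_less_trans osuc_le)
  qed
  then show ?case by (simp add: ht_at_eq[OF assms(1), of s] cordinal_zero_le)
qed

lemma empty_in_tree: "{} \<in> tree B"
  by (auto simp: tree_def init_seg_def)

text \<open>This is the bridge by which statements about heights become statements about
  bars.\<close>

lemma barred_iff_ht: "front B \<Longrightarrow> barred (base B) B {} b \<longleftrightarrow> ht B \<le> b"
  unfolding ht_def by (meson barred_ht_at barred_le empty_in_tree ht_at_le)

subsection \<open>Smooth barriers of prescribed height\<close>

lemma sorted_list_of_set_Un_below:
  assumes "finite s" "finite t" "s \<lless> t"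
  shows "sorted_list_of_set (s \<union> t) = sorted_list_of_set s @ sorted_list_of_set t"
proof (rule sorted_distinct_set_unique)
  show "sorted (sorted_list_of_set s @ sorted_list_of_set t)"
    using assms by (auto simp: sorted_append less_imp_le)
  show "distinct (sorted_list_of_set s @ sorted_list_of_set t)"
    using assms by fastforce
qed (use assms in auto)

text \<open>
  Each member of \<open>S (n + 1)\<close> extends a member of \<open>S n\<close>; this makes the union of the barriers
  \<open>{insert n r | r. r \<in> S n}\<close> smooth.
\<close>

lemma exists_section_sequence:
  assumes X: "infinite X"
    and P: "\<And>n Q. end_closed Q \<Longrightarrow> barred {x\<in>X. n < x} Q {} (h n) \<Longrightarrow>
      \<exists>S\<subseteq>Q. P n S \<and> barred {x\<in>X. n < x} S {} (h n)"
    and Q: "\<And>n. end_closed (Q n)" "\<And>n. barred {x\<in>X. n < x} (Q n) {} (h n)"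
    and h: "\<And>n. h n \<le> h (Suc n)"
  shows "\<exists>S. \<forall>n. S n \<subseteq> Q n \<and> P n (S n) \<and> barred {x\<in>X. n < x} (S n) {} (h n) \<and>
    (\<forall>s\<in>S (Suc n). \<exists>e\<in>S n. iseg e s)"
proof -
  let ?P = "\<lambda>n S. S \<subseteq> Q n \<and> P n S \<and> barred {x\<in>X. n < x} S {} (h n)"
  have "\<exists>S. \<forall>n. ?P n (S n) \<and> (\<forall>s\<in>S (Suc n). \<exists>e\<in>S n. iseg e s)"
  proof (rule dependent_nat_choice)
    show "\<exists>S. ?P 0 S" using P[OF Q(1) Q(2)] by blast
    fix S n assume S: "?P n S"
    \<comment> \<open>Intersecting the next target with the end extensions of members of
      \<open>S\<close> costs no rank, since \<open>S\<close> is a bar of rank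
      \<open>h n \<le> h (Suc n)\<close> on a larger set of numbers.\<close>
    let ?U = "{s. \<exists>e\<in>S. iseg e s}"
    have "end_closed ?U" by (rule end_closed_up)
    moreover have "barred {x\<in>X. Suc n < x} ?U {} (h (Suc n))"
      by (rule barred_mono[OF conjunct2[OF conjunct2[OF S]]]) (use h iseg_refl in \<open>auto, blast\<close>)
    ultimately have "\<exists>S'\<subseteq>Q (Suc n) \<inter> ?U. P (Suc n) S' \<and> barred {x\<in>X. Suc n < x} S' {} (h (Suc n))"
      using Q by (intro P barred_Int) (auto simp: end_closed_def)
    then show "\<exists>S'. ?P (Suc n) S' \<and> (\<forall>s\<in>S'. \<exists>e\<in>S. iseg e s)" by blast
  qed
  then show ?thesis by blast
qed

text \<open>The rank is measured on \<open>X\<close> and not by \<open>ht\<close>: for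
  \<open>a = 0\<close> and infinite \<open>X\<close> the family is \<open>{{}}\<close>, whose
  \<open>base\<close> is the set of all numbers.\<close>

definition exact_barrier :: "nat set \<Rightarrow> nat set set \<Rightarrow> cordinal \<Rightarrow> bool" where
  "exact_barrier X B a \<longleftrightarrow> (\<forall>s\<in>B. finite s \<and> s \<subseteq> X) \<and> antichain B \<and> smooth B \<and>
    barred X B {} a \<and> (\<forall>b. barred X B {} b \<longrightarrow> a \<le> b)"

text \<open>The section at \<open>n\<close> is chosen, by induction, of exact rank
  \<open>h n < a\<close>. That \<open>h\<close> is nondecreasing allows the sections to be nested,
  which gives smoothness; that \<open>h\<close> eventually dominates each ordinal below
  \<open>a\<close> keeps the rank from being less than \<open>a\<close>.\<close>

lemma exists_exact_barrier:
  assumes "infinite X" "end_closed Q" "barred X Q {} a"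
  shows "\<exists>B\<subseteq>Q. exact_barrier X B a"
  using assms
proof (induction a arbitrary: X Q rule: less_induct)
  case (less a)
  show ?case
  proof (cases "a = 0")
    case True
    then have "{} \<in> Q" using less.prems barred_zero by blast
    moreover have "exact_barrier X {{}} 0"
      by (auto simp: exact_barrier_def antichain_def smooth_def cordinal_zero_le intro: barred.now)
    ultimately show ?thesis using True by blast
  next
    case False
    then have a: "0 < a" by (simp add: cordinal_neq_zero)
    have "\<exists>b<a. barred X Q {n} b" if "n \<in> X" for n
      using barred_step[OF less.prems(3) that] less.prems(2) a barred.now
      unfolding end_closed_def by (metis empty_iff)
    then obtain f where f: "\<And>n. n \<in> X \<Longrightarrow> f n < a \<and> barred X Q {n} (f n)" by metis
    obtain g :: "nat \<Rightarrow> cordinal" where g: "range g = {..<a}"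
      using range_from_nat_into[OF _ countable_cordinal_lessThan, of a] a by blast
    define f' where "f' n = (if n \<in> X then f n else 0)" for n
    \<comment> \<open>The running maximum is nondecreasing and dominates \<open>g i\<close> from
      \<open>i\<close> on; as a maximum of finitely many ordinals it stays below
      \<open>a\<close>.\<close>
    define h where "h n = Max ((\<lambda>i. max (f' i) (g i)) ` {..n})" for n
    have h_less: "h n < a" for n
      unfolding h_def using f g a by (subst Max_less_iff) (auto simp: f'_def)
    have h_ge: "max (f' i) (g i) \<le> h n" if "i \<le> n" for i n
      unfolding h_def using that by (intro Max_ge) auto
    have h_mono: "h n \<le> h (Suc n)" for n
      unfolding h_def by (intro Max_mono) auto
    \<comment> \<open>The guard \<open>{n} \<lless> r\<close> gives end closure: an element added to
      \<open>r\<close> must then exceed \<open>n\<close>. Outside \<open>X\<close> the trivial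
      target allows the sections to be indexed by all numbers.\<close>
    define R where "R n = (if n \<in> X then {r. {n} \<lless> r \<longrightarrow> insert n r \<in> Q} else UNIV)" for n
    have R_closed: "end_closed (R n)" for n
    proof (cases "n \<in> X")
      case True
      have "insert n (insert m r) \<in> Q" if "insert n r \<in> Q" "r \<lless> {m}" "n < m" for r m
        using that less.prems(2) unfolding end_closed_def by (metis insert_commute insert_iff singletonD)
      then show ?thesis using True by (auto simp: R_def end_closed_def)
    qed (simp add: R_def end_closed_def)
    have R_barred: "barred {x\<in>X. n < x} (R n) {} (h n)" for n
    proof (cases "n \<in> X")
      case True
      have "barred {x\<in>X. n < x} {r. {n} \<union> r \<in> Q} {} (f n)"
        using f[OF True] by (intro barred_unshift[of X]) auto
      from barred_restrict_empty[OF this] show ?thesis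
        by (rule barred_mono) (use h_ge[of n n] True in \<open>auto simp: R_def f'_def\<close>)
    qed (simp add: R_def barred.now)
    define P where "P n S \<longleftrightarrow> exact_barrier {x\<in>X. n < x} S (h n)" for n S
    have "\<exists>S. \<forall>n. S n \<subseteq> R n \<and> P n (S n) \<and> barred {x\<in>X. n < x} (S n) {} (h n) \<and>
        (\<forall>s\<in>S (Suc n). \<exists>e\<in>S n. iseg e s)"
    proof (rule exists_section_sequence[OF less.prems(1) _ R_closed R_barred h_mono])
      fix n Q assume "end_closed Q" "barred {x\<in>X. n < x} Q {} (h n)"
      moreover have "infinite {x\<in>X. n < x}"
        using less.prems(1) by (rule infinite_above)
      ultimately show "\<exists>S\<subseteq>Q. P n S \<and> barred {x\<in>X. n < x} S {} (h n)"
        using less.IH[OF h_less, of "{x\<in>X. n < x}" Q n] by (auto simp: P_def exact_barrier_def)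
    qed
    then obtain S where S: "\<And>n. S n \<subseteq> R n" "\<And>n. exact_barrier {x\<in>X. n < x} (S n) (h n)"
      and S_Suc: "\<And>n s. s \<in> S (Suc n) \<Longrightarrow> \<exists>e\<in>S n. iseg e s"
      unfolding P_def by metis
    have S_dom: "\<exists>e\<in>S m. iseg e s" if "m \<le> n" "s \<in> S n" for m n s
      using that
    proof (induction n arbitrary: s rule: dec_induct)
      case base
      then show ?case using iseg_refl by blast
    next
      case (step n)
      then show ?case using S_Suc iseg_trans by meson
    qed
    have S_fin: "finite s" "\<And>x. x \<in> s \<Longrightarrow> n < x \<and> x \<in> X" if "s \<in> S n" for n s
      using S(2)[of n] that unfolding exact_barrier_def by blast+
    define B where "B = {insert n r | n r. n \<in> X \<and> r \<in> S n}"
    have "B \<subseteq> Q" using S(1) S_fin by (fastforce simp: B_def R_def)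
    moreover have "exact_barrier X B a"
      unfolding exact_barrier_def
    proof (intro conjI)
      show "\<forall>s\<in>B. finite s \<and> s \<subseteq> X" using S_fin by (auto simp: B_def)
      \<comment> \<open>A member of a later section has an initial segment in every earlier one, so
        it cannot lie properly inside a member of that antichain.\<close>
      have not_sub: False if "s \<in> S n" "t \<in> S m" "m < n" "s \<subset> t" for s t m n
      proof -
        obtain e where "e \<in> S m" "iseg e s" using S_dom[OF less_imp_le[OF \<open>m < n\<close>] \<open>s \<in> S n\<close>] by blast
        then have "e \<subset> t" using that by (auto simp: iseg_def)
        then show False using S(2)[of m] that \<open>e \<in> S m\<close> by (auto simp: exact_barrier_def antichain_def)
      qed
      show "antichain B"
        unfolding antichain_def
      proof (intro ballI impI)
        fix s t assume "s \<in> B" "t \<in> B" and sub: "s \<subseteq> t"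
        then obtain n r m q where s: "s = insert n r" "r \<in> S n" and t: "t = insert m q" "q \<in> S m"
          by (auto simp: B_def)
        have nr: "n \<notin> r" and mq: "m \<notin> q" using S_fin[OF s(2)] S_fin[OF t(2)] by auto
        have "m \<le> n" using sub s t S_fin[OF t(2)] by (auto intro: less_imp_le)
        show "s = t"
        proof (cases "m = n")
          case True
          then have "r \<subseteq> q" using sub s t nr by auto
          then show ?thesis using S(2)[of n] s t True by (auto simp: exact_barrier_def antichain_def)
        next
          case False
          then have "m < n" using \<open>m \<le> n\<close> by simp
          then have "m \<notin> s" using s S_fin(2)[OF s(2), of m] by auto
          then have "r \<subset> q" using sub s t nr False by auto
          then show ?thesis using not_sub s t \<open>m < n\<close> by blast
        qed
      qed
      show "smooth B"
        unfolding smooth_def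
      proof (intro ballI impI)
        fix s t assume "s \<in> B" "t \<in> B" and less: "card s < card t"
        then obtain n r m q where s: "s = insert n r" "r \<in> S n" and t: "t = insert m q" "q \<in> S m"
          by (auto simp: B_def)
        have ls: "sorted_list_of_set s = n # sorted_list_of_set r"
          using sorted_list_of_set_Un_below[of "{n}" r] S_fin[OF s(2)] s by auto
        have lt: "sorted_list_of_set t = m # sorted_list_of_set q"
          using sorted_list_of_set_Un_below[of "{m}" q] S_fin[OF t(2)] t by auto
        have cs: "card s = Suc (card r)" using s S_fin[OF s(2)] by (subst s, subst card_insert_disjoint) auto
        have ct: "card t = Suc (card q)" using t S_fin[OF t(2)] by (subst t, subst card_insert_disjoint) auto
        show "\<exists>i<card s. sorted_list_of_set s ! i < sorted_list_of_set t ! i"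
        proof (cases "n < m")
          case True
          then show ?thesis using cs ls lt by (intro exI[of _ 0]) auto
        next
          case False
          \<comment> \<open>Since \<open>e\<close> is shorter than \<open>q\<close>, smoothness of
            \<open>S m\<close> compares these two; the first elements \<open>n\<close> and
            \<open>m\<close> shift the index by one.\<close>
          then obtain e where e: "e \<in> S m" "iseg e r" using S_dom[of m n r] s by auto
          have fe: "finite e" "finite (r - e)" using e S_fin[OF s(2)] finite_subset unfolding iseg_def by auto
          have r: "sorted_list_of_set r = sorted_list_of_set e @ sorted_list_of_set (r - e)"
            using sorted_list_of_set_Un_below[OF fe iseg_diff(2)[OF e(2)]] iseg_diff(1)[OF e(2)] by simp
          have le: "card e \<le> card r" using e S_fin[OF s(2)] by (intro card_mono) (auto simp: iseg_def)
          then have "card e < card q" using cs ct less by simp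
          then obtain i where "i < card e" "sorted_list_of_set e ! i < sorted_list_of_set q ! i"
            using S(2)[of m] e(1) t(2) unfolding exact_barrier_def smooth_def by blast
          then show ?thesis using cs ls lt le r fe
            by (intro exI[of _ "Suc i"]) (auto simp: nth_append)
        qed
      qed
      show "barred X B {} a"
      proof (rule barred.later)
        fix n assume n: "n \<in> X"
        have "barred {x\<in>X. n < x} (S n) {} (h n)" using S(2)[of n] by (simp add: exact_barrier_def)
        then have "barred {x\<in>X. n < x} {r. {n} \<union> r \<in> B} {} (h n)"
          by (rule barred_mono) (use n in \<open>auto simp: B_def\<close>)
        then have "barred X B ({n} \<union> {}) (h n)" by (rule barred_shift) auto
        then show "\<exists>b<a. barred X B {n} b" using h_less by auto
      qed
      show "\<forall>b. barred X B {} b \<longrightarrow> a \<le> b"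
      proof (intro allI impI)
        fix b assume b: "barred X B {} b"
        have h_lt: "h n < b" if n: "n \<in> X" for n
        proof -
          have "{} \<notin> B" by (auto simp: B_def)
          then obtain c where c: "c < b" "barred X B {n} c"
            using barred_step[OF b n] by auto
          have "barred {x\<in>X. n < x} {r. {n} \<union> r \<in> B} {} c"
            using c(2) by (intro barred_unshift[of X]) auto
          \<comment> \<open>All members of \<open>B\<close> with least element \<open>n\<close> come
            from \<open>S n\<close>, so the exactness of \<open>S n\<close> applies to
            \<open>c\<close>.\<close>
          from barred_restrict_empty[OF this] have "barred {x\<in>X. n < x} (S n) {} c"
          proof (rule barred_mono)
            show "{r \<in> {r. {n} \<union> r \<in> B}. finite r \<and> r \<subseteq> {x \<in> X. n < x}} \<subseteq> S n"
            proof (intro subsetI)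
              fix r assume r: "r \<in> {r \<in> {r. {n} \<union> r \<in> B}. finite r \<and> r \<subseteq> {x \<in> X. n < x}}"
              then obtain m q where q: "insert n r = insert m q" "q \<in> S m" by (auto simp: B_def)
              have "n \<notin> r" "\<And>x. x \<in> r \<Longrightarrow> n < x" using r by auto
              moreover have "m \<notin> q" "\<And>x. x \<in> q \<Longrightarrow> m < x" using S_fin[OF q(2)] by auto
              ultimately have "m = n" using q(1) by (metis insertE insertI1 less_asym)
              then have "r = q" using q(1) \<open>n \<notin> r\<close> \<open>m \<notin> q\<close> by (metis insert_ident)
              then show "r \<in> S n" using q \<open>m = n\<close> by simp
            qed
          qed auto
          then have "h n \<le> c" using S(2)[of n] by (auto simp: exact_barrier_def)
          then show ?thesis using c(1) by simp
        qed
        show "a \<le> b"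
        proof (rule ccontr)
          assume "\<not> a \<le> b"
          then have "b \<in> range g" using g by auto
          then obtain i where i: "b = g i" by blast
          obtain n where n: "n \<in> X" "i < n" using less.prems(1) by (meson infinite_nat_iff_unbounded)
          then show False using h_lt[OF n(1)] h_ge[of i n] i by auto
        qed
      qed
    qed
    ultimately show ?thesis by blast
  qed
qed

section \<open>Min-homogeneous sets\<close>

lemma front_sum_assoc: "(A \<oplus> B) \<oplus> C = A \<oplus> (B \<oplus> C)"
proof (intro equalityI subsetI)
  fix x assume "x \<in> (A \<oplus> B) \<oplus> C"
  then obtain c b a where "x = c \<union> (b \<union> a)" "c \<in> C" "b \<in> B" "a \<in> A" "c \<lless> b \<union> a" "b \<lless> a"
    unfolding front_sum_def by blast
  moreover from this have "c \<union> b \<in> B \<oplus> C" unfolding front_sum_def by blast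
  ultimately show "x \<in> A \<oplus> (B \<oplus> C)"
    unfolding front_sum_def [of A] by (intro CollectI exI[of _ "c \<union> b"] exI[of _ a]) auto
next
  fix x assume "x \<in> A \<oplus> (B \<oplus> C)"
  then obtain c b a where "x = (c \<union> b) \<union> a" "c \<in> C" "b \<in> B" "a \<in> A" "c \<lless> b" "c \<union> b \<lless> a"
    unfolding front_sum_def by blast
  moreover from this have "b \<union> a \<in> A \<oplus> B" unfolding front_sum_def by blast
  ultimately show "x \<in> (A \<oplus> B) \<oplus> C"
    unfolding front_sum_def [of _ C] by (intro CollectI exI[of _ c] exI[of _ "b \<union> a"]) auto
qed

lemma front_sumI: "s \<in> B \<Longrightarrow> t \<in> A \<Longrightarrow> s \<lless> t \<Longrightarrow> s \<union> t \<in> A \<oplus> B"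
  unfolding front_sum_def by blast

lemma front_sumE:
  assumes "u \<in> A \<oplus> B"
  obtains s t where "u = s \<union> t" "s \<in> B" "t \<in> A" "s \<lless> t"
  using assms unfolding front_sum_def by blast

lemma front_sum_empty [simp]: "A \<oplus> {{}} = A"
  unfolding front_sum_def by simp

text \<open>The last element ranges over all numbers, so that no base has to be carried along;
  \<open>singletons_base_front_sum\<close> translates back.\<close>

definition one :: "nat set set \<Rightarrow> nat set set" where
  "one C = singletons UNIV \<oplus> C"

lemma oneI: "v \<in> C \<Longrightarrow> v \<lless> {y} \<Longrightarrow> insert y v \<in> one C"
  using front_sumI[of v C "{y}" "singletons UNIV"] by (simp add: one_def singletons_def)

lemma oneE:
  assumes "u \<in> one C"
  obtains v y where "u = insert y v" "v \<in> C" "v \<lless> {y}"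
  using assms unfolding one_def singletons_def by (auto elim!: front_sumE)

lemma one_front_sum: "one (C \<oplus> D) = one C \<oplus> D"
  by (simp add: one_def front_sum_assoc)

lemma one_nonempty: "u \<in> one C \<Longrightarrow> u \<noteq> {}"
  by (auto elim: oneE)

lemma antichain_one: "antichain C \<Longrightarrow> antichain (one C)"
  unfolding antichain_def
proof (intro ballI impI)
  fix s t assume C: "\<forall>s\<in>C. \<forall>t\<in>C. s \<subseteq> t \<longrightarrow> s = t" and "s \<in> one C" "t \<in> one C" and sub: "s \<subseteq> t"
  then obtain v y v' y' where s: "s = insert y v" "v \<in> C" "v \<lless> {y}" and t: "t = insert y' v'" "v' \<in> C" "v' \<lless> {y'}"
    by (auto elim!: oneE)
  have "y \<le> y'" using sub s t by (auto intro: less_imp_le)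
  then have "v \<subseteq> v'" using sub s t by fastforce
  then have "v = v'" using C s t by blast
  then show "s = t" using sub s t by auto
qed

lemma Min_Un_below:
  assumes "finite d" "finite w" "w \<noteq> {}" "d \<lless> w"
  shows "Min (d \<union> w) = Min (insert (Min w) d)"
  using assms by (cases "d = {}") (auto simp: Min_Un min.commute)

text \<open>Elements put in front can only make a \<open>C\<close>-initial segment end earlier: a
  member of \<open>C\<close> extending \<open>r \<union> q\<close> contains \<open>q\<close>, hence
  equals it. The last element of \<open>w\<close> remains available as the element after that
  segment.\<close>

lemma one_extend:
  assumes C: "antichain C" "dense Y C" "\<forall>v\<in>C. finite v"
    and w: "w \<in> one C" "w \<subseteq> Y" and r: "finite r" "r \<subseteq> Y" "r \<lless> w"
  shows "\<exists>w'\<in>one C. iseg w' (r \<union> w)"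
proof -
  obtain q y where q: "w = insert y q" "q \<in> C" "q \<lless> {y}" using w(1) by (rule oneE)
  let ?f = "r \<union> q" and ?F = "r \<union> w"
  have fin: "finite ?f" "finite ?F" using r q C by auto
  obtain e where e: "e \<in> C" "iseg e ?f \<or> iseg ?f e"
    using C(2) fin(1) r w q unfolding dense_def by (metis Un_subset_iff insert_subset)
  have e': "iseg e ?f"
  proof (cases "iseg e ?f")
    case False
    then have "iseg ?f e" using e by blast
    then have "q \<subseteq> e" "?f \<subseteq> e" by (auto simp: iseg_def)
    then have "q = e" using C(1) q e by (auto simp: antichain_def)
    then have "e = ?f" using \<open>?f \<subseteq> e\<close> by blast
    then show ?thesis by simp
  qed
  have "iseg ?f ?F" using q r by (auto simp: iseg_def)
  then have F: "iseg e ?F" using e' iseg_trans by blast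
  have "y \<notin> e" using e' q r by (auto simp: iseg_def)
  then have "e \<noteq> ?F" using q by auto
  note m = iseg_insert_Min[OF F this fin(2)]
  show ?thesis using m oneI[OF e(1) m(2)] by blast
qed

text \<open>\<open>one_extend\<close> is applied to the part of \<open>p\<close> from
  \<open>x\<close> on. The resulting representatives turn a colouring that depends only on minima
  into a colouring of numbers.\<close>

lemma one_extend_at:
  assumes C: "antichain C" "dense Y C" "\<forall>v\<in>C. finite v"
    and w: "w \<in> one C" "finite (p \<union> w)" "p \<union> w \<subseteq> Y" "p \<lless> w" and x: "x \<in> insert (Min w) p"
  obtains w' where "w' \<in> one C" "w' \<subseteq> p \<union> w" "Min w' = x"
proof -
  let ?r = "{y\<in>p. x \<le> y}"
  have m: "Min w \<in> w" "\<And>y. y \<in> w \<Longrightarrow> Min w \<le> y" using w one_nonempty by auto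
  have "?r \<lless> w" "w \<subseteq> Y" "?r \<subseteq> Y" "finite ?r" using w by auto
  then obtain w' where w': "w' \<in> one C" "iseg w' (?r \<union> w)"
    using one_extend[OF C w(1)] by blast
  have "Min w' = Min (?r \<union> w)"
    using w' w(2) one_nonempty by (intro iseg_Min) auto
  also have "\<dots> = x"
    using x m w by (intro Min_eqI) (auto intro: less_imp_le less_le_trans)
  finally show thesis using w' that by (auto simp: iseg_def)
qed

section \<open>Families that force min-homogeneous subsets\<close>

definition min_hom :: "nat set set \<Rightarrow> (nat set \<Rightarrow> nat) \<Rightarrow> nat set \<Rightarrow> bool" where
  "min_hom E c t \<longleftrightarrow> (\<forall>u\<in>E. \<forall>v\<in>E. u \<subseteq> t \<longrightarrow> v \<subseteq> t \<longrightarrow> Min u = Min v \<longrightarrow> c u = c v)"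

text \<open>
  The number \<open>k x\<close> of admissible colours of a set may depend on its minimum \<open>x\<close>; this freedom
  is what allows the bounds for \<open>C\<close> and \<open>D\<close> to be composed into one for \<open>C \<oplus> D\<close>.
\<close>

definition coloring :: "nat set set \<Rightarrow> (nat \<Rightarrow> nat) \<Rightarrow> nat set \<Rightarrow> (nat set \<Rightarrow> nat) \<Rightarrow> bool" where
  "coloring E k s c \<longleftrightarrow> (\<forall>u\<in>E. u \<subseteq> s \<longrightarrow> c u < k (Min u))"

definition good :: "nat set set \<Rightarrow> nat set set \<Rightarrow> (nat \<Rightarrow> nat) \<Rightarrow> nat set set" where
  "good A C k = {s. finite s \<and> (\<forall>c. coloring (one C) k s c \<longrightarrow>
    (\<exists>t\<in>one C \<oplus> A. t \<subseteq> s \<and> min_hom (one C) c t))}"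

text \<open>A barrier contained in \<open>pre Y Q\<close> absorbs the last element of a \<open>(1 \<oplus> B)\<close>-size set.\<close>

definition pre :: "nat set \<Rightarrow> nat set set \<Rightarrow> nat set set" where
  "pre Y Q = {s. \<forall>y\<in>Y. s \<lless> {y} \<longrightarrow> insert y s \<in> Q}"

text \<open>\<open>A\<close> is an arbitrary family rather than a barrier, since in compositions its
  role is taken by families such as \<open>pre Y (good A D k)\<close>.\<close>

definition minhom_bound :: "nat set \<Rightarrow> (cordinal \<Rightarrow> cordinal) \<Rightarrow> nat set set \<Rightarrow> bool" where
  "minhom_bound Y f C \<longleftrightarrow>
    (\<forall>A k a. barred Y A {} a \<longrightarrow> barred Y (pre Y (good A C k)) {} (f a))"

lemma coloring_subset: "coloring E k s c \<Longrightarrow> t \<subseteq> s \<Longrightarrow> coloring E k t c"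
  unfolding coloring_def by blast

lemma good_superset:
  assumes "s \<in> good A C k" "s \<subseteq> t" "finite t"
  shows "t \<in> good A C k"
  unfolding good_def
proof (intro CollectI conjI allI impI)
  fix c assume "coloring (one C) k t c"
  then have "coloring (one C) k s c" using assms(2) by (rule coloring_subset)
  then obtain u where "u \<in> one C \<oplus> A" "u \<subseteq> s" "min_hom (one C) c u"
    using assms(1) unfolding good_def by blast
  then show "\<exists>u\<in>one C \<oplus> A. u \<subseteq> t \<and> min_hom (one C) c u"
    using assms(2) by (meson order_trans)
qed fact

lemma end_closed_pre_good: "end_closed (pre Y (good A C k) \<inter> {s. finite s})"
proof -
  have "insert y (insert n s) \<in> good A C k"
    if "\<forall>y\<in>Y. s \<lless> {y} \<longrightarrow> insert y s \<in> good A C k" "y \<in> Y" "insert n s \<lless> {y}" "finite s" for y n s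
    by (rule good_superset[of "insert y s"]) (use that in auto)
  then show ?thesis by (auto simp: end_closed_def pre_def)
qed

text \<open>The sets in \<open>one {{}}\<close> are singletons and thus determined by their minimum,
  so every colouring is min-homogeneous.\<close>

lemma pre_good_degenerate:
  assumes "s \<in> A" "finite s"
  shows "s \<in> pre Y (good A {{}} k)"
  unfolding pre_def
proof (intro CollectI ballI impI)
  fix y assume y: "s \<lless> {y}"
  have "{y} \<in> one {{}}" using oneI[of "{}" "{{}}" y] by simp
  then have "s \<union> {y} \<in> one {{}} \<oplus> A" using assms y by (intro front_sumI) auto
  moreover have "min_hom (one {{}}) c t" for c t by (auto simp: min_hom_def elim!: oneE)
  ultimately show "insert y s \<in> good A {{}} k" using assms by (auto simp: good_def)
qed

lemma minhom_bound_degenerate: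
  assumes "\<And>a. a \<le> f a"
  shows "minhom_bound Y f {{}}"
  unfolding minhom_bound_def
proof (intro allI impI)
  fix A k a assume A: "barred Y A {} a"
  show "barred Y (pre Y (good A {{}} k)) {} (f a)"
    by (rule barred_mono[OF barred_restrict_empty[OF A] _ _ assms]) (auto intro: pre_good_degenerate)
qed

lemma minhom_bound_restrict:
  assumes "minhom_bound Y f (C \<inter> Pow Y)"
  shows "minhom_bound Y f C"
  unfolding minhom_bound_def
proof (intro allI impI)
  fix A k a assume A: "barred Y A {} a"
  have one: "u \<in> one (C \<inter> Pow Y) \<longleftrightarrow> u \<in> one C" if "u \<subseteq> Y" for u
    using that by (auto elim!: oneE intro!: oneI)
  have "s \<in> good A C k" if "s \<in> good A (C \<inter> Pow Y) k" "s \<subseteq> Y" for s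
  proof -
    have "\<exists>t\<in>one C \<oplus> A. t \<subseteq> s \<and> min_hom (one C) c t" if c: "coloring (one C) k s c" for c
    proof -
      have "coloring (one (C \<inter> Pow Y)) k s c"
        using c one \<open>s \<subseteq> Y\<close> by (auto simp: coloring_def)
      then obtain t where t: "t \<in> one (C \<inter> Pow Y) \<oplus> A" "t \<subseteq> s" "min_hom (one (C \<inter> Pow Y)) c t"
        using \<open>s \<in> good A (C \<inter> Pow Y) k\<close> by (auto simp: good_def)
      have "t \<in> one C \<oplus> A"
        using t(1,2) \<open>s \<subseteq> Y\<close> one by (auto elim!: front_sumE intro!: front_sumI)
      moreover have "min_hom (one C) c t"
        using t(2,3) \<open>s \<subseteq> Y\<close> one unfolding min_hom_def by (meson order_trans)
      ultimately show ?thesis using t by blast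
    qed
    then show ?thesis using that by (auto simp: good_def)
  qed
  then have sub: "{s \<in> pre Y (good A (C \<inter> Pow Y) k). finite s \<and> s \<subseteq> Y} \<subseteq> pre Y (good A C k)"
    by (auto simp: pre_def)
  have "barred Y (pre Y (good A (C \<inter> Pow Y) k)) {} (f a)"
    using assms A by (simp add: minhom_bound_def)
  from barred_restrict_empty[OF this] show "barred Y (pre Y (good A C k)) {} (f a)"
    by (rule barred_mono) (use sub in auto)
qed

subsection \<open>Composition\<close>

text \<open>A set \<open>w\<close> with minimum \<open>x\<close> is coloured by the function sending \<open>v \<subseteq> {..<x}\<close> to the colour of
  \<open>v \<union> w\<close>.\<close>

definition color_vectors :: "(nat \<Rightarrow> nat) \<Rightarrow> nat \<Rightarrow> (nat set \<Rightarrow> nat) set" where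
  "color_vectors k x = PiE (Pow {..<x}) (\<lambda>_. {..\<Sum>i\<le>x. k i})"

text \<open>Min-homogeneity for the vectors makes \<open>c (v \<union> w)\<close> depend on
  \<open>v\<close> and \<open>Min w\<close> only. Replacing \<open>w\<close> by its minimum turns
  \<open>c\<close> into a colouring of \<open>one D\<close>; in a min-homogeneous set for that
  colouring the last element is expanded into a set of \<open>one C\<close> again.\<close>

lemma good_compose:
  assumes C: "antichain C" "dense Y C" "\<forall>v\<in>C. finite v" and D: "\<forall>v\<in>D. finite v"
    and s: "s \<in> good (pre Y (good A D k)) C (\<lambda>x. card (color_vectors k x))" "s \<subseteq> Y"
  shows "s \<in> good A (C \<oplus> D) k"
proof -
  let ?F = "color_vectors k"
  have fin_s: "finite s" using s by (simp add: good_def)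
  have "\<exists>t\<in>one (C \<oplus> D) \<oplus> A. t \<subseteq> s \<and> min_hom (one (C \<oplus> D)) c t"
    if c: "coloring (one (C \<oplus> D)) k s c" for c
  proof -
    have finF: "finite (?F x)" for x by (auto simp: color_vectors_def intro!: finite_PiE)
    have one_fin: "finite w" "Min w \<in> w" "\<And>x. x \<in> w \<Longrightarrow> Min w \<le> x" if "w \<in> one C" "w \<subseteq> s" for w
      using one_nonempty[OF that(1)] finite_subset[OF that(2) fin_s] by auto
    have sum_in: "v \<union> w \<in> one (C \<oplus> D)" if "v \<in> D" "w \<in> one C" "v \<lless> w" for v w
      using that by (auto simp: one_front_sum intro: front_sumI)
    \<comment> \<open>Only \<open>D\<close>-subsets of \<open>s\<close> carry information; the entry
      0 elsewhere keeps the vector in the finite set \<open>color_vectors k (Min w)\<close>.\<close>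
    define h where "h w = (\<lambda>v\<in>Pow {..<Min w}. if v \<in> D \<and> v \<subseteq> s then c (v \<union> w) else 0)" for w
    define c1 where "c1 w = to_nat_on (?F (Min w)) (h w)" for w
    have hF: "h w \<in> ?F (Min w)" if w: "w \<in> one C" "w \<subseteq> s" for w
      unfolding h_def color_vectors_def
    proof (intro restrict_PiE_iff[THEN iffD2] ballI)
      fix v assume v: "v \<in> Pow {..<Min w}"
      show "(if v \<in> D \<and> v \<subseteq> s then c (v \<union> w) else 0) \<in> {..\<Sum>i\<le>Min w. k i}"
      proof (cases "v \<in> D \<and> v \<subseteq> s")
        case True
        have "v \<lless> w" using v one_fin[OF w] by (auto intro: less_le_trans)
        then have "c (v \<union> w) < k (Min (v \<union> w))"
          using c True w sum_in unfolding coloring_def by auto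
        moreover have "Min (v \<union> w) \<le> Min w"
          using one_fin[OF w] True fin_s by (intro Min_antimono) (auto intro: finite_subset)
        then have "k (Min (v \<union> w)) \<le> (\<Sum>i\<le>Min w. k i)"
          by (intro member_le_sum) auto
        ultimately show ?thesis using True by simp
      qed auto
    qed
    have "coloring (one C) (\<lambda>x. card (?F x)) s c1"
      unfolding coloring_def c1_def using hF bij_betwE[OF to_nat_on_finite[OF finF]] by blast
    then obtain t' where t': "t' \<in> one C \<oplus> pre Y (good A D k)" "t' \<subseteq> s" "min_hom (one C) c1 t'"
      using s by (auto simp: good_def)
    have decode: "c (v \<union> w) = c (v \<union> w')"
      if w: "w \<in> one C" "w \<subseteq> t'" "w' \<in> one C" "w' \<subseteq> t'" "Min w = Min w'"
        and v: "v \<in> D" "v \<subseteq> s" "v \<lless> {Min w}" for v w w'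
    proof -
      have "c1 w = c1 w'" using t'(3) w unfolding min_hom_def by blast
      then have "to_nat_on (?F (Min w)) (h w) = to_nat_on (?F (Min w)) (h w')"
        unfolding c1_def w(5) .
      moreover have "h w \<in> ?F (Min w)" "h w' \<in> ?F (Min w)"
        using hF[of w] hF[of w'] w t'(2) by auto
      ultimately have "h w = h w'"
        by (rule inj_onD[OF bij_betw_imp_inj_on[OF to_nat_on_finite[OF finF]]])
      then have "h w v = h w' v" by simp
      moreover have "v \<subseteq> {..<Min w}" "v \<subseteq> {..<Min w'}" using v(3) w(5) by auto
      ultimately show ?thesis using v by (simp add: h_def)
    qed
    obtain p' w' where p': "t' = p' \<union> w'" "p' \<in> pre Y (good A D k)" "w' \<in> one C" "p' \<lless> w'"
      using t'(1) by (rule front_sumE)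
    \<comment> \<open>Of the last block only the minimum is kept; it is the further element that
      \<open>pre\<close> asks for.\<close>
    let ?z = "Min w'"
    have w': "finite w'" "?z \<in> w'" "\<And>x. x \<in> w' \<Longrightarrow> ?z \<le> x" using one_fin[of w'] p' t' by auto
    have fin_t': "finite t'" using fin_s t' finite_subset by blast
    have "insert ?z p' \<in> good A D k"
      using p' w' t' s(2) unfolding pre_def by blast
    have ex_w: "\<exists>w. w \<in> one C \<and> w \<subseteq> t' \<and> Min w = x" if x: "x \<in> insert ?z p'" for x
    proof -
      have "p' \<union> w' \<subseteq> Y" using p'(1) t'(2) s(2) by (metis order_trans)
      then obtain w where "w \<in> one C" "w \<subseteq> p' \<union> w'" "Min w = x"
        using one_extend_at[OF C p'(3) _ _ p'(4) x] fin_t' p'(1) by auto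
      then show ?thesis using p' by blast
    qed
    define W where "W x = (SOME w. w \<in> one C \<and> w \<subseteq> t' \<and> Min w = x)" for x
    have W: "W x \<in> one C" "W x \<subseteq> t'" "Min (W x) = x" if "x \<in> insert ?z p'" for x
      using someI_ex[OF ex_w[OF that]] by (auto simp: W_def)
    have W_ge: "x \<le> y" if "x \<in> insert ?z p'" "y \<in> W x" for x y
      using W[OF that(1)] one_fin[of "W x"] t' that by auto
    \<comment> \<open>For a set in \<open>one D\<close>, \<open>Max e\<close> is the added element;
      it is expanded to the representative with that minimum.\<close>
    define c2 where "c2 e = c ((e - {Max e}) \<union> W (Max e))" for e
    have c2: "c2 (insert x d) = c (d \<union> W x)" if "d \<in> D" "d \<lless> {x}" for d x
    proof -
      have "Max (insert x d) = x" using that D by (intro Max_eqI) (auto intro: less_imp_le)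
      moreover have "insert x d - {x} = d" using that by auto
      ultimately show ?thesis by (simp add: c2_def)
    qed
    have "coloring (one D) k (insert ?z p') c2"
      unfolding coloring_def
    proof (intro ballI impI)
      fix e assume "e \<in> one D" and sub: "e \<subseteq> insert ?z p'"
      then obtain d x where e: "e = insert x d" "d \<in> D" "d \<lless> {x}" by (auto elim: oneE)
      then have x: "x \<in> insert ?z p'" using sub by auto
      have lt: "d \<lless> W x" using e W_ge[OF x] by (auto intro: less_le_trans)
      have "insert ?z p' \<subseteq> t'" using p' w' by auto
      then have "d \<union> W x \<subseteq> s" using e sub W[OF x] t' by blast
      moreover have "d \<union> W x \<in> one (C \<oplus> D)" using e lt W[OF x] by (intro sum_in) auto
      ultimately have "c (d \<union> W x) < k (Min (d \<union> W x))" using c by (auto simp: coloring_def)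
      also have "Min (d \<union> W x) = Min e"
        using Min_Un_below[of d "W x"] W[OF x] lt one_fin[of "W x"] one_nonempty[of "W x"] t' e D
        by auto
      finally show "c2 e < k (Min e)" using c2[of d x] e by simp
    qed
    then obtain t2 where t2: "t2 \<in> one D \<oplus> A" "t2 \<subseteq> insert ?z p'" "min_hom (one D) c2 t2"
      using \<open>insert ?z p' \<in> good A D k\<close> by (auto simp: good_def)
    obtain p w where pw: "t2 = p \<union> w" "p \<in> A" "w \<in> one D" "p \<lless> w"
      using t2(1) by (rule front_sumE)
    obtain x d where xd: "w = insert x d" "d \<in> D" "d \<lless> {x}" using pw(3) by (rule oneE)
    have x: "x \<in> insert ?z p'" using t2 pw xd by auto
    have Wx: "\<And>y. y \<in> W x \<Longrightarrow> x \<le> y" "W x \<in> one C" "W x \<subseteq> t'" using W_ge[OF x] W[OF x] by auto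
    let ?t = "p \<union> (d \<union> W x)"
    have d_W: "d \<lless> W x" using xd Wx by (auto intro: less_le_trans)
    have "p \<lless> W x" using pw xd Wx by (auto intro: less_le_trans)
    then have "?t \<in> one (C \<oplus> D) \<oplus> A"
      using pw xd Wx d_W by (intro front_sumI sum_in) auto
    have "insert ?z p' \<subseteq> t'" using p' w' by auto
    then have t_sub: "p \<subseteq> t'" "d \<subseteq> t'" "t2 \<subseteq> t'" using t2(2) pw xd by auto
    then have t_t': "?t \<subseteq> t'" using Wx by auto
    have key: "\<exists>e\<in>one D. e \<subseteq> t2 \<and> Min e = Min u \<and> c u = c2 e"
      if u: "u \<in> one (C \<oplus> D)" "u \<subseteq> ?t" for u
    proof -
      obtain d1 w1 where dw: "u = d1 \<union> w1" "d1 \<in> D" "w1 \<in> one C" "d1 \<lless> w1"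
        using u(1) unfolding one_front_sum by (rule front_sumE)
      let ?m = "Min w1"
      have w1_t': "w1 \<subseteq> t'" using dw u t_t' by auto
      then have w1: "finite w1" "?m \<in> w1" "\<And>x. x \<in> w1 \<Longrightarrow> ?m \<le> x" using one_fin[of w1] dw t' by auto
      \<comment> \<open>Either \<open>w1\<close> is the whole of \<open>W x\<close>, by the
        antichain property, or it has an element in \<open>p \<union> d\<close>, hence below
        \<open>x\<close>.\<close>
      have m_le: "?m \<le> x \<and> ?m \<in> t2"
      proof (cases "w1 \<subseteq> W x")
        case True
        then have "w1 = W x" using antichain_one[OF C(1)] dw Wx by (auto simp: antichain_def)
        then show ?thesis using W[OF x] pw xd by auto
      next
        case False
        then obtain y where "y \<in> w1" "y \<in> p \<union> d" using u dw by auto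
        then have "y < x" using pw(4) xd(1,3) by auto
        then have "?m < x" using w1(3)[OF \<open>y \<in> w1\<close>] by simp
        moreover have "?m \<in> ?t" using u dw w1 by auto
        moreover have "?m \<notin> W x" using Wx(1)[of ?m] \<open>?m < x\<close> by auto
        ultimately show ?thesis using pw xd by auto
      qed
      have d1: "d1 \<lless> {?m}" using dw w1 by auto
      have "y \<in> p \<union> d" if "y \<in> d1" for y
      proof -
        have "y < x" using that d1 m_le by (auto intro: less_le_trans)
        then have "y \<notin> W x" using Wx(1)[of y] by auto
        then show ?thesis using that u dw by auto
      qed
      then have sub: "insert ?m d1 \<subseteq> t2" using m_le pw xd by auto
      have mz: "?m \<in> insert ?z p'" using m_le t2 by auto
      have "d1 \<subseteq> s" using u(2) dw(1) t_t' t'(2) by blast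
      then have "c (d1 \<union> w1) = c (d1 \<union> W ?m)"
        using W[OF mz] w1_t' dw d1 by (intro decode) auto
      also have "\<dots> = c2 (insert ?m d1)" using c2 dw d1 by simp
      finally have "c u = c2 (insert ?m d1)" using dw by simp
      moreover have "Min (insert ?m d1) = Min u"
        using Min_Un_below[of d1 w1] dw w1 D one_nonempty by auto
      ultimately show ?thesis using sub oneI[OF dw(2) d1] by blast
    qed
    have "min_hom (one (C \<oplus> D)) c ?t"
      unfolding min_hom_def using key t2(3) unfolding min_hom_def by metis
    then show ?thesis using \<open>?t \<in> one (C \<oplus> D) \<oplus> A\<close> t_t' t' by blast
  qed
  then show ?thesis using fin_s by (auto simp: good_def)
qed

text \<open>The bound for \<open>D\<close> gives a bar of rank \<open>g a\<close>, and this bar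
  takes the place of \<open>A\<close> in the bound for \<open>C\<close>.\<close>

lemma minhom_bound_compose:
  assumes C: "antichain C" "dense Y C" "\<forall>v\<in>C. finite v" and D: "\<forall>v\<in>D. finite v"
    and "minhom_bound Y f C" "minhom_bound Y g D"
  shows "minhom_bound Y (f \<circ> g) (C \<oplus> D)"
  unfolding minhom_bound_def
proof (intro allI impI)
  fix A and k :: "nat \<Rightarrow> nat" and a assume "barred Y A {} a"
  then have "barred Y (pre Y (good A D k)) {} (g a)"
    using assms by (simp add: minhom_bound_def)
  then have "barred Y (pre Y (good (pre Y (good A D k)) C
      (\<lambda>x. card (color_vectors k x)))) {} (f (g a))"
    using assms by (simp add: minhom_bound_def)
  from barred_restrict_empty[OF this] show "barred Y (pre Y (good A (C \<oplus> D) k)) {} ((f \<circ> g) a)"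
    by (rule barred_mono) (auto simp: pre_def intro!: good_compose[OF C D])
qed

text \<open>If some element of \<open>d1\<close> lies in \<open>q2\<close>, then \<open>q1\<close>,
  lying above it, is contained in \<open>q2\<close> and thus equal to it; but that element is below
  all of \<open>q1\<close>.\<close>

lemma antichain_front_sum:
  assumes "antichain C" "antichain D"
  shows "antichain (C \<oplus> D)"
  unfolding antichain_def
proof (intro ballI impI)
  fix u v assume "u \<in> C \<oplus> D" "v \<in> C \<oplus> D" and sub: "u \<subseteq> v"
  then obtain d1 q1 d2 q2 where u: "u = d1 \<union> q1" "d1 \<in> D" "q1 \<in> C" "d1 \<lless> q1"
    and v: "v = d2 \<union> q2" "d2 \<in> D" "q2 \<in> C" "d2 \<lless> q2"
    by (auto elim!: front_sumE)
  have "d1 \<subseteq> d2"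
  proof (rule ccontr)
    assume "\<not> d1 \<subseteq> d2"
    then obtain x where x: "x \<in> d1" "x \<in> q2" using sub u(1) v(1) by blast
    have "y \<in> q2" if "y \<in> q1" for y
    proof -
      have "x < y" using x u that by blast
      moreover have "y \<in> d2 \<Longrightarrow> y < x" using v x by blast
      ultimately show ?thesis using sub u v that by (meson UnE UnI2 less_asym subsetD)
    qed
    then have "q1 = q2" using assms(1) u(3) v(3) unfolding antichain_def by blast
    then show False using x u by blast
  qed
  then have d: "d1 = d2" using assms(2) u(2) v(2) unfolding antichain_def by blast
  have "q1 \<subseteq> q2"
  proof
    fix x assume "x \<in> q1"
    moreover from this have "x \<notin> d2" using u(4) d by blast
    ultimately show "x \<in> q2" using sub u(1) v(1) by blast
  qed
  then have "q1 = q2" using assms(1) u(3) v(3) unfolding antichain_def by blast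
  then show "u = v" using u v d by simp
qed

text \<open>First \<open>D\<close> is compared with \<open>f\<close>, then \<open>C\<close> with the
  remainder \<open>f - e\<close>. If \<open>e\<close> already covers \<open>f\<close>, any member of
  \<open>C\<close> beyond \<open>e\<close> completes it.\<close>

lemma dense_front_sum:
  assumes "dense Y C" "dense Y D" "\<forall>v\<in>D. finite v" "infinite Y"
  shows "dense Y (C \<oplus> D)"
  unfolding dense_def
proof (intro allI impI)
  fix f assume f: "finite f" "f \<subseteq> Y"
  obtain e where e: "e \<in> D" "iseg e f \<or> iseg f e" using assms(2) f unfolding dense_def by blast
  have ex: "\<exists>q\<in>C. e \<lless> q"
  proof -
    obtain n where n: "n \<in> Y" "n > Max (insert 0 e)"
      using assms(4) by (meson infinite_nat_iff_unbounded)
    then have n': "e \<lless> {n}" using assms(3) e by auto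
    obtain q where "q \<in> C" "iseg q {n} \<or> iseg {n} q"
      using assms(1) n unfolding dense_def by (metis empty_subsetI finite.simps insert_subset)
    moreover from this(2) have "n \<le> x" if "x \<in> q" for x
      using that by (cases "x = n") (auto simp: iseg_def intro!: less_imp_le)
    ultimately show ?thesis using n' by (meson less_le_trans singletonI)
  qed
  show "\<exists>e\<in>C \<oplus> D. iseg e f \<or> iseg f e"
  proof (cases "iseg f e")
    case True
    obtain q where "q \<in> C" "e \<lless> q" using ex by blast
    then have "e \<union> q \<in> C \<oplus> D" "iseg e (e \<union> q)" using e by (auto intro: front_sumI iseg_Un)
    then show ?thesis using True iseg_trans by blast
  next
    case False
    then have ef: "iseg e f" "f \<noteq> e" using e by auto
    let ?g = "f - e"
    have g: "?g \<noteq> {}" "finite ?g" "?g \<subseteq> Y" using ef f by (auto simp: iseg_def)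
    obtain q where q: "q \<in> C" "iseg q ?g \<or> iseg ?g q" using assms(1) g unfolding dense_def by blast
    from q(2) show ?thesis
    proof
      assume i: "iseg q ?g"
      then have "e \<lless> q" using ef by (auto simp: iseg_def)
      moreover have "iseg (e \<union> q) f" using i ef by (auto simp: iseg_def)
      ultimately show ?thesis using q e front_sumI by blast
    next
      assume i: "iseg ?g q"
      obtain y where y: "y \<in> ?g" using g by blast
      have "e \<lless> q"
      proof (intro ballI)
        fix m n assume mn: "m \<in> e" "n \<in> q"
        then have "m < y" using y ef by (auto simp: iseg_def)
        show "m < n"
        proof (cases "n \<in> ?g")
          case True
          then show ?thesis using mn ef by (auto simp: iseg_def)
        next
          case False
          then have "y < n" using y mn i unfolding iseg_def by blast
          then show ?thesis using \<open>m < y\<close> by simp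
        qed
      qed
      moreover have "iseg f (e \<union> q)" using i ef calculation by (auto simp: iseg_def)
      ultimately show ?thesis using q e front_sumI by blast
    qed
  qed
qed

subsection \<open>Colourings of pairs\<close>

definition omega_sum :: "cordinal multiset \<Rightarrow> cordinal" where
  "omega_sum M = sum_list (map omega_pow (rev (sorted_list_of_multiset M)))"

lemma omega_sum_single [simp]: "omega_sum {#r#} = omega_pow r"
  by (simp add: omega_sum_def)

lemma omega_sum_add:
  assumes "\<forall>x\<in>#H. \<forall>y\<in>#L. y \<le> x"
  shows "omega_sum (H + L) = omega_sum H + omega_sum L"
proof -
  let ?xs = "sorted_list_of_multiset L @ sorted_list_of_multiset H"
  have "sorted ?xs" using assms by (auto simp: sorted_append)
  then have "sorted_list_of_multiset (mset ?xs) = ?xs"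
    by (simp only: sorted_list_of_multiset_mset sorted_sort_id)
  then have "sorted_list_of_multiset (H + L) = ?xs" by (simp add: add.commute)
  then show ?thesis unfolding omega_sum_def by simp
qed

lemma omega_sum_less: "(\<And>x. x \<in># L \<Longrightarrow> x < r) \<Longrightarrow> omega_sum L < omega_pow r"
  unfolding omega_sum_def by (rule sum_omega_pow_less) simp

text \<open>The terms with exponent at least \<open>r\<close> stay in front unchanged; all others,
  old and new, have exponents below \<open>r\<close> and add up to less than
  \<open>omega_pow r\<close>.\<close>

lemma omega_sum_replace:
  assumes "\<And>x. x \<in># N \<Longrightarrow> x < r"
  shows "omega_sum (M + N) < omega_sum (add_mset r M)"
proof -
  define H L where "H = filter_mset (\<lambda>x. r \<le> x) M" and "L = filter_mset (\<lambda>x. \<not> r \<le> x) M"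
  have M: "M = H + L" unfolding H_def L_def by (rule multiset_partition)
  have H: "\<forall>x\<in>#H. r \<le> x" and L: "\<forall>x\<in>#L. x < r" by (auto simp: H_def L_def)
  have HL: "y \<le> x" if "x \<in># H" "y < r" for x y
    using H that by (meson less_imp_le less_le_trans)
  have "omega_sum (M + N) = omega_sum (H + (L + N))" by (simp add: M ac_simps)
  also have "\<dots> = omega_sum H + omega_sum (L + N)"
    using HL L assms by (intro omega_sum_add) auto
  also have "\<dots> < omega_sum H + omega_pow r"
    using L assms by (auto intro!: omega_sum_less)
  also have "\<dots> \<le> omega_sum H + (omega_pow r + omega_sum L)" by simp
  also have "omega_pow r + omega_sum L = omega_sum ({#r#} + L)"
    using L by (subst omega_sum_add) (auto intro: less_imp_le)
  also have "omega_sum H + omega_sum ({#r#} + L) = omega_sum (H + ({#r#} + L))"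
    using H HL L by (intro omega_sum_add[symmetric]) auto
  also have "H + ({#r#} + L) = add_mset r M" by (simp add: M)
  finally show ?thesis .
qed

section \<open>Branches of the Erdos-Rado tree\<close>

lemma one_singletonsE:
  assumes "u \<in> one (singletons Y)"
  obtains a b where "u = {a, b}" "a < b" "a \<in> Y" "Min u = a"
proof -
  obtain v y where "u = insert y v" "v \<in> singletons Y" "v \<lless> {y}" using assms by (rule oneE)
  then obtain a where a: "u = {a, y}" "a < y" "a \<in> Y" by (auto simp: singletons_def)
  then have "Min u = a" by (simp add: min_def)
  then show thesis using a that by blast
qed

lemma one_singletonsI: "a < b \<Longrightarrow> a \<in> Y \<Longrightarrow> {a, b} \<in> one (singletons Y)"
  using oneI[of "{a}" "singletons Y" b] by (auto simp: singletons_def insert_commute)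

text \<open>
  A slot \<open>(p, d, r)\<close> is a branch of the Erdos-Rado tree at which some later number may still be
  inserted: \<open>d\<close> is the required colouring of the pairs with a minimum in \<open>p\<close>, and \<open>r\<close> bounds the
  rank of \<open>p\<close> with respect to \<open>A\<close>.
\<close>

type_synonym slot = "nat set \<times> (nat \<Rightarrow> nat) \<times> cordinal"

definition end_hom :: "(nat set \<Rightarrow> nat) \<Rightarrow> nat set \<Rightarrow> (nat \<Rightarrow> nat) \<Rightarrow> bool" where
  "end_hom c p d \<longleftrightarrow> (\<forall>x\<in>p. \<forall>y\<in>p. x < y \<longrightarrow> c {x, y} = d x)"

text \<open>A later number \<open>y\<close> with \<open>c {a, y} = g a\<close> for all
  \<open>a\<close> in the branch completes it to the set \<open>p \<union> {x, y}\<close> that is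
  sought.\<close>

definition complete_branch ::
  "nat set set \<Rightarrow> nat set \<Rightarrow> (nat set \<Rightarrow> nat) \<Rightarrow> (nat \<Rightarrow> nat) \<Rightarrow> bool" where
  "complete_branch A s c g \<longleftrightarrow> (\<exists>p x d. p \<in> A \<and> p \<lless> {x} \<and> insert x p \<subseteq> s \<and>
    end_hom c (insert x p) d \<and> (\<forall>a\<in>insert x p. g a = d a))"

lemma complete_branchI:
  assumes "p \<in> A" "p \<lless> {x}" "insert x p \<subseteq> s" "end_hom c (insert x p) d" "\<forall>a\<in>insert x p. g a = d a"
  shows "complete_branch A s c g"
  unfolding complete_branch_def by (intro exI conjI) (rule assms)+

lemma complete_branchE:
  assumes "complete_branch A s c g"
  obtains p x d where "p \<in> A" "p \<lless> {x}" "insert x p \<subseteq> s" "end_hom c (insert x p) d"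
    "\<forall>a\<in>insert x p. g a = d a"
  using assms unfolding complete_branch_def by (elim exE conjE) rule

text \<open>Here \<open>g\<close> stands for the row of colours of the pairs that a later number
  forms with the elements of \<open>s\<close>; ranging over all rows prepares for every continuation
  of the colouring.\<close>

definition slots_inv ::
  "nat set \<Rightarrow> nat set set \<Rightarrow> (nat \<Rightarrow> nat) \<Rightarrow> nat set \<Rightarrow> (nat set \<Rightarrow> nat) \<Rightarrow> slot multiset \<Rightarrow> bool" where
  "slots_inv Y A k s c M \<longleftrightarrow>
    (\<forall>(p, d, r)\<in>#M. p \<subseteq> s \<and> barred Y A p r \<and> end_hom c p d) \<and>
    (\<forall>g. (\<forall>x\<in>s. g x < k x) \<longrightarrow>
      (\<exists>(p, d, r)\<in>#M. \<forall>x\<in>p. g x = d x) \<or> complete_branch A s c g)"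

abbreviation slots_rank :: "slot multiset \<Rightarrow> cordinal" where
  "slots_rank M \<equiv> omega_sum (image_mset (\<lambda>(p, d, r). r) M)"

lemma end_hom_insert:
  assumes "end_hom c p d" "p \<lless> {y}" "\<forall>x\<in>p. c {x, y} = d x"
  shows "end_hom c (insert y p) (d(y := j))"
  unfolding end_hom_def
proof (intro ballI impI)
  fix a b assume ab: "a \<in> insert y p" "b \<in> insert y p" "a < b"
  have "b \<le> y" using ab(2) assms(2) by (auto intro: less_imp_le)
  then have a: "a \<in> p" "a \<noteq> y" using ab by auto
  have "c {a, b} = d a"
    using a ab assms by (cases "b = y") (auto simp: end_hom_def)
  then show "c {a, b} = (d(y := j)) a" using a by simp
qed

text \<open>The row of \<open>y\<close> selects its place. A complete branch yields the set sought.
  A slot with its branch in \<open>A\<close> is dropped, as \<open>y\<close> completes that branch.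
  Any other slot is replaced by one slot for each admissible colour at \<open>y\<close>, all of
  smaller rank.\<close>

lemma slots_step:
  assumes inv: "slots_inv Y A k s c M" and y: "y \<in> Y" "s \<lless> {y}" and s: "s \<subseteq> Y"
    and c: "coloring (one (singletons Y)) k (insert y s) c"
  shows "(\<exists>t\<in>one (singletons Y) \<oplus> A. t \<subseteq> insert y s \<and> min_hom (one (singletons Y)) c t) \<or>
    (\<exists>M'. slots_inv Y A k (insert y s) c M' \<and> slots_rank M' < slots_rank M)"
proof -
  define g where "g x = c {x, y}" for x
  have "g x < k x" if "x \<in> s" for x
  proof -
    have "x < y" using that y by auto
    then have "{x, y} \<in> one (singletons Y)" "Min {x, y} = x"
      using that s by (auto intro: one_singletonsI simp: min_def)
    then show ?thesis using c that by (auto simp: coloring_def g_def)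
  qed
  then have "(\<exists>(p, d, r)\<in>#M. \<forall>x\<in>p. g x = d x) \<or> complete_branch A s c g"
    using inv unfolding slots_inv_def by simp
  then consider (closed) p x d where "p \<in> A" "p \<lless> {x}" "insert x p \<subseteq> s" "end_hom c (insert x p) d"
      "\<forall>a\<in>insert x p. g a = d a"
    | (opn) p d r where "(p, d, r) \<in># M" "\<forall>x\<in>p. g x = d x"
    by (auto elim: complete_branchE)
  then show ?thesis
  proof cases
    case closed
    let ?t = "insert y (insert x p)"
    have "x < y" "x \<in> Y" using closed(3) y s by auto
    then have "p \<union> {x, y} \<in> one (singletons Y) \<oplus> A"
      using closed(1,2) by (intro front_sumI one_singletonsI) (auto intro: less_trans)
    moreover have "p \<union> {x, y} = ?t" by auto
    \<comment> \<open>As the largest element, \<open>y\<close> is never the minimum of a pair, so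
      the value 0 is arbitrary.\<close>
    moreover have hom: "end_hom c ?t (d(y := 0))"
      using closed y by (intro end_hom_insert) (auto simp: g_def)
    have "min_hom (one (singletons Y)) c ?t"
      unfolding min_hom_def
    proof (intro ballI impI)
      fix u v assume uv: "u \<in> one (singletons Y)" "v \<in> one (singletons Y)" "u \<subseteq> ?t" "v \<subseteq> ?t" "Min u = Min v"
      have "c w = (d(y := 0)) (Min w)" if "w \<in> one (singletons Y)" "w \<subseteq> ?t" for w
        using that hom by (auto elim!: one_singletonsE simp: end_hom_def)
      then show "c u = c v" using uv by metis
    qed
    ultimately show ?thesis using closed(3) by auto
  next
    case opn
    obtain M0 where M0: "M = add_mset (p, d, r) M0" using opn(1) by (meson multi_member_split)
    have p: "p \<subseteq> s" "barred Y A p r" "end_hom c p d"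
      using inv opn(1) unfolding slots_inv_def by auto
    then have py: "p \<lless> {y}" using y by auto
    have hom: "end_hom c (insert y p) (d(y := j))" for j
      using end_hom_insert[OF p(3) py] opn(2) by (simp add: g_def)
    have old: "\<forall>(p, d, r)\<in>#M0. p \<subseteq> insert y s \<and> barred Y A p r \<and> end_hom c p d"
      using inv unfolding slots_inv_def M0 by auto
    have cover: "(\<exists>(p, d, r)\<in>#M0. \<forall>x\<in>p. g' x = d x) \<or> (\<forall>x\<in>p. g' x = d x) \<or>
      complete_branch A (insert y s) c g'" if g': "\<forall>x\<in>insert y s. g' x < k x" for g'
    proof -
      have "\<forall>x\<in>s. g' x < k x" using g' by blast
      then have "(\<exists>(p, d, r)\<in>#M. \<forall>x\<in>p. g' x = d x) \<or>
        complete_branch A s c g'"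
        using inv unfolding slots_inv_def by simp
      moreover have "complete_branch A (insert y s) c g'" if "complete_branch A s c g'"
        using that
      proof (rule complete_branchE)
        fix p x d assume "p \<in> A" "p \<lless> {x}" "insert x p \<subseteq> s" "end_hom c (insert x p) d"
          "\<forall>a\<in>insert x p. g' a = d a"
        then show ?thesis by (intro complete_branchI[of p A x _ c d]) auto
      qed
      ultimately show ?thesis unfolding M0 by auto
    qed
    show ?thesis
    proof (cases "p \<in> A")
      case True
      have "slots_inv Y A k (insert y s) c M0"
        unfolding slots_inv_def
      proof (intro conjI old allI impI)
        fix g' assume g': "\<forall>x\<in>insert y s. g' x < k x"
        have "complete_branch A (insert y s) c g'" if "\<forall>x\<in>p. g' x = d x"
          using True py p hom[of "g' y"] that
          by (intro complete_branchI[of p A y _ c "d(y := g' y)"]) auto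
        then show "(\<exists>(p, d, r)\<in>#M0. \<forall>x\<in>p. g' x = d x) \<or>
          complete_branch A (insert y s) c g'" using cover[OF g'] by blast
      qed
      moreover have "slots_rank M0 < slots_rank M"
        using omega_sum_replace[of "{#}" r "image_mset (\<lambda>(p, d, r). r) M0"] by (simp add: M0)
      ultimately show ?thesis by blast
    next
      case False
      then obtain r' where r': "r' < r" "barred Y A (insert y p) r'"
        using barred_step[OF p(2) y(1) py] by blast
      define N where "N = image_mset (\<lambda>j. (insert y p, d(y := j), r')) (mset_set {..<k y})"
      have "slots_inv Y A k (insert y s) c (M0 + N)"
        unfolding slots_inv_def
      proof (intro conjI allI impI)
        show "\<forall>(p, d, r)\<in>#M0 + N. p \<subseteq> insert y s \<and> barred Y A p r \<and> end_hom c p d"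
          using old p r' hom by (auto simp: N_def)
        fix g' assume g': "\<forall>x\<in>insert y s. g' x < k x"
        have "\<exists>(p, d, r)\<in>#N. \<forall>x\<in>p. g' x = d x" if "\<forall>x\<in>p. g' x = d x"
          using that g' py by (intro bexI[of _ "(insert y p, d(y := g' y), r')"]) (auto simp: N_def)
        then show "(\<exists>(p, d, r)\<in>#M0 + N. \<forall>x\<in>p. g' x = d x) \<or>
          complete_branch A (insert y s) c g'" using cover[OF g'] by auto
      qed
      moreover have "x < r" if "x \<in># image_mset (\<lambda>(p, d, r). r) N" for x
        using that r' by (auto simp: N_def)
      then have "slots_rank (M0 + N) < slots_rank M"
        using omega_sum_replace[of "image_mset (\<lambda>(p, d, r). r) N" r] by (simp add: M0)
      ultimately show ?thesis by blast
    qed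
  qed
qed

lemma slots_inv_cong:
  assumes "slots_inv Y A k s c M" "\<And>u. u \<subseteq> s \<Longrightarrow> u \<in> one (singletons Y) \<Longrightarrow> c u = c' u" "s \<subseteq> Y"
  shows "slots_inv Y A k s c' M"
proof -
  have "end_hom c p d \<longleftrightarrow> end_hom c' p d" if "p \<subseteq> s" for p d
  proof -
    have "c {x, y} = c' {x, y}" if "x \<in> p" "y \<in> p" "x < y" for x y
      using that \<open>p \<subseteq> s\<close> assms(3) by (intro assms(2) one_singletonsI) auto
    then show ?thesis by (auto simp: end_hom_def)
  qed
  note hom = this
  have "complete_branch A s c' g" if "complete_branch A s c g" for g
    using that
  proof (rule complete_branchE)
    fix p x d assume "p \<in> A" "p \<lless> {x}" "insert x p \<subseteq> s" "end_hom c (insert x p) d"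
      "\<forall>a\<in>insert x p. g a = d a"
    then show ?thesis using hom[of "insert x p" d] by (intro complete_branchI[of p A x _ c' d]) auto
  qed
  moreover have "\<forall>(p, d, r)\<in>#M. p \<subseteq> s \<and> barred Y A p r \<and> end_hom c' p d"
    using assms(1) hom unfolding slots_inv_def by auto
  ultimately show ?thesis using assms(1) unfolding slots_inv_def by blast
qed

text \<open>The hypothesis treats each colouring separately, whereas the bar needs one ordinal for
  all of them. On the finitely many relevant pairs there are only finitely many colourings, so a
  maximum of ranks suffices.\<close>

lemma barred_pre_good_singletons:
  fixes Y A k
  defines "S \<equiv> singletons Y"
  assumes "finite s" "s \<subseteq> Y"
    and "\<And>c. coloring (one S) k s c \<Longrightarrow>
      (\<exists>t\<in>one S \<oplus> A. t \<subseteq> s \<and> min_hom (one S) c t) \<or>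
      (\<exists>M. slots_inv Y A k s c M \<and> slots_rank M \<le> b)"
  shows "barred Y (pre Y (good A S k)) s b"
  using assms(2-)
proof (induction b arbitrary: s rule: less_induct)
  case (less b)
  let ?win = "\<lambda>c s. \<exists>t\<in>one S \<oplus> A. t \<subseteq> s \<and> min_hom (one S) c t"
  have step: "?win c (insert n s) \<or> (\<exists>M. slots_inv Y A k (insert n s) c M \<and> slots_rank M < b)"
    if n: "n \<in> Y" "s \<lless> {n}" and c: "coloring (one S) k (insert n s) c" for n c
  proof -
    have "coloring (one S) k s c" using c by (rule coloring_subset) auto
    from less.prems(3)[OF this] show ?thesis
    proof
      assume "\<exists>M. slots_inv Y A k s c M \<and> slots_rank M \<le> b"
      then show ?thesis
        using slots_step[OF _ n less.prems(2)] c unfolding S_def by (meson less_le_trans)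
    qed (meson order_trans subset_insertI)
  qed
  show ?case
  proof (cases "s \<in> pre Y (good A S k)")
    case True
    then show ?thesis by (rule barred.now)
  next
    case False
    \<comment> \<open>With no rank left to decrease, each further element already forces the
      min-homogeneous set.\<close>
    have b: "0 < b"
    proof (rule ccontr)
      assume "\<not> 0 < b"
      then have "b = 0" using cordinal_neq_zero by blast
      then have "insert n s \<in> good A S k" if "n \<in> Y" "s \<lless> {n}" for n
        using step[OF that] less.prems(1) by (auto simp: good_def)
      then show False using False by (auto simp: pre_def)
    qed
    show ?thesis
    proof (rule barred.later)
      fix n assume n: "n \<in> Y" "s \<lless> {n}"
      let ?s = "insert n s"
      have sub: "?s \<subseteq> Y" "finite ?s" using n less.prems by auto
      define U where "U = {u\<in>one S. u \<subseteq> ?s}"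
      have "finite U" using sub by (auto simp: U_def)
      define V where "V = PiE U (\<lambda>u. {..<k (Min u)})"
      have finV: "finite V" unfolding V_def using \<open>finite U\<close> by (intro finite_PiE) auto
      have V_col: "coloring (one S) k ?s c" if "c \<in> V" for c
        using that unfolding V_def U_def coloring_def by (auto dest: PiE_mem)
      obtain M where M: "\<And>c. c \<in> V \<Longrightarrow> ?win c ?s \<or> (slots_inv Y A k ?s c (M c) \<and> slots_rank (M c) < b)"
        using step[OF n V_col] by metis
      \<comment> \<open>The 0 covers the case in which every colouring already has its
        min-homogeneous set.\<close>
      define b' where "b' = Max (insert 0 ((\<lambda>c. slots_rank (M c)) ` {c\<in>V. \<not> ?win c ?s}))"
      have fin': "finite (insert 0 ((\<lambda>c. slots_rank (M c)) ` {c\<in>V. \<not> ?win c ?s}))" using finV by auto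
      have "b' < b" unfolding b'_def using fin' M b by (subst Max_less_iff) auto
      moreover have "barred Y (pre Y (good A S k)) ?s b'"
      proof (rule less.IH[OF \<open>b' < b\<close> sub(2,1)])
        fix c assume c: "coloring (one S) k ?s c"
        define c1 where "c1 = restrict c U"
        have c1: "c1 \<in> V" using c unfolding c1_def V_def U_def coloring_def by auto
        have eq: "c1 u = c u" if "u \<subseteq> ?s" "u \<in> one S" for u using that by (simp add: c1_def U_def)
        show "?win c ?s \<or> (\<exists>M. slots_inv Y A k ?s c M \<and> slots_rank M \<le> b')"
        proof (cases "?win c1 ?s")
          case True
          then obtain t where t: "t \<in> one S \<oplus> A" "t \<subseteq> ?s" "min_hom (one S) c1 t" by blast
          have "c u = c v" if "u \<in> one S" "v \<in> one S" "u \<subseteq> t" "v \<subseteq> t" "Min u = Min v" for u v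
            using t(2,3) that eq unfolding min_hom_def by (metis order_trans)
          then have "min_hom (one S) c t" unfolding min_hom_def by blast
          then show ?thesis using t by blast
        next
          case False
          then have "slots_inv Y A k ?s c1 (M c1)" using M[OF c1] by blast
          then have "slots_inv Y A k ?s c (M c1)"
            by (rule slots_inv_cong) (use eq sub S_def in auto)
          moreover have "slots_rank (M c1) \<le> b'"
            unfolding b'_def using fin' c1 False by (intro Max_ge) auto
          ultimately show ?thesis by blast
        qed
      qed
      ultimately show "\<exists>b'<b. barred Y (pre Y (good A S k)) ?s b'" by blast
    qed
  qed
qed

text \<open>The process starts with a single slot, the empty branch with the rank of
  \<open>A\<close>.\<close>

lemma minhom_bound_singletons: "minhom_bound Y omega_pow (singletons Y)"
  unfolding minhom_bound_def
proof (intro allI impI)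
  fix A k a assume A: "barred Y A {} a"
  have "slots_inv Y A k {} c {#({}, \<lambda>_. 0, a)#}" for c
    using A by (auto simp: slots_inv_def end_hom_def)
  then show "barred Y (pre Y (good A (singletons Y) k)) {} (omega_pow a)"
    by (intro barred_pre_good_singletons) (auto intro!: exI[of _ "{#({}, \<lambda>_. 0, a)#}"])
qed

subsection \<open>Sums of indecomposable barriers\<close>

text \<open>These are the conditions that \<open>good_compose\<close> puts on \<open>C\<close>; they
  survive shrinking \<open>Y\<close> and, for infinite \<open>Y\<close>, forming sums.\<close>

definition finitary_barrier :: "nat set \<Rightarrow> nat set set \<Rightarrow> bool" where
  "finitary_barrier Y C \<longleftrightarrow> antichain C \<and> dense Y C \<and> (\<forall>v\<in>C. finite v)"

lemma finitary_barrier_subset: "finitary_barrier Y C \<Longrightarrow> Y' \<subseteq> Y \<Longrightarrow> finitary_barrier Y' C"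
  unfolding finitary_barrier_def dense_def by (meson order_trans)

lemma finitary_barrier_empty: "finitary_barrier Y {{}}"
  by (auto simp: finitary_barrier_def antichain_def dense_def)

lemma finitary_barrier_front_sum:
  assumes "infinite Y" "finitary_barrier Y C" "finitary_barrier Y D"
  shows "finitary_barrier Y (C \<oplus> D)"
  using assms antichain_front_sum dense_front_sum unfolding finitary_barrier_def
  by (auto elim!: front_sumE)

lemma foldr_front_sum_bound:
  assumes "infinite Y"
    and "list_all2 (\<lambda>C d. finitary_barrier Y C \<and> minhom_bound Y (veblen d) C) Cs ds"
  shows "finitary_barrier Y (foldr (\<oplus>) Cs {{}}) \<and>
    minhom_bound Y (foldr (\<circ>) (map veblen ds) id) (foldr (\<oplus>) Cs {{}})"
  using assms(2)
proof (induction rule: list_all2_induct)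
  case Nil
  then show ?case by (simp add: finitary_barrier_empty minhom_bound_degenerate)
next
  case (Cons C Cs d ds)
  let ?D = "foldr (\<oplus>) Cs {{}}"
  have C: "finitary_barrier Y C" "minhom_bound Y (veblen d) C" and D: "finitary_barrier Y ?D"
    "minhom_bound Y (foldr (\<circ>) (map veblen ds) id) ?D"
    using Cons.hyps(1) Cons.IH by blast+
  have "minhom_bound Y (veblen d \<circ> foldr (\<circ>) (map veblen ds) id) (C \<oplus> ?D)"
    by (rule minhom_bound_compose) (use C D in \<open>auto simp: finitary_barrier_def\<close>)
  moreover have "finitary_barrier Y (C \<oplus> ?D)"
    using assms(1) C(1) D(1) by (rule finitary_barrier_front_sum)
  moreover have "foldr (\<circ>) (map veblen (d # ds)) id = veblen d \<circ> foldr (\<circ>) (map veblen ds) id"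
    "foldr (\<oplus>) (C # Cs) {{}} = C \<oplus> ?D"
    by simp_all
  ultimately show ?case by metis
qed

text \<open>By \<open>barred_add\<close>, the blocks \<open>Es\<close> use up
  \<open>omega_mult e m\<close> and leave rank \<open>omega_pow e\<close> at each of their members.
  The last block has to absorb this for all members at once; once its first element \<open>n\<close>
  is fixed, only finitely many of them lie below it.\<close>

lemma exists_front_sum_below:
  assumes "infinite Y" "end_closed Q" "barred Y Q {} (omega_mult e m)"
  shows "\<exists>Es. length Es = m \<and> (\<forall>E\<in>set Es. finitary_barrier Y E \<and> barred Y E {} (omega_pow e)) \<and>
    (\<forall>s\<in>foldr (\<oplus>) Es {{}}. s \<in> Q \<and> s \<subseteq> Y)"
  using assms(2,3)
proof (induction m arbitrary: Q)
  case 0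
  then have "{} \<in> Q" using barred_zero assms(1) by auto
  then show ?case by auto
next
  case (Suc m)
  let ?w = "omega_pow e"
  let ?Q1 = "{s. s \<subseteq> Y \<longrightarrow> barred Y Q s ?w}"
  have "barred Y {s. barred Y Q s ?w} {} (omega_mult e m)"
    using Suc.prems(2) by (intro barred_add) simp
  then have "barred Y ?Q1 {} (omega_mult e m)" by (rule barred_mono) auto
  moreover have "end_closed ?Q1"
    using end_closed_barred[OF Suc.prems(1)] by (auto simp: end_closed_def)
  ultimately obtain Es where Es: "length Es = m"
    "\<forall>E\<in>set Es. finitary_barrier Y E \<and> barred Y E {} ?w"
    "\<forall>s\<in>foldr (\<oplus>) Es {{}}. s \<in> ?Q1 \<and> s \<subseteq> Y"
    using Suc.IH by blast
  let ?E = "foldr (\<oplus>) Es {{}}"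
  let ?Q' = "{r. r \<noteq> {} \<and> (\<forall>s\<in>?E. s \<lless> r \<longrightarrow> s \<union> r \<in> Q)}"
  have "end_closed ?Q'"
    unfolding end_closed_def
  proof (intro ballI allI impI, clarify, intro conjI ballI impI)
    fix r n s assume r: "r \<noteq> {}" "\<forall>s\<in>?E. s \<lless> r \<longrightarrow> s \<union> r \<in> Q" "r \<lless> {n}"
      and s: "s \<in> ?E" "s \<lless> insert n r"
    then have "s \<union> r \<in> Q" "s \<union> r \<lless> {n}" by auto
    then show "s \<union> insert n r \<in> Q" using Suc.prems(1) by (auto simp: end_closed_def)
  qed auto
  moreover have "barred Y ?Q' {} ?w"
  proof (rule barred.later)
    fix n assume n: "n \<in> Y"
    define I where "I = {s\<in>?E. s \<subseteq> {..<n}}"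
    have finI: "finite I" by (rule finite_subset[of _ "Pow {..<n}"]) (auto simp: I_def)
    have "\<exists>b<?w. barred Y Q (s \<union> {n}) b" if "s \<in> I" for s
    proof -
      have s: "barred Y Q s ?w" "s \<lless> {n}" using that Es(3) by (auto simp: I_def)
      have "s \<in> Q \<Longrightarrow> insert n s \<in> Q" using s Suc.prems(1) by (auto simp: end_closed_def)
      then have "s \<in> Q \<Longrightarrow> barred Y Q (insert n s) 0" by (rule barred.now)
      then show ?thesis
        using barred_step[OF s(1) n s(2)] omega_pow_bounds(1)[of e] by (metis Un_insert_right sup_bot.right_neutral)
    qed
    then obtain b where b: "\<And>s. s \<in> I \<Longrightarrow> b s < ?w \<and> barred Y Q (s \<union> {n}) (b s)" by metis
    define b' where "b' = Max (insert 0 (b ` I))"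
    have "b' < ?w" unfolding b'_def using finI b omega_pow_bounds(1) by (subst Max_less_iff) auto
    \<comment> \<open>Requiring \<open>n \<in> r\<close> makes the family end closed: whatever is
      added after \<open>r\<close> exceeds \<open>n\<close> and so all of \<open>s\<close>.\<close>
    have "barred Y {r. n \<in> r \<and> s \<union> r \<in> Q} {n} b'" if s: "s \<in> I" for s
    proof -
      have "barred Y {r. s \<union> r \<in> Q} {n} (b s)"
        using b[OF s] s by (intro barred_unshift[of Y]) (auto simp: I_def)
      from barred_restrict[OF this] show ?thesis
      proof (rule barred_mono)
        show "b s \<le> b'" unfolding b'_def using finI s by (intro Max_ge) auto
      qed (auto simp: iseg_def)
    qed
    moreover have "end_closed {r. n \<in> r \<and> s \<union> r \<in> Q}" if s: "s \<in> I" for s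
      unfolding end_closed_def
    proof (clarify, intro conjI)
      fix r x assume r: "n \<in> r" "s \<union> r \<in> Q" "r \<lless> {x}"
      then have "s \<lless> {x}" using s by (force simp: I_def)
      then have "s \<union> r \<lless> {x}" using r(3) by auto
      then show "s \<union> insert x r \<in> Q" using r(2) Suc.prems(1) unfolding end_closed_def by auto
    qed auto
    ultimately have "barred Y (\<Inter>s\<in>I. {r. n \<in> r \<and> s \<union> r \<in> Q}) {n} b'"
      using finI by (intro barred_INT) auto
    from barred_restrict[OF this] have "barred Y ?Q' {n} b'"
    proof (rule barred_mono)
      show "{r \<in> \<Inter>s\<in>I. {r. n \<in> r \<and> s \<union> r \<in> Q}. iseg {n} r \<and> finite (r - {n}) \<and> r - {n} \<subseteq> Y} \<subseteq> ?Q'"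
      proof (intro subsetI CollectI conjI ballI impI)
        fix r assume r: "r \<in> {r \<in> \<Inter>s\<in>I. {r. n \<in> r \<and> s \<union> r \<in> Q}. iseg {n} r \<and> finite (r - {n}) \<and> r - {n} \<subseteq> Y}"
        then have nr: "n \<in> r" by (auto simp: iseg_def)
        then show "r \<noteq> {}" by blast
        fix s assume "s \<in> ?E" "s \<lless> r"
        then have "s \<in> I" using nr by (auto simp: I_def)
        then show "s \<union> r \<in> Q" using r by blast
      qed
    qed auto
    then show "\<exists>b<?w. barred Y ?Q' (insert n {}) b" using \<open>b' < ?w\<close> by blast
  qed
  ultimately obtain E0 where E0: "E0 \<subseteq> ?Q'" "exact_barrier Y E0 ?w"
    using exists_exact_barrier[OF assms(1)] by blast
  then have "finitary_barrier Y E0" "barred Y E0 {} ?w"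
    using barred_dense assms(1) unfolding exact_barrier_def finitary_barrier_def by blast+
  moreover have "s \<in> Q \<and> s \<subseteq> Y" if "s \<in> E0 \<oplus> ?E" for s
    using that E0 Es(3) by (elim front_sumE) (auto simp: exact_barrier_def)
  ultimately show ?case using Es by (intro exI[of _ "E0 # Es"]) auto
qed

subsection \<open>Colourings of an indecomposable barrier\<close>

definition mono_sets :: "nat set set \<Rightarrow> nat \<Rightarrow> nat set set" where
  "mono_sets G k = {s. \<forall>d. (\<forall>x\<in>s. d x < k) \<longrightarrow>
    (\<exists>g\<in>G. \<exists>z (j :: nat). g \<lless> {z} \<and> insert z g \<subseteq> s \<and> (\<forall>x\<in>insert z g. d x = j))}"

lemma mono_setsE:
  assumes "s \<in> mono_sets G k" "\<And>x. x \<in> s \<Longrightarrow> d x < k"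
  obtains g z j where "g \<in> G" "g \<lless> {z}" "insert z g \<subseteq> s" "\<And>x. x \<in> insert z g \<Longrightarrow> d x = j"
proof -
  have "\<exists>g\<in>G. \<exists>z j. g \<lless> {z} \<and> insert z g \<subseteq> s \<and> (\<forall>x\<in>insert z g. d x = j)"
    using assms unfolding mono_sets_def by simp
  then show thesis by (elim bexE exE conjE) (rule that, auto)
qed

text \<open>This is a pigeonhole principle. Pairs get the colour of their larger element, so in a
  min-homogeneous set all elements beyond the first have the same colour. The extra first element in
  \<open>A\<close> raises the rank to \<open>osuc b\<close>.\<close>

lemma barred_mono_sets:
  assumes G: "barred Y G {} b"
  shows "barred Y (pre Y (mono_sets G k)) {} (omega_pow (osuc b))"
proof -
  define A where "A = {insert x p | x p. p \<in> G \<and> {x} \<lless> p}"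
  have "barred Y A {} (osuc b)"
  proof (rule barred.later)
    fix n assume "n \<in> Y"
    have "barred {x\<in>Y. n < x} G {} b" using G by (rule barred_mono) auto
    from barred_restrict_empty[OF this] have "barred {x\<in>Y. n < x} {r. {n} \<union> r \<in> A} {} b"
      by (rule barred_mono) (auto simp: A_def)
    then have "barred Y A ({n} \<union> {}) b" by (rule barred_shift) auto
    then show "\<exists>c<osuc b. barred Y A {n} c" using less_osuc by auto
  qed
  then have "barred Y (pre Y (good A (singletons Y) (\<lambda>_. k))) {} (omega_pow (osuc b))"
    using minhom_bound_singletons by (simp add: minhom_bound_def)
  moreover have "s \<in> mono_sets G k" if s: "s \<in> good A (singletons Y) (\<lambda>_. k)" "s \<subseteq> Y" for s
    unfolding mono_sets_def
  proof (intro CollectI allI impI)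
    fix d :: "nat \<Rightarrow> nat" assume d: "\<forall>x\<in>s. d x < k"
    have Max: "Max {a, b} = b" if "a < b" for a b :: nat using that by (simp add: max_def)
    have "coloring (one (singletons Y)) (\<lambda>_. k) s (\<lambda>u. d (Max u))"
      unfolding coloring_def using d Max by (auto elim!: one_singletonsE)
    then obtain t where t: "t \<in> one (singletons Y) \<oplus> A" "t \<subseteq> s"
      "min_hom (one (singletons Y)) (\<lambda>u. d (Max u)) t"
      using s by (auto simp: good_def)
    obtain p' w where p': "t = p' \<union> w" "p' \<in> A" "w \<in> one (singletons Y)" "p' \<lless> w"
      using t(1) by (rule front_sumE)
    obtain x p where p: "p' = insert x p" "p \<in> G" "{x} \<lless> p" using p'(2) by (auto simp: A_def)
    obtain a b where w: "w = {a, b}" "a < b" using p'(3) by (rule one_singletonsE)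
    have x: "x \<in> Y" "x < a" "a \<in> t" using p' p w t(2) s(2) by auto
    have eq: "d y = d a" if y: "y \<in> t" "x < y" for y
    proof -
      have "{x, y} \<in> one (singletons Y)" "{x, a} \<in> one (singletons Y)" "{x, y} \<subseteq> t" "{x, a} \<subseteq> t"
        "Min {x, y} = Min {x, a}"
        using x y p' p by (auto intro!: one_singletonsI simp: min_def)
      then have "d (Max {x, y}) = d (Max {x, a})" using t(3) unfolding min_hom_def by blast
      then show ?thesis using Max x y by simp
    qed
    have sub: "insert a p \<subseteq> t" using p' p(1) w(1) by auto
    have "\<forall>y\<in>insert a p. x < y" using p(3) x(2) by auto
    then have "\<forall>y\<in>insert a p. d y = d a" using sub eq by blast
    moreover have "insert a p \<subseteq> s" using sub t(2) by (rule order_trans)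
    moreover have "p \<lless> {a}" using p'(4) p(1) w(1) by auto
    ultimately show "\<exists>g\<in>G. \<exists>z j. g \<lless> {z} \<and> insert z g \<subseteq> s \<and> (\<forall>x\<in>insert z g. d x = j)"
      using p(2) by blast
  qed
  then have "{s \<in> pre Y (good A (singletons Y) (\<lambda>_. k)). finite s \<and> s \<subseteq> Y} \<subseteq> pre Y (mono_sets G k)"
    by (auto simp: pre_def)
  ultimately show ?thesis
    using barred_restrict_empty barred_mono by (meson order_refl)
qed

text \<open>This is meant for the section of a barrier at \<open>n\<close>: all sets there stand for
  sets with minimum \<open>n\<close>, so min-homogeneity means constancy.\<close>

definition constant_sets :: "nat set set \<Rightarrow> nat set set \<Rightarrow> nat \<Rightarrow> nat set set" where
  "constant_sets G C k = {s. \<forall>c. (\<forall>u\<in>one C. u \<subseteq> s \<longrightarrow> c u < k) \<longrightarrow>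
    (\<exists>g\<in>G. \<exists>z (j :: nat). g \<lless> {z} \<and> insert z g \<subseteq> s \<and> (\<forall>u\<in>one C. u \<subseteq> insert z g \<longrightarrow> c u = j))}"

lemma constant_setsE:
  assumes "s \<in> constant_sets G C k" "\<And>u. u \<in> one C \<Longrightarrow> u \<subseteq> s \<Longrightarrow> c u < k"
  obtains g z j where "g \<in> G" "g \<lless> {z}" "insert z g \<subseteq> s"
    "\<And>u. u \<in> one C \<Longrightarrow> u \<subseteq> insert z g \<Longrightarrow> c u = j"
proof -
  have "\<exists>g\<in>G. \<exists>z j. g \<lless> {z} \<and> insert z g \<subseteq> s \<and> (\<forall>u\<in>one C. u \<subseteq> insert z g \<longrightarrow> c u = j)"
    using assms unfolding constant_sets_def by simp
  then show thesis by (elim bexE exE conjE) (rule that, auto)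
qed

text \<open>Each set in \<open>one E\<close> takes its colour from its unique initial segment in
  \<open>one C\<close>. The bound for \<open>E\<close> makes this depend on the minimum, and
  \<open>mono_sets\<close> makes it constant. Every set of \<open>one C\<close> inside the result
  arises as such an initial segment.\<close>

lemma good_imp_constant:
  assumes C: "antichain C" and E: "finitary_barrier Y E" "\<And>e. e \<in> E \<Longrightarrow> \<exists>v\<in>C. iseg v e"
    and s: "s \<in> good (pre Y (mono_sets G k)) E (\<lambda>_. k)" "s \<subseteq> Y"
  shows "s \<in> constant_sets G C k"
  unfolding constant_sets_def
proof (intro CollectI allI impI)
  fix c assume c: "\<forall>u\<in>one C. u \<subseteq> s \<longrightarrow> c u < k"
  have fin_s: "finite s" using s by (simp add: good_def)
  have E': "antichain E" "dense Y E" "\<forall>v\<in>E. finite v" using E by (auto simp: finitary_barrier_def)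
  have ex_u: "\<exists>u. u \<in> one C \<and> iseg u w" if w: "w \<in> one E" for w
  proof -
    obtain e y where e: "w = insert y e" "e \<in> E" "e \<lless> {y}" using w by (rule oneE)
    obtain v where v: "v \<in> C" "iseg v e" using E(2) e(2) by blast
    have "iseg e w" using e by (auto simp: iseg_def)
    with v(2) have vw: "iseg v w" by (rule iseg_trans)
    have "v \<noteq> w" using v(2) e by (auto simp: iseg_def)
    moreover have "finite w" using e E' by auto
    ultimately have "insert (Min (w - v)) v \<in> one C" "iseg (insert (Min (w - v)) v) w"
      using iseg_insert_Min[OF vw] oneI[OF v(1)] by blast+
    then show ?thesis by blast
  qed
  have uniq: "u = u'" if "u \<in> one C" "u' \<in> one C" "iseg u w" "iseg u' w" for u u' w
  proof -
    have "u \<subseteq> u' \<or> u' \<subseteq> u" using iseg_linear[OF that(3,4)] by (auto simp: iseg_def)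
    then show ?thesis using antichain_one[OF C] that(1,2) by (auto simp: antichain_def)
  qed
  define U where "U w = (SOME u. u \<in> one C \<and> iseg u w)" for w
  have U: "U w \<in> one C" "iseg (U w) w" if "w \<in> one E" for w
    using someI_ex[OF ex_u[OF that]] by (auto simp: U_def)
  have U_sub: "U w \<subseteq> w" if "w \<in> one E" for w
    using U(2)[OF that] by (simp add: iseg_def)
  have "coloring (one E) (\<lambda>_. k) s (\<lambda>w. c (U w))"
    unfolding coloring_def using U(1) U_sub c by (meson order_trans)
  then obtain t where t: "t \<in> one E \<oplus> pre Y (mono_sets G k)" "t \<subseteq> s" "min_hom (one E) (\<lambda>w. c (U w)) t"
    using s by (auto simp: good_def)
  obtain p w where p: "t = p \<union> w" "p \<in> pre Y (mono_sets G k)" "w \<in> one E" "p \<lless> w"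
    using t(1) by (rule front_sumE)
  have fin_t: "finite t" "t \<subseteq> Y" using fin_s t s(2) finite_subset by auto
  let ?n = "Min w"
  have n: "?n \<in> w" "\<And>x. x \<in> w \<Longrightarrow> ?n \<le> x" using fin_t p one_nonempty by auto
  have pn: "insert ?n p \<in> mono_sets G k" using p n fin_t unfolding pre_def by auto
  have ex_w: "\<exists>w'. w' \<in> one E \<and> w' \<subseteq> t \<and> Min w' = x" if x: "x \<in> insert ?n p" for x
  proof -
    obtain w' where "w' \<in> one E" "w' \<subseteq> p \<union> w" "Min w' = x"
      using one_extend_at[OF E' p(3) _ _ p(4) x] fin_t p(1) by blast
    then show ?thesis using p by blast
  qed
  define W where "W x = (SOME w'. w' \<in> one E \<and> w' \<subseteq> t \<and> Min w' = x)" for x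
  have W: "W x \<in> one E" "W x \<subseteq> t" "Min (W x) = x" if "x \<in> insert ?n p" for x
    using someI_ex[OF ex_w[OF that]] by (auto simp: W_def)
  have "c (U (W x)) < k" if "x \<in> insert ?n p" for x
  proof -
    have "U (W x) \<subseteq> s" using U_sub[OF W(1)[OF that]] W(2)[OF that] t(2) by (meson order_trans)
    then show ?thesis using c U(1)[OF W(1)[OF that]] by blast
  qed
  then obtain g z j where g: "g \<in> G" "g \<lless> {z}" "insert z g \<subseteq> insert ?n p"
    "\<And>x. x \<in> insert z g \<Longrightarrow> c (U (W x)) = j"
    using mono_setsE[OF pn, of "\<lambda>x. c (U (W x))"] by blast
  have "c u = j" if u: "u \<in> one C" "u \<subseteq> insert z g" for u
  proof -
    have up: "u \<subseteq> insert ?n p" using u g by blast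
    \<comment> \<open>Removing the elements of \<open>p\<close> outside \<open>u\<close> makes
      \<open>u\<close> an initial segment, while \<open>w\<close> leaves room for a set of
      \<open>one E\<close>.\<close>
    let ?F = "u \<inter> p \<union> w"
    have F: "?F \<subseteq> t" "finite ?F" using p fin_t by auto
    obtain w1 where w1: "w1 \<in> one E" "iseg w1 ?F"
      using one_extend[OF E' p(3), of "u \<inter> p"] fin_t p by blast
    have uF: "iseg u ?F"
      unfolding iseg_def
    proof (intro conjI ballI)
      show "u \<subseteq> ?F" using up n by auto
      fix x y assume x: "x \<in> u" and y: "y \<in> ?F - u"
      show "x < y"
      proof (cases "x \<in> p")
        case False
        then have "x = ?n" using x up by blast
        then show ?thesis using y x n(2)[of y] by (auto simp: le_less)
      qed (use y p in auto)
    qed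
    have "iseg u w1"
      using iseg_linear[OF uF w1(2)]
    proof
      assume "iseg w1 u"
      then have "iseg (U w1) u" using U(2)[OF w1(1)] iseg_trans by blast
      then have "U w1 = u" using uniq[OF U(1)[OF w1(1)] u(1)] by simp
      then show ?thesis using U(2)[OF w1(1)] by simp
    qed
    then have "U w1 = u" using uniq U w1(1) u(1) by blast
    have ne: "u \<noteq> {}" "w1 \<noteq> {}" using u w1 one_nonempty by auto
    have "Min w1 = Min u"
      using iseg_Min[OF uF ne(1) F(2)] iseg_Min[OF w1(2) ne(2) F(2)] by simp
    moreover have "finite u" using uF F(2) finite_subset unfolding iseg_def by blast
    then have "Min u \<in> u" using ne(1) by (rule Min_in)
    ultimately have m: "Min w1 \<in> insert z g" "Min w1 \<in> insert ?n p" using u up by auto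
    have "w1 \<subseteq> t" using w1 F by (auto simp: iseg_def)
    then have "c (U w1) = c (U (W (Min w1)))"
      using t(3) w1(1) W[OF m(2)] unfolding min_hom_def by metis
    then show ?thesis using g(4)[OF m(1)] \<open>U w1 = u\<close> by simp
  qed
  moreover have "insert z g \<subseteq> s" using g(3) p n t(2) by auto
  ultimately show "\<exists>g\<in>G. \<exists>z j. g \<lless> {z} \<and> insert z g \<subseteq> s \<and> (\<forall>u\<in>one C. u \<subseteq> insert z g \<longrightarrow> c u = j)"
    using g(1,2) by (intro bexI[of _ g] exI[of _ z] exI[of _ j]) simp_all
qed

text \<open>The sets with minimum \<open>n\<close> come from the section of \<open>C\<close> at
  \<open>n\<close> and all get one colour; the others are handled by goodness for the section of
  \<open>A\<close> at \<open>n\<close>.\<close>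

lemma good_section:
  assumes Y: "\<And>x. x \<in> Y \<Longrightarrow> n < x" and C: "{} \<notin> C" "\<forall>v\<in>C. finite v"
    and s: "s \<in> constant_sets (pre Y (good {r. insert n r \<in> A} C k)) {r. insert n r \<in> C \<and> {n} \<lless> r} (k n)"
      "s \<subseteq> Y" "finite s"
  shows "insert n s \<in> good A C k"
proof -
  let ?A = "{r. insert n r \<in> A}" and ?C = "{r. insert n r \<in> C \<and> {n} \<lless> r}"
  have "\<exists>t\<in>one C \<oplus> A. t \<subseteq> insert n s \<and> min_hom (one C) c t"
    if c: "coloring (one C) k (insert n s) c" for c
  proof -
    have "c (insert n u) < k n" if u: "u \<in> one ?C" "u \<subseteq> s" for u
    proof -
      obtain v y where v: "u = insert y v" "insert n v \<in> C" "{n} \<lless> v" "v \<lless> {y}"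
        using u(1) by (auto elim: oneE)
      then have "n < y" using u s Y by auto
      then have "insert y (insert n v) \<in> one C" using v by (intro oneI) auto
      then have "insert n u \<in> one C" using v by (simp add: insert_commute)
      moreover have "Min (insert n u) = n"
        using u s Y finite_subset by (intro Min_eqI) (auto intro: less_imp_le)
      ultimately show ?thesis using c u by (auto simp: coloring_def)
    qed
    then obtain g z j where g: "g \<in> pre Y (good ?A C k)" "g \<lless> {z}" "insert z g \<subseteq> s"
      "\<And>u. u \<in> one ?C \<Longrightarrow> u \<subseteq> insert z g \<Longrightarrow> c (insert n u) = j"
      using constant_setsE[OF s(1), of "\<lambda>u. c (insert n u)"] by blast
    have "insert z g \<in> good ?A C k" using g s(2) by (auto simp: pre_def)
    moreover have "coloring (one C) k (insert z g) c" using c g(3) by (auto intro: coloring_subset)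
    ultimately obtain t where t: "t \<in> one C \<oplus> ?A" "t \<subseteq> insert z g" "min_hom (one C) c t"
      by (auto simp: good_def)
    obtain p w where p: "t = p \<union> w" "insert n p \<in> A" "w \<in> one C" "p \<lless> w"
      using t(1) by (auto elim: front_sumE)
    have tY: "\<And>x. x \<in> t \<Longrightarrow> n < x" using t g s Y by blast
    have fin_t: "finite t" by (rule finite_subset[OF order_trans[OF t(2) g(3)] s(3)])
    have "insert n p \<union> w \<in> one C \<oplus> A" using p tY by (intro front_sumI) auto
    then have "insert n t \<in> one C \<oplus> A" using p by simp
    moreover have "min_hom (one C) c (insert n t)"
      unfolding min_hom_def
    proof (intro ballI impI)
      fix u v assume uv: "u \<in> one C" "v \<in> one C" "u \<subseteq> insert n t" "v \<subseteq> insert n t" "Min u = Min v"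
      have fin: "finite u" "finite v"
        using finite_subset[OF uv(3)] finite_subset[OF uv(4)] fin_t by simp_all
      have ne: "u \<noteq> {}" "v \<noteq> {}" using uv one_nonempty by auto
      \<comment> \<open>As \<open>C\<close> has no empty member, \<open>n\<close> belongs to the
        \<open>C\<close>-part of \<open>x\<close>, so \<open>x\<close> comes from the
        section.\<close>
      have cn: "c x = j" if x: "x \<in> one C" "x \<subseteq> insert n t" "n \<in> x" for x
      proof -
        obtain q y where q: "x = insert y q" "q \<in> C" "q \<lless> {y}" using x(1) by (rule oneE)
        have "q \<noteq> {}" using q C by auto
        then have "n \<in> q" using x q tY by (metis ex_in_conv insert_iff insert_subset less_asym singletonI subsetD)
        then have q': "insert n (q - {n}) = q" by blast
        have "q - {n} \<in> ?C" using q' q x tY by auto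
        moreover have "y \<noteq> n" using \<open>n \<in> q\<close> q by auto
        then have *: "insert y (q - {n}) = x - {n}" using q by auto
        ultimately have "x - {n} \<in> one ?C" using oneI[of "q - {n}" ?C y] q by auto
        then have "c (insert n (x - {n})) = j" using x t(2) by (intro g) auto
        then show ?thesis using x(3) by (simp add: insert_absorb)
      qed
      have min: "n \<in> x \<longleftrightarrow> Min x = n" if "x \<subseteq> insert n t" "finite x" "x \<noteq> {}" for x
      proof
        assume "n \<in> x"
        then show "Min x = n" using that tY by (intro Min_eqI) (auto intro: less_imp_le)
      qed (use that Min_in in blast)
      show "c u = c v"
      proof (cases "Min u = n")
        case True
        then show ?thesis using cn uv min fin ne by metis
      next
        case False
        then have "u \<subseteq> t" "v \<subseteq> t" using uv min[of u] min[of v] fin ne by auto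
        then show ?thesis using t(3) uv unfolding min_hom_def by blast
      qed
    qed
    ultimately show ?thesis using t(2) g(3) by blast
  qed
  then show ?thesis using s(3) by (auto simp: good_def)
qed

section \<open>The bound for rank a power of \<omega>\<close>

lemma antichain_empty: "antichain C \<Longrightarrow> {} \<in> C \<Longrightarrow> C = {{}}"
  by (auto simp: antichain_def)

lemma foldr_veblen_closed:
  assumes "e < d" "b < veblen d a"
  shows "foldr (\<circ>) (map veblen (replicate m e)) id b < veblen d a"
  by (induction m) (use assms veblen_closed in auto)

text \<open>A single set of \<open>one C\<close> suffices here, and by the antichain property it
  contains no other.\<close>

lemma barred_pre_good_base:
  assumes "antichain C" "\<forall>v\<in>C. finite v" "barred Y C {} b" "{} \<in> A"
  shows "barred Y (pre Y (good A C k)) {} b"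
  using assms(3)
proof (rule barred_mono)
  have "insert y v \<in> good A C k" if "v \<in> C" "v \<lless> {y}" for v y
  proof -
    have one: "insert y v \<in> one C" using that by (rule oneI)
    have "{} \<union> insert y v \<in> one C \<oplus> A" using one assms(4) by (intro front_sumI) auto
    moreover have "min_hom (one C) c (insert y v)" for c
      using antichain_one[OF assms(1)] one unfolding min_hom_def antichain_def by metis
    ultimately show ?thesis using that assms(2) by (auto simp: good_def)
  qed
  then show "C \<subseteq> pre Y (good A C k)" by (auto simp: pre_def)
qed auto

lemma minhom_bound_power:
  assumes "infinite Y" "finitary_barrier Y C" "barred Y C {} (omega_pow d)"
  shows "minhom_bound Y (veblen d) C"
  using assms
proof (induction d arbitrary: Y C rule: less_induct)
  case (less d)
  note outer_IH = less.IH
  have C: "antichain C" "\<forall>v\<in>C. finite v" using less.prems(2) by (auto simp: finitary_barrier_def)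
  show ?case
  proof (cases "{} \<in> C")
    case True
    then have "C = {{}}" using C antichain_empty by blast
    then show ?thesis using minhom_bound_degenerate strict_mono_cordinal_ge[OF strict_mono_veblen] by blast
  next
    case ne: False
    show ?thesis
    proof (cases "d = 0")
      case True
      \<comment> \<open>A bar of rank 1 without the empty set contains every
        \<open>{n}\<close>.\<close>
      have "{n} \<in> C" if "n \<in> Y" for n
        using barred_step[OF less.prems(3) that] ne True less.prems(1) barred_zero[of Y C "{n}"]
        by (auto simp: omega_pow_0 less_osuc_iff)
      then have "C \<inter> Pow Y = singletons Y"
        using C(1) ne by (auto simp: singletons_def antichain_def)
          (metis all_not_in_conv empty_subsetI insert_subset subsetD)
      then show ?thesis
        using minhom_bound_singletons[of Y] minhom_bound_restrict[of Y _ C] True by (simp add: veblen_0)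
    next
      case False
      then have d: "0 < d" by (simp add: cordinal_neq_zero)
      \<comment> \<open>The set \<open>Y\<close> is generalised because sections live on the numbers
        above the first element.\<close>
      have "barred Y (pre Y (good A C k)) {} (veblen d a)"
        if "infinite Y" "finitary_barrier Y C" "barred Y C {} (omega_pow d)" "barred Y A {} a" for Y A a k
        using that
      proof (induction a arbitrary: Y A rule: less_induct)
        case (less a)
        note prems = less.prems
        show ?case
        proof (cases "{} \<in> A")
          case True
          then show ?thesis
            by (intro barred_le[OF barred_pre_good_base[OF C prems(3)] omega_pow_le_veblen])
        next
          case nA: False
          show ?thesis
          proof (rule barred.later)
            fix n assume n: "n \<in> Y"
            let ?Y = "{x\<in>Y. n < x}" and ?A = "{r. insert n r \<in> A}"
              and ?C = "{r. insert n r \<in> C \<and> {n} \<lless> r}"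
            have inf: "infinite ?Y" using prems(1) by (rule infinite_above)
            obtain a' where a': "a' < a" "barred Y A {n} a'"
              using barred_step[OF prems(4) n] nA by auto
            have "barred ?Y {r. {n} \<union> r \<in> A} {} a'"
              using a'(2) by (intro barred_unshift[of Y]) auto
            then have An: "barred ?Y ?A {} a'" by simp
            have G: "barred ?Y (pre ?Y (good ?A C k)) {} (veblen d a')"
            proof (rule less.IH[OF a'(1) inf _ _ An])
              show "finitary_barrier ?Y C" using prems(2) by (rule finitary_barrier_subset) auto
              show "barred ?Y C {} (omega_pow d)" using prems(3) by (rule barred_mono) auto
            qed
            obtain c where c: "c < omega_pow d" "barred Y C {n} c"
              using barred_step[OF prems(3) n] ne by auto
            have "barred ?Y {r. {n} \<union> r \<in> C} {} c"
              using c(2) by (intro barred_unshift[of Y]) auto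
            from barred_restrict_empty[OF this] have Cn: "barred ?Y ?C {} c"
              by (rule barred_mono) auto
            have "\<exists>e<d. \<exists>m. c \<le> omega_mult e m"
            proof (cases "c = 0")
              case True
              then show ?thesis using d cordinal_zero_le by blast
            next
              case False
              then have "0 < c" by (simp add: cordinal_neq_zero)
              with c(1) show ?thesis by (rule less_omega_powE) (blast intro: less_imp_le)
            qed
            then obtain e m where e: "e < d" "c \<le> omega_mult e m" by blast
            have "barred ?Y {s. \<exists>v\<in>?C. iseg v s} {} (omega_mult e m)"
              by (rule barred_mono[OF Cn _ _ e(2)]) (use iseg_refl in blast)+
            then obtain Es where Es: "length Es = m"
              "\<forall>E\<in>set Es. finitary_barrier ?Y E \<and> barred ?Y E {} (omega_pow e)"
              "\<forall>s\<in>foldr (\<oplus>) Es {{}}. s \<in> {s. \<exists>v\<in>?C. iseg v s} \<and> s \<subseteq> ?Y"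
              using exists_front_sum_below[OF inf end_closed_up] by blast
            let ?E = "foldr (\<oplus>) Es {{}}" and ?f = "foldr (\<circ>) (map veblen (replicate m e)) id"
            have "list_all2 (\<lambda>C d. finitary_barrier ?Y C \<and> minhom_bound ?Y (veblen d) C) Es (replicate m e)"
              unfolding list_all2_conv_all_nth using Es(1,2) outer_IH[OF e(1) inf] by simp
            then have E: "finitary_barrier ?Y ?E" "minhom_bound ?Y ?f ?E"
              using foldr_front_sum_bound[OF inf] by blast+
            let ?G = "pre ?Y (good ?A C k)"
            \<comment> \<open>Read from inside: the rank for the section of \<open>A\<close>, the
              pigeonhole principle for \<open>k n\<close> colours, and the blocks of
              \<open>?E\<close>.\<close>
            define b where "b = ?f (omega_pow (osuc (veblen d a')))"
            have "barred ?Y (pre ?Y (good (pre ?Y (mono_sets ?G (k n))) ?E (\<lambda>_. k n))) {} b"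
              using E(2) barred_mono_sets[OF G] unfolding minhom_bound_def b_def by blast
            from barred_restrict_empty[OF this]
            have "barred ?Y {r. {n} \<union> r \<in> pre Y (good A C k)} {} b"
            proof (rule barred_mono)
              show "{s \<in> pre ?Y (good (pre ?Y (mono_sets ?G (k n))) ?E (\<lambda>_. k n)). finite s \<and> s \<subseteq> ?Y}
                \<subseteq> {r. {n} \<union> r \<in> pre Y (good A C k)}"
              proof (intro subsetI CollectI)
                fix r
                assume r: "r \<in> {s \<in> pre ?Y (good (pre ?Y (mono_sets ?G (k n))) ?E (\<lambda>_. k n)). finite s \<and> s \<subseteq> ?Y}"
                have "insert y ({n} \<union> r) \<in> good A C k" if y: "y \<in> Y" "{n} \<union> r \<lless> {y}" for y
                proof -
                  have "y \<in> ?Y" "r \<lless> {y}" using y by auto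
                  then have s: "insert y r \<in> good (pre ?Y (mono_sets ?G (k n))) ?E (\<lambda>_. k n)" "insert y r \<subseteq> ?Y"
                    using r by (auto simp: pre_def)
                  have "antichain ?C"
                    using C(1) unfolding antichain_def by (auto simp: insert_ident) (metis insert_ident insert_mono less_irrefl)
                  then have "insert y r \<in> constant_sets ?G ?C (k n)"
                    using E(1) Es(3) s by (intro good_imp_constant) auto
                  then have "insert n (insert y r) \<in> good A C k"
                    using ne C(2) s(2) r by (intro good_section[of ?Y]) auto
                  then show ?thesis by (simp add: insert_commute)
                qed
                then show "{n} \<union> r \<in> pre Y (good A C k)" by (simp add: pre_def)
              qed
            qed auto
            then have "barred Y (pre Y (good A C k)) ({n} \<union> {}) b" by (rule barred_shift) auto
            moreover have "b < veblen d a"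
            proof -
              have "veblen d a' < veblen d a"
                using a'(1) strict_mono_veblen by (simp add: strict_mono_less)
              then have "osuc (veblen d a') < veblen d a" by (rule osuc_less_veblen[OF d])
              then have "omega_pow (osuc (veblen d a')) < veblen d a"
                using veblen_closed[OF d] by (simp add: veblen_0)
              then show ?thesis unfolding b_def by (rule foldr_veblen_closed[OF e(1)])
            qed
            ultimately show "\<exists>b<veblen d a. barred Y (pre Y (good A C k)) (insert n {}) b" by auto
          qed
        qed
      qed
      then show ?thesis using less.prems by (simp add: minhom_bound_def)
    qed
  qed
qed

section \<open>Decomposable barriers\<close>

lemma infinite_base: "front B \<Longrightarrow> infinite (base B)"
  by (cases "B = {{}}") (simp add: base_def, simp add: front_def)

lemma antichain_barrier: "barrier B \<Longrightarrow> antichain B"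
  by (auto simp: barrier_def antichain_def)

lemma finite_front: "front B \<Longrightarrow> s \<in> B \<Longrightarrow> finite s"
  by (auto simp: front_def)

text \<open>Positivity excludes \<open>{{}}\<close>, whose \<open>base\<close> is the set of all
  numbers. Density at \<open>{n}\<close> shows that each \<open>n\<close> of \<open>X\<close> occurs
  in some member.\<close>

lemma exact_barrier_imp_barrier:
  assumes X: "infinite X" and B: "exact_barrier X B a" and a: "0 < a"
  shows "barrier B" and "base B = X" and "ht B = a"
proof -
  note B' = B[unfolded exact_barrier_def]
  have ne: "{} \<notin> B"
  proof
    assume "{} \<in> B"
    then have "barred X B {} 0" by (rule barred.now)
    then have "a \<le> 0" using B' by blast
    then show False using a by simp
  qed
  have "X \<subseteq> \<Union>B"
  proof
    fix n assume n: "n \<in> X"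
    have "dense X B" using B' X barred_dense by blast
    then obtain e where e: "e \<in> B" "iseg e {n} \<or> iseg {n} e"
      using n unfolding dense_def by (metis empty_subsetI finite.simps insert_subset)
    have "e \<noteq> {}" using e(1) ne by blast
    then have "n \<in> e" using e(2) unfolding iseg_def by blast
    then show "n \<in> \<Union>B" using e by blast
  qed
  moreover have "\<Union>B \<subseteq> X" using B' by blast
  ultimately show base: "base B = X" using ne by (auto simp: base_def)
  have anti: "s = t" if "s \<in> B" "t \<in> B" "s \<subseteq> t" for s t
    using B' that unfolding antichain_def by blast
  have "\<exists>s\<in>B. s \<sqsubset> Z" if Z: "infinite Z" "Z \<subseteq> X" for Z
  proof -
    have "{} \<sqsubset> Z" using Z by (auto simp: init_seg_def)
    moreover have "barred X B {} a" using B' by blast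
    ultimately show ?thesis using Z barred_front by blast
  qed
  then have "front B"
    using B' X anti unfolding front_def base by (auto simp: init_seg_def)
  then show "barrier B" using anti by (auto simp: barrier_def)
  have "ht B \<le> a" using barred_iff_ht[OF \<open>front B\<close>] B' base by simp
  moreover have "a \<le> ht B" using barred_iff_ht[OF \<open>front B\<close>, of "ht B"] B' base by simp
  ultimately show "ht B = a" by simp
qed

lemma final_segment_trans: "final_segment Z Y \<Longrightarrow> final_segment Y X \<Longrightarrow> final_segment Z X"
proof -
  assume "final_segment Z Y" "final_segment Y X"
  then obtain m k where "Z = {n\<in>Y. m \<le> n}" "Y = {n\<in>X. k \<le> n}" by (auto simp: final_segment_def)
  then have "Z = {n\<in>X. max m k \<le> n}" by auto
  then show ?thesis unfolding final_segment_def by blast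
qed

lemma final_segmentD: "final_segment Y X \<Longrightarrow> y \<in> Y \<Longrightarrow> x \<in> X \<Longrightarrow> y \<le> x \<Longrightarrow> x \<in> Y"
  by (auto simp: final_segment_def)

lemma final_segment_subset: "final_segment Y X \<Longrightarrow> Y \<subseteq> X"
  by (auto simp: final_segment_def)

text \<open>An element of the \<open>B0\<close>-part lies beyond an element of the nonempty part
  from the later summands, hence in their bases, which are final segments.\<close>

lemma Union_foldr_front_sum:
  assumes "sorted_wrt (\<lambda>B B'. final_segment (base B') (base B)) Bs"
    and "\<And>B. B \<in> set Bs \<Longrightarrow> {} \<notin> B"
  shows "(Bs \<noteq> [] \<longrightarrow> {} \<notin> foldr (\<oplus>) Bs {{}}) \<and> (\<forall>B\<in>set Bs. \<Union>(foldr (\<oplus>) Bs {{}}) \<subseteq> base B)"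
  using assms
proof (induction Bs)
  case (Cons B0 Bs)
  let ?R = "foldr (\<oplus>) Bs {{}}"
  have fs: "final_segment (base B) (base B0)" if "B \<in> set Bs" for B using Cons.prems(1) that by simp
  have IH: "Bs \<noteq> [] \<Longrightarrow> {} \<notin> ?R" "\<And>B. B \<in> set Bs \<Longrightarrow> \<Union>?R \<subseteq> base B"
    using Cons by auto
  have B0: "{} \<notin> B0" "\<Union>B0 \<subseteq> base B0" using Cons.prems(2) by (auto simp: base_def)
  have "x \<in> base B" if u: "u \<in> B0 \<oplus> ?R" "x \<in> u" and B: "B \<in> set (B0 # Bs)" for u x B
  proof -
    obtain s t where st: "u = s \<union> t" "s \<in> ?R" "t \<in> B0" "s \<lless> t" using u(1) by (rule front_sumE)
    show ?thesis
    proof (cases "Bs = []")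
      case True
      then show ?thesis using st u B B0 by auto
    next
      case False
      then obtain B1 where B1: "B1 \<in> set Bs" by (meson list.set_sel(1))
      show ?thesis
      proof (cases "x \<in> s")
        case True
        then have *: "\<And>B. B \<in> set Bs \<Longrightarrow> x \<in> base B" using IH(2) st(2) by blast
        then have "x \<in> base B0" using B1 final_segment_subset[OF fs[OF B1]] by blast
        then show ?thesis using * B by auto
      next
        case False
        then have xt: "x \<in> t" "x \<in> base B0" using u(2) st B0(2) by auto
        obtain y where y: "y \<in> s" using IH(1)[OF \<open>Bs \<noteq> []\<close>] st(2) by (metis ex_in_conv)
        then have "y \<le> x" using st(4) xt by (auto intro: less_imp_le)
        have "x \<in> base B" if B: "B \<in> set Bs" for B
        proof -
          have "y \<in> base B" using IH(2)[OF B] st(2) y by blast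
          then show ?thesis using final_segmentD[OF fs[OF B]] xt(2) \<open>y \<le> x\<close> by blast
        qed
        then show ?thesis using B xt by auto
      qed
    qed
  qed
  moreover have "{} \<notin> B0 \<oplus> ?R" using B0(1) by (auto elim!: front_sumE)
  ultimately show ?case by auto
qed simp

text \<open>Uniqueness of Cantor normal forms identifies the exponents of the decomposition with
  \<open>cnf (ht C)\<close>, and \<open>X\<close> lies in the bases of all summands.\<close>

lemma decomposable_minhom_bound:
  assumes C: "SD_barrier C" and X: "infinite X" "X \<subseteq> base C"
  shows "minhom_bound X (veblen_log (ht C)) C"
proof -
  obtain bs Bs where cnf: "is_cnf bs (ht C)" and len: "length Bs = length bs"
    and Bs: "\<forall>i<length bs. barrier (Bs ! i) \<and> smooth (Bs ! i) \<and> ht (Bs ! i) = omega_pow (bs ! i)"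
    and fs: "\<forall>i. Suc i < length bs \<longrightarrow> final_segment (base (Bs ! Suc i)) (base (Bs ! i))"
    and fold: "C = foldr (\<oplus>) Bs {{}}"
    using C unfolding SD_barrier_def decomposable_def by blast
  have log: "veblen_log (ht C) = foldr (\<circ>) (map veblen bs) id"
    by (simp add: veblen_log_def cnf_eq[OF cnf])
  have "transp (\<lambda>B B'. final_segment (base B') (base B))"
    using final_segment_trans by (auto intro!: transpI)
  then have "sorted_wrt (\<lambda>B B'. final_segment (base B') (base B)) Bs"
    using fs len by (simp add: sorted_wrt_iff_nth_Suc_transp)
  moreover have "{} \<notin> B" if B: "B \<in> set Bs" for B
  proof
    assume "{} \<in> B"
    obtain i where i: "i < length bs" "B = Bs ! i" using B len by (metis in_set_conv_nth)
    then have fB: "front B" "ht B = omega_pow (bs ! i)" using Bs by (auto simp: barrier_def)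
    have "barred (base B) B {} 0" using \<open>{} \<in> B\<close> by (rule barred.now)
    then have "omega_pow (bs ! i) \<le> 0" using barred_iff_ht[OF fB(1)] fB(2) by metis
    then show False using omega_pow_bounds(1)[of "bs ! i"] by simp
  qed
  ultimately have U: "Bs \<noteq> [] \<Longrightarrow> {} \<notin> C" "\<And>B. B \<in> set Bs \<Longrightarrow> \<Union>C \<subseteq> base B"
    using Union_foldr_front_sum[of Bs] fold by auto
  have "X \<subseteq> base B" if "B \<in> set Bs" for B
  proof -
    have "Bs \<noteq> []" using that by auto
    then have "C \<noteq> {{}}" using U(1) by blast
    then have "X \<subseteq> \<Union>C" using X(2) by (simp add: base_def)
    then show ?thesis using U(2)[OF that] by simp
  qed
  then have sub: "X \<subseteq> base (Bs ! i)" if "i < length bs" for i using that len by simp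
  have "finitary_barrier X (Bs ! i) \<and> minhom_bound X (veblen (bs ! i)) (Bs ! i)" if i: "i < length bs" for i
  proof -
    have b: "barrier (Bs ! i)" "front (Bs ! i)" "ht (Bs ! i) = omega_pow (bs ! i)"
      using Bs i by (auto simp: barrier_def)
    have "barred (base (Bs ! i)) (Bs ! i) {} (omega_pow (bs ! i))"
      using barred_iff_ht[OF b(2)] b(3) by simp
    then have bar: "barred X (Bs ! i) {} (omega_pow (bs ! i))"
      by (rule barred_mono) (use sub[OF i] in auto)
    then have "finitary_barrier X (Bs ! i)"
      unfolding finitary_barrier_def
      using antichain_barrier[OF b(1)] barred_dense[OF bar X(1)] finite_front[OF b(2)] by blast
    then show ?thesis using minhom_bound_power[OF X(1) _ bar] by blast
  qed
  then have "list_all2 (\<lambda>C d. finitary_barrier X C \<and> minhom_bound X (veblen d) C) Bs bs"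
    unfolding list_all2_conv_all_nth using len by simp
  then show ?thesis using foldr_front_sum_bound[OF X(1)] fold log by simp
qed

text \<open>Outside the degenerate case the bound is a power of \<omega>, so a smooth barrier of
  exactly that height is decomposable with itself as the only summand.\<close>

lemma veblen_log_cases:
  assumes "SD_barrier C"
  obtains "C = {{}}" "veblen_log (ht C) = id"
    | "\<And>a. \<exists>b. veblen_log (ht C) a = omega_pow b"
proof -
  obtain bs Bs where cnf: "is_cnf bs (ht C)" "length Bs = length bs" "C = foldr (\<oplus>) Bs {{}}"
    using assms unfolding SD_barrier_def decomposable_def by blast
  then have log: "veblen_log (ht C) = foldr (\<circ>) (map veblen bs) id"
    by (simp add: veblen_log_def cnf_eq)
  show thesis
  proof (cases bs)
    case Nil
    then show thesis using cnf log that(1) by simp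
  next
    case (Cons b bs')
    then show thesis using log veblen_is_omega_pow that(2) by simp
  qed
qed

lemma singletons_base_front_sum:
  assumes "u \<subseteq> Y"
  shows "u \<in> singletons Y \<oplus> C \<longleftrightarrow> u \<in> one C"
proof
  assume "u \<in> singletons Y \<oplus> C"
  then show "u \<in> one C"
    by (rule front_sumE) (auto simp: singletons_def intro!: oneI)
next
  assume "u \<in> one C"
  then obtain v y where "u = insert y v" "v \<in> C" "v \<lless> {y}" by (rule oneE)
  then show "u \<in> singletons Y \<oplus> C"
    using assms front_sumI[of v C "{y}" "singletons Y"] by (simp add: singletons_def)
qed

lemma good_conclusion:
  assumes s: "s \<in> good A C (\<lambda>_. k)" "s \<subseteq> base C"
    and c: "c \<in> size_subsets s (singletons (base C) \<oplus> C) \<rightarrow> {..<k}"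
  shows "\<exists>t \<in> singletons (base C) \<oplus> C \<oplus> A. t \<subseteq> s \<and>
    (\<forall>u \<in> size_subsets t (singletons (base C) \<oplus> C).
     \<forall>v \<in> size_subsets t (singletons (base C) \<oplus> C). Min u = Min v \<longrightarrow> c u = c v)"
proof -
  have one: "u \<in> singletons (base C) \<oplus> C \<longleftrightarrow> u \<in> one C" if "u \<subseteq> s" for u
    using singletons_base_front_sum[of u "base C"] that s(2) by blast
  have "coloring (one C) (\<lambda>_. k) s c"
    unfolding coloring_def using c one by (auto simp: size_subsets_def)
  then obtain t where t: "t \<in> one C \<oplus> A" "t \<subseteq> s" "min_hom (one C) c t"
    using s(1) by (auto simp: good_def)
  obtain p w where "t = p \<union> w" "p \<in> A" "w \<in> one C" "p \<lless> w" using t(1) by (rule front_sumE)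
  then have "t \<in> singletons (base C) \<oplus> C \<oplus> A"
    using t(2) one[of w] by (auto intro!: front_sumI)
  moreover have "c u = c v" if "u \<in> size_subsets t (singletons (base C) \<oplus> C)"
    "v \<in> size_subsets t (singletons (base C) \<oplus> C)" "Min u = Min v" for u v
  proof -
    have "u \<subseteq> t" "v \<subseteq> t" using that by (auto simp: size_subsets_def)
    moreover from this have "u \<in> one C" "v \<in> one C"
      using that one[of u] one[of v] t(2) by (auto simp: size_subsets_def)
    ultimately show ?thesis using t(3) that(3) unfolding min_hom_def by blast
  qed
  ultimately show ?thesis using t(2) by blast
qed

theorem theorem7p4:
  fixes k :: nat and A C :: "nat set set" and \<alpha> \<gamma> :: cordinal
  assumes "SD_barrier A" and "SD_barrier C"
    and "ht A = \<alpha>" and "ht C = \<gamma>"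
    and "final_segment (base A) (base C)"
  shows "\<exists>B. SD_barrier B \<and> base B = base A \<and> ht B \<le> veblen_log \<gamma> \<alpha> \<and>
    (\<forall>s \<in> singletons (base B) \<oplus> B.
      \<forall>c \<in> size_subsets s (singletons (base C) \<oplus> C) \<rightarrow> {..<k}.
        \<exists>t \<in> singletons (base C) \<oplus> C \<oplus> A. t \<subseteq> s \<and>
          (\<forall>u \<in> size_subsets t (singletons (base C) \<oplus> C).
           \<forall>v \<in> size_subsets t (singletons (base C) \<oplus> C).
             Min u = Min v \<longrightarrow> c u = c v))"
proof -
  let ?X = "base A"
  have A: "barrier A" "front A" using assms(1) by (auto simp: SD_barrier_def barrier_def)
  have X: "infinite ?X" "?X \<subseteq> base C"
    using infinite_base[OF A(2)] final_segment_subset[OF assms(5)] by auto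
  have fin: "finite s" "s \<subseteq> ?X" if "s \<in> A" for s
    using finite_front[OF A(2) that] that by (auto simp: base_def)
  have B: "\<exists>B. SD_barrier B \<and> base B = ?X \<and> ht B \<le> veblen_log \<gamma> \<alpha> \<and>
    (\<forall>s\<in>B. finite s \<and> s \<subseteq> ?X \<and> s \<in> pre ?X (good A C (\<lambda>_. k)))"
    using assms(2)
  proof (cases rule: veblen_log_cases)
    case 1
    have "s \<in> pre ?X (good A {{}} (\<lambda>_. k))" if "s \<in> A" for s
      using pre_good_degenerate that fin by blast
    \<comment> \<open>The bound is the identity, and \<open>A\<close> itself serves as
      \<open>B\<close>.\<close>
    then show ?thesis using 1 assms fin by (intro exI[of _ A]) auto
  next
    case 2
    then obtain b where b: "veblen_log \<gamma> \<alpha> = omega_pow b" using assms(4) by blast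
    \<comment> \<open>Restriction to finite sets gives the end closure that
      \<open>exists_exact_barrier\<close> asks for.\<close>
    let ?Q = "pre ?X (good A C (\<lambda>_. k)) \<inter> {s. finite s}"
    have "barred ?X A {} \<alpha>" using barred_iff_ht[OF A(2)] assms(3) by simp
    then have "barred ?X (pre ?X (good A C (\<lambda>_. k))) {} (omega_pow b)"
      using decomposable_minhom_bound[OF assms(2) X] assms(4) b unfolding minhom_bound_def by metis
    from barred_restrict_empty[OF this] have "barred ?X ?Q {} (omega_pow b)"
      by (rule barred_mono) auto
    from exists_exact_barrier[OF X(1) end_closed_pre_good this]
    obtain B where B: "B \<subseteq> ?Q" "exact_barrier ?X B (omega_pow b)" by blast
    note B' = exact_barrier_imp_barrier[OF X(1) B(2) omega_pow_bounds(1)]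
    have "decomposable B"
      unfolding decomposable_def
      by (rule exI[of _ "[b]"], rule exI[of _ "[B]"])
        (use B B' in \<open>auto simp: is_cnf_def exact_barrier_def\<close>)
    then have "SD_barrier B" using B B' by (auto simp: SD_barrier_def exact_barrier_def)
    then show ?thesis using B B' b by (intro exI[of _ B]) (auto simp: exact_barrier_def)
  qed
  then obtain B where B: "SD_barrier B" "base B = ?X" "ht B \<le> veblen_log \<gamma> \<alpha>"
    "\<And>s. s \<in> B \<Longrightarrow> finite s \<and> s \<subseteq> ?X \<and> s \<in> pre ?X (good A C (\<lambda>_. k))"
    by blast
  \<comment> \<open>Such a set is a member of \<open>B\<close> with one further element, as
    anticipated by \<open>pre\<close>.\<close>
  have good: "s \<in> good A C (\<lambda>_. k)" "s \<subseteq> base C" if s: "s \<in> singletons ?X \<oplus> B" for s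
  proof -
    obtain r y where "s = insert y r" "r \<in> B" "y \<in> ?X" "r \<lless> {y}"
      using s by (auto simp: singletons_def elim!: front_sumE)
    then show "s \<in> good A C (\<lambda>_. k)" "s \<subseteq> base C" using B(4)[of r] X(2) by (auto simp: pre_def)
  qed
  show ?thesis
    by (intro exI[of _ B] conjI ballI B(1-3), unfold B(2), rule good_conclusion) (rule good | assumption)+
qed

end
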